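(* Let $\alpha\in(1,2)$. Suppose $u_0(x)=c+m((-\infty,x])$ with $c\in\mathbb{R}$ and $m$ a finite signed Borel measure on $\mathbb{R}$, and let $u$ be the solution of $u_t+\Lambda^\alpha u+uu_x=0$, $u(\cdot,0)=u_0$. Then $u_x\in C((0,T];L^p(\mathbb{R}))$ for every $1\le p\le\infty$ and every $T>0$. Moreover, let $u$ and $\widetilde u$ be two such solutions with initial data $u_0$ and $\widetilde u_0$ of this form (with constants $c,\widetilde c$ and finite signed measures $m,\widetilde m$), suppose that $\widetilde u_x(x,t)\ge0$ for a.e. $x$ and all $t>0$, and that $u_0-\widetilde u_0\in L^1(\mathbb{R})$. Then $$\|u(t)-\widetilde u(t)\|_1\le\|u_0-\widetilde u_0\|_1\qquad\text{for all }t>0.$$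
   Context: $\Lambda^\alpha=(-\partial_x^2)^{\alpha/2}$ is defined by $\widehat{\Lambda^\alpha v}(\xi)=|\xi|^\alpha\widehat v(\xi)$; for bounded smooth functions and $\alpha\in(1,2)$ it is given by $\Lambda^\alpha w(x)=-C(\alpha)\int_{\mathbb{R}}\frac{w(x+z)-w(x)-w_x(x)z}{|z|^{1+\alpha}}dz$. For $u_0\in L^\infty(\mathbb{R})$, "the solution" means the unique function $u$ such that for all $T>0$: $u\in C_b((0,T)\times\mathbb{R})$, $u\in C_b^\infty((a,T)\times\mathbb{R})$ for every $a\in(0,T)$, $u$ satisfies the equation on $(0,T)\times\mathbb{R}$, and $u(\cdot,t)\to u_0$ weak-$*$ in $L^\infty(\mathbb{R})$ as $t\to0$. *)

theory Defs
  imports "HOL-Analysis.Analysis"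
begin

definition frac_const :: "real \<Rightarrow> real" where
  "frac_const \<alpha> = \<alpha> * 2 powr (\<alpha> - 1) * Gamma ((1 + \<alpha>) / 2) / (sqrt pi * Gamma (1 - \<alpha> / 2))"

definition frac_lap :: "real \<Rightarrow> (real \<Rightarrow> real) \<Rightarrow> real \<Rightarrow> real" where
  "frac_lap \<alpha> w x = - frac_const \<alpha> *
     (\<integral> z. (w (x + z) - w x - deriv w x * z) / \<bar>z\<bar> powr (1 + \<alpha>) \<partial>lborel)"

definition Cb_on :: "real set \<Rightarrow> (real \<Rightarrow> real \<Rightarrow> real) \<Rightarrow> bool" where
  "Cb_on I u \<longleftrightarrow> continuous_on (I \<times> UNIV) (\<lambda>(t, x). u t x)
                   \<and> bounded ((\<lambda>(t, x). u t x) ` (I \<times> UNIV))"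

text \<open>C_b^infinity on I x R (I open): all partial derivatives D i j = d_t^i d_x^j u exist,
  are continuous and bounded.\<close>
definition Cb_inf_on :: "real set \<Rightarrow> (real \<Rightarrow> real \<Rightarrow> real) \<Rightarrow> bool" where
  "Cb_inf_on I u \<longleftrightarrow> (\<exists>D :: nat \<Rightarrow> nat \<Rightarrow> real \<Rightarrow> real \<Rightarrow> real.
      (\<forall>t\<in>I. \<forall>x. D 0 0 t x = u t x) \<and>
      (\<forall>i j. \<forall>t\<in>I. \<forall>x.
          ((\<lambda>s. D i j s x) has_real_derivative D (Suc i) j t x) (at t) \<and>
          ((\<lambda>y. D i j t y) has_real_derivative D i (Suc j) t x) (at x)) \<and>
      (\<forall>i j. Cb_on I (D i j)))"

definition is_solution :: "real \<Rightarrow> (real \<Rightarrow> real) \<Rightarrow> (real \<Rightarrow> real \<Rightarrow> real) \<Rightarrow> bool" where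
  "is_solution \<alpha> u0 u \<longleftrightarrow>
     (\<forall>T>0. Cb_on {0<..<T} u \<and> (\<forall>a\<in>{0<..<T}. Cb_inf_on {a<..<T} u) \<and>
        (\<forall>t\<in>{0<..<T}. \<forall>x. deriv (\<lambda>s. u s x) t + frac_lap \<alpha> (u t) x + u t x * deriv (u t) x = 0)) \<and>
     (\<forall>\<phi>. integrable lborel \<phi> \<longrightarrow>
        ((\<lambda>t. \<integral> x. u t x * \<phi> x \<partial>lborel) \<longlongrightarrow> (\<integral> x. u0 x * \<phi> x \<partial>lborel)) (at_right 0))"

text \<open>u0(x) = c + m((-inf,x]) with m = M1 - M2 a finite signed Borel measure (Jordan decomposition).\<close>
definition measure_datum :: "(real \<Rightarrow> real) \<Rightarrow> bool" where
  "measure_datum u0 \<longleftrightarrow> (\<exists>c M1 M2. finite_measure M1 \<and> finite_measure M2 \<and>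
      sets M1 = sets borel \<and> sets M2 = sets borel \<and>
      u0 = (\<lambda>x. c + measure M1 {..x} - measure M2 {..x}))"

definition Lp_cont :: "real \<Rightarrow> real set \<Rightarrow> (real \<Rightarrow> real \<Rightarrow> real) \<Rightarrow> bool" where
  "Lp_cont p I f \<longleftrightarrow>
     (\<forall>t\<in>I. f t \<in> borel_measurable lborel \<and> integrable lborel (\<lambda>x. \<bar>f t x\<bar> powr p)) \<and>
     (\<forall>t0\<in>I. ((\<lambda>t. (\<integral> x. \<bar>f t x - f t0 x\<bar> powr p \<partial>lborel) powr (1 / p)) \<longlongrightarrow> 0) (at t0 within I))"

definition Linf_cont :: "real set \<Rightarrow> (real \<Rightarrow> real \<Rightarrow> real) \<Rightarrow> bool" where
  "Linf_cont I f \<longleftrightarrow>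
     (\<forall>t\<in>I. f t \<in> borel_measurable lborel \<and> (\<exists>C. AE x in lborel. \<bar>f t x\<bar> \<le> C)) \<and>
     (\<forall>t0\<in>I. \<forall>\<epsilon>>0. \<exists>\<delta>>0. \<forall>t\<in>I. \<bar>t - t0\<bar> < \<delta> \<longrightarrow> (AE x in lborel. \<bar>f t x - f t0 x\<bar> \<le> \<epsilon>))"

end

(*
  Let L = - Lambda^alpha, approximated by the bounded jump operators L_eps of the truncated Levy
  measures c 1_{|z| >= eps} |z|^(-1-alpha) dz; on C^2_b functions the error is o(1) times the C^2 norm.

  The weak-* initial condition is turned into a strong one by a gradient bound that does not see
  the data: at a near maximum of |u_x| one has L|u_x| <= - c |u_x|^(1+alpha) / |u|_oo^alpha, and since
  alpha > 1 this beats the quadratic term, so that |u_x(t)| <= A t^(-1/alpha). Hence the nonlinearity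
  is a source which is integrable in time near t = 0.

  For the difference w = u - v one has w_t + (b w)_x = L w with b = (u + v) / 2. Kato's inequality
  with the weight (1 + (x/R)^2)^(-(1+alpha)/4), which satisfies |L_eps psi| + |psi'| <= C psi / R uniformly
  in eps and is integrable because 1 < (1+alpha)/2 < alpha, bounds the weighted norm of w(t) by that of
  w(a). For the remaining time interval (0, a) the equation is averaged over [x, x + delta]: averages
  of w(s) converge pointwise to averages of w(0), and the source only contributes O(a^(1-1/alpha)).
  Letting a -> 0 and R -> oo gives the contraction.

  Applied to u and its translates, the contraction bounds u_x(t) in L^1 by the total variation of u_0.
  Kato's inequality for u_x with a weight that lives near infinity shows that no mass escapes, which
  gives continuity into L^1; uniform continuity and interpolation give the other exponents.
*)

theory Submission
  imports Defs
begin

section \<open>Second order expansions and the fractional Laplacian\<close>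

text \<open>Weak-* convergence at time 0 gives no norm convergence of w(a) as a -> 0, so the
  comparison with the data must pass through quantities that are continuous for weak-* limits, such
  as averages over short intervals. Averaging commutes with translation invariant linear operators,
  but not with the product u u_x. Hence the nonlinearity has to become a source near t = 0, and a
  time-integrable bound on u_x that depends on u only through its sup norm is indispensable.

  Truncating small jumps makes all operators bounded and self-adjoint by Fubini, and reduces Kato's
  inequality to convexity of a function of one variable; C^2 norms, which may degenerate as t -> 0,
  multiply only errors that vanish in the limit. One exponent, (1+\<alpha>)/2, rules both the growth
  allowed for increments and the decay of the weights: above 1, it dominates the linear compensator
  and makes the weights integrable; below \<alpha>, it is integrable against the Levy measure at
  infinity. The order of limits matters: the mass of the weight grows with R, so a -> 0 is taken
  with R fixed.\<close>

definition growth :: "real \<Rightarrow> real \<Rightarrow> real" where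
  "growth \<alpha> z = min (z\<^sup>2) (\<bar>z\<bar> powr ((1 + \<alpha>) / 2))"

definition C2_bounded :: "(real \<Rightarrow> real) \<Rightarrow> (real \<Rightarrow> real) \<Rightarrow> (real \<Rightarrow> real) \<Rightarrow> real \<Rightarrow> bool" where
  "C2_bounded f f1 f2 B \<longleftrightarrow> (\<forall>x. (f has_real_derivative f1 x) (at x) \<and>
     (f1 has_real_derivative f2 x) (at x) \<and> \<bar>f x\<bar> \<le> B \<and> \<bar>f1 x\<bar> \<le> B \<and> \<bar>f2 x\<bar> \<le> B)"

lemma growth_nonneg: "0 \<le> growth \<alpha> z"
  by (simp add: growth_def)

lemma growth_measurable [measurable]: "growth \<alpha> \<in> borel_measurable borel"
  unfolding growth_def by measurable

lemma growth_small:
  assumes "1 < \<alpha>" "\<alpha> < 2" "\<bar>z\<bar> \<le> 1"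
  shows "growth \<alpha> z = z\<^sup>2"
proof (cases "z = 0")
  case False
  have "\<bar>z\<bar> powr 2 \<le> \<bar>z\<bar> powr ((1 + \<alpha>) / 2)"
    using assms False by (intro powr_mono') auto
  then show ?thesis using False by (simp add: growth_def min_def)
qed (simp add: growth_def)

lemma growth_large:
  assumes "1 < \<alpha>" "\<alpha> < 2" "1 \<le> \<bar>z\<bar>"
  shows "growth \<alpha> z = \<bar>z\<bar> powr ((1 + \<alpha>) / 2)"
proof -
  have "\<bar>z\<bar> powr ((1 + \<alpha>) / 2) \<le> \<bar>z\<bar> powr 2"
    using assms by (intro powr_mono) auto
  moreover have "\<bar>z\<bar> powr 2 = z\<^sup>2" using assms(3) by simp
  ultimately show ?thesis by (simp add: growth_def min_def)
qed

lemma abs_le_growth: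
  assumes "1 < \<alpha>" "\<alpha> < 2" "1 \<le> \<bar>z\<bar>"
  shows "\<bar>z\<bar> \<le> growth \<alpha> z" "1 \<le> growth \<alpha> z"
proof -
  have "\<bar>z\<bar> powr 1 \<le> \<bar>z\<bar> powr ((1 + \<alpha>) / 2)"
    using assms by (intro powr_mono) auto
  then show "\<bar>z\<bar> \<le> growth \<alpha> z" using assms growth_large by simp
  then show "1 \<le> growth \<alpha> z" using assms by simp
qed

section \<open>Power functions and integrability against the Levy kernel\<close>

lemma integrable_powr_near_0:
  fixes a :: real assumes "-1 < a"
  shows "integrable lborel (\<lambda>x. indicator {0..1} x * x powr a)"
proof -
  have "(\<lambda>x. x powr a) integrable_on {0..1}"
    using has_integral_powr_from_0[OF assms, of 1] by (auto simp: integrable_on_def)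
  then have "(\<lambda>x. x powr a) absolutely_integrable_on {0..1}"
    by (rule nonnegative_absolutely_integrable_1) auto
  then show ?thesis
    unfolding set_integrable_def by (subst (asm) integrable_completion) (auto)
qed

lemma integrable_powr_tail:
  fixes a :: real assumes "a < -1"
  shows "integrable lborel (\<lambda>x. indicator {1..} x * x powr a)"
proof -
  have "(\<lambda>x. x powr a) integrable_on {1..}"
    using has_integral_powr_to_inf[OF assms, of 1] by (auto simp: integrable_on_def)
  then have "(\<lambda>x. x powr a) absolutely_integrable_on {1..}"
    by (rule nonnegative_absolutely_integrable_1) auto
  then show ?thesis
    unfolding set_integrable_def by (subst (asm) integrable_completion) (auto)
qed

lemma integrable_lborel_reflect:
  fixes f :: "real \<Rightarrow> real"
  assumes "integrable lborel f" shows "integrable lborel (\<lambda>x. f (- x))"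
  using lborel_integrable_real_affine[OF assms, of "-1" 0] by simp

lemma integral_lborel_reflect:
  fixes f :: "real \<Rightarrow> real"
  shows "(LBINT x. f (- x)) = (LBINT x. f x)"
  using lborel_integral_real_affine[of "-1" f 0] by simp

text \<open>The exponents that arise are 1 - \<alpha> > -1 near the origin and -(1 + \<alpha>)/2 <
  -1 at infinity. \<open>g\<close> collects the two one-sided majorants, and
  \<open>g z + g (- z)\<close> covers both signs of z.\<close>

lemma integrable_growth:
  assumes "1 < \<alpha>" "\<alpha> < 2"
  shows "integrable lborel (\<lambda>z. growth \<alpha> z / \<bar>z\<bar> powr (1 + \<alpha>))"
proof -
  define g where "g x = indicator {0..1} x * x powr (1 - \<alpha>) +
    indicator {1..} x * x powr ((1 + \<alpha>) / 2 - (1 + \<alpha>))" for x :: real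
  have g: "integrable lborel g" unfolding g_def
    using assms by (intro Bochner_Integration.integrable_add integrable_powr_near_0 integrable_powr_tail) auto
  have pos: "growth \<alpha> z / \<bar>z\<bar> powr (1 + \<alpha>) \<le> g z" if "0 < z" for z
  proof (cases "z \<le> 1")
    case True
    have "growth \<alpha> z / \<bar>z\<bar> powr (1 + \<alpha>) = z powr 2 / z powr (1 + \<alpha>)"
      using True that assms by (simp add: growth_small)
    also have "\<dots> = z powr (1 - \<alpha>)" by (simp flip: powr_diff)
    also have "\<dots> \<le> g z" using True that by (simp add: g_def)
    finally show ?thesis .
  next
    case False
    then have "growth \<alpha> z / \<bar>z\<bar> powr (1 + \<alpha>) = z powr ((1 + \<alpha>) / 2 - (1 + \<alpha>))"
      using that assms by (simp add: growth_large powr_diff)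
    also have "\<dots> \<le> g z" using False that by (simp add: g_def)
    finally show ?thesis .
  qed
  have g0: "0 \<le> g z" for z by (simp add: g_def)
  have ev: "growth \<alpha> (- z) = growth \<alpha> z" for z by (simp add: growth_def)
  show ?thesis
  proof (rule Bochner_Integration.integrable_bound)
    show "integrable lborel (\<lambda>z. g z + g (- z))"
      using g integrable_lborel_reflect by (intro Bochner_Integration.integrable_add)
    show "AE z in lborel. norm (growth \<alpha> z / \<bar>z\<bar> powr (1 + \<alpha>)) \<le> norm (g z + g (- z))"
    proof (rule AE_I2)
      fix z :: real
      consider "z = 0" | "z > 0" | "z < 0" by linarith
      then show "norm (growth \<alpha> z / \<bar>z\<bar> powr (1 + \<alpha>)) \<le> norm (g z + g (- z))"
      proof cases
        case 2 then show ?thesis using pos[of z] g0[of z] g0[of "-z"] growth_nonneg[of \<alpha> z] by simp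
      next
        case 3 then show ?thesis using pos[of "-z"] g0[of z] g0[of "-z"] growth_nonneg[of \<alpha> z] by (simp add: ev)
      qed simp
    qed
  qed measurable
qed

section \<open>Taylor estimates with explicit constants\<close>

lemma deriv_bound_lipschitz:
  fixes f :: "real \<Rightarrow> real"
  assumes "convex S" "\<And>x. x \<in> S \<Longrightarrow> (f has_real_derivative f' x) (at x)"
    and "\<And>x. x \<in> S \<Longrightarrow> \<bar>f' x\<bar> \<le> B" "x \<in> S" "y \<in> S"
  shows "\<bar>f x - f y\<bar> \<le> B * \<bar>x - y\<bar>"
  using field_differentiable_bound[of S f f' B x y] assms
  by (auto simp: has_field_derivative_at_within)

text \<open>The mean value inequality is applied twice, hence the constant K instead of K/2. The
  bound on \<open>f2\<close> is asked only within distance |z| of x, because for the decaying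
  weights it will be proportional to the value of the weight at x.\<close>

lemma taylor2_bound:
  fixes f :: "real \<Rightarrow> real"
  assumes "\<And>y. \<bar>y - x\<bar> \<le> \<bar>z\<bar> \<Longrightarrow> (f has_real_derivative f1 y) (at y)"
    and "\<And>y. \<bar>y - x\<bar> \<le> \<bar>z\<bar> \<Longrightarrow> (f1 has_real_derivative f2 y) (at y)"
    and "\<And>y. \<bar>y - x\<bar> \<le> \<bar>z\<bar> \<Longrightarrow> \<bar>f2 y\<bar> \<le> K"
  shows "\<bar>f (x + z) - f x - f1 x * z\<bar> \<le> K * z\<^sup>2"
proof -
  let ?S = "cball x \<bar>z\<bar>"
  have mem: "y \<in> ?S \<longleftrightarrow> \<bar>y - x\<bar> \<le> \<bar>z\<bar>" for y by (auto simp: dist_real_def abs_minus_commute)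
  have K0: "0 \<le> K" using assms(3)[of x] by auto
  have 1: "\<bar>f1 y - f1 x\<bar> \<le> K * \<bar>z\<bar>" if "y \<in> ?S" for y
  proof -
    have "\<bar>f1 y - f1 x\<bar> \<le> K * \<bar>y - x\<bar>"
      using that assms(2,3) mem by (intro deriv_bound_lipschitz[of ?S f1 f2]) auto
    also have "\<dots> \<le> K * \<bar>z\<bar>" using that mem K0 by (intro mult_left_mono) auto
    finally show ?thesis .
  qed
  have "\<bar>(f (x + z) - f1 x * (x + z)) - (f x - f1 x * x)\<bar> \<le> (K * \<bar>z\<bar>) * \<bar>(x + z) - x\<bar>"
    by (rule deriv_bound_lipschitz[of ?S _ "\<lambda>y. f1 y - f1 x"])
       (use assms(1) mem 1 in \<open>auto intro!: derivative_eq_intros simp: mem\<close>)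
  then show ?thesis by (simp add: algebra_simps power2_eq_square)
qed

lemma C2_boundedD:
  assumes "C2_bounded f f1 f2 B"
  shows "(f has_real_derivative f1 x) (at x)" "(f1 has_real_derivative f2 x) (at x)"
    "\<bar>f x\<bar> \<le> B" "\<bar>f1 x\<bar> \<le> B" "\<bar>f2 x\<bar> \<le> B" "0 \<le> B"
  using assms unfolding C2_bounded_def by (auto intro: order_trans[OF abs_ge_zero])

lemma C2_bounded_compensated_square:
  assumes "C2_bounded f f1 f2 B"
  shows "\<bar>f (x + z) - f x - f1 x * z\<bar> \<le> B * z\<^sup>2"
  by (rule taylor2_bound[of _ _ _ _ f2]) (use C2_boundedD[OF assms] in auto)

text \<open>Beyond |z| = 1 the three terms are estimated one by one by B, B and B |z|; since 1 \<le>
  |z| \<le> \<open>growth \<alpha> z\<close> there, 3 B suffices.\<close>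

lemma C2_bounded_compensated_growth:
  assumes "1 < \<alpha>" "\<alpha> < 2" "C2_bounded f f1 f2 B"
  shows "\<bar>f (x + z) - f x - f1 x * z\<bar> \<le> 3 * B * growth \<alpha> z"
proof (cases "\<bar>z\<bar> \<le> 1")
  case True
  have "\<bar>f (x + z) - f x - f1 x * z\<bar> \<le> B * z\<^sup>2" by (rule C2_bounded_compensated_square[OF assms(3)])
  also have "\<dots> \<le> 3 * B * z\<^sup>2" using C2_boundedD(6)[OF assms(3)] by (intro mult_right_mono) auto
  finally show ?thesis using growth_small[OF assms(1,2) True] by simp
next
  case False
  have "\<bar>f1 x * z\<bar> \<le> B * \<bar>z\<bar>"
    using C2_boundedD[OF assms(3)] by (simp add: abs_mult mult_right_mono)
  moreover have "\<bar>f (x + z)\<bar> \<le> B" "\<bar>f x\<bar> \<le> B" using C2_boundedD[OF assms(3)] by auto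
  ultimately have "\<bar>f (x + z) - f x - f1 x * z\<bar> \<le> 2 * B + B * \<bar>z\<bar>" by linarith
  also have "\<dots> \<le> 2 * B * growth \<alpha> z + B * growth \<alpha> z"
    using abs_le_growth[OF assms(1,2), of z] False C2_boundedD(6)[OF assms(3)]
    by (intro add_mono mult_left_mono) (auto simp: mult_le_cancel_left1)
  finally show ?thesis by simp
qed

lemma C2_bounded_measurable:
  assumes "C2_bounded f f1 f2 B"
  shows "f \<in> borel_measurable borel" "f1 \<in> borel_measurable borel"
  using C2_boundedD(1,2)[OF assms]
  by (auto intro!: borel_measurable_continuous_onI continuous_at_imp_continuous_on DERIV_isCont)

lemma integrable_compensated:
  assumes "1 < \<alpha>" "\<alpha> < 2" "C2_bounded f f1 f2 B"
  shows "integrable lborel (\<lambda>z. (f (x + z) - f x - f1 x * z) / \<bar>z\<bar> powr (1 + \<alpha>))"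
proof (rule Bochner_Integration.integrable_bound)
  note [measurable] = C2_bounded_measurable(1,2)[OF assms(3)]
  show "integrable lborel (\<lambda>z. 3 * B * (growth \<alpha> z / \<bar>z\<bar> powr (1 + \<alpha>)))"
    using integrable_growth[OF assms(1,2)] by (intro integrable_mult_right)
  show "(\<lambda>z. (f (x + z) - f x - f1 x * z) / \<bar>z\<bar> powr (1 + \<alpha>)) \<in> borel_measurable lborel"
    by measurable
  show "AE z in lborel. norm ((f (x + z) - f x - f1 x * z) / \<bar>z\<bar> powr (1 + \<alpha>))
    \<le> norm (3 * B * (growth \<alpha> z / \<bar>z\<bar> powr (1 + \<alpha>)))"
  proof (rule AE_I2)
    fix z
    have "norm ((f (x + z) - f x - f1 x * z) / \<bar>z\<bar> powr (1 + \<alpha>))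
      \<le> 3 * B * growth \<alpha> z / \<bar>z\<bar> powr (1 + \<alpha>)"
      using C2_bounded_compensated_growth[OF assms, of x z] by (auto intro!: divide_right_mono)
    also have "\<dots> \<le> norm (3 * B * (growth \<alpha> z / \<bar>z\<bar> powr (1 + \<alpha>)))" by (simp add: divide_right_mono)
    finally show "norm ((f (x + z) - f x - f1 x * z) / \<bar>z\<bar> powr (1 + \<alpha>))
      \<le> norm (3 * B * (growth \<alpha> z / \<bar>z\<bar> powr (1 + \<alpha>)))" .
  qed
qed

lemma frac_const_pos:
  assumes "1 < \<alpha>" "\<alpha> < 2" shows "0 < frac_const \<alpha>"
  unfolding frac_const_def using assms by (intro divide_pos_pos mult_pos_pos Gamma_real_pos) auto

lemma frac_lap_C2:
  assumes "C2_bounded f f1 f2 B"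
  shows "frac_lap \<alpha> f x = - frac_const \<alpha> *
     (\<integral> z. (f (x + z) - f x - f1 x * z) / \<bar>z\<bar> powr (1 + \<alpha>) \<partial>lborel)"
  using DERIV_imp_deriv[OF C2_boundedD(1)[OF assms]] by (simp add: frac_lap_def)

section \<open>Truncated stable Levy measures\<close>

definition levy_density :: "real \<Rightarrow> real \<Rightarrow> real \<Rightarrow> real" where
  "levy_density \<alpha> \<epsilon> z = frac_const \<alpha> * (indicator {z. \<epsilon> \<le> \<bar>z\<bar>} z / \<bar>z\<bar> powr (1 + \<alpha>))"

definition levy :: "real \<Rightarrow> real \<Rightarrow> real measure" where
  "levy \<alpha> \<epsilon> = density lborel (\<lambda>z. ennreal (levy_density \<alpha> \<epsilon> z))"

text \<open>The integral of \<open>growth\<close> under the full, untruncated Levy measure. It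
  bounds, uniformly in the truncation, the integral of everything dominated by
  \<open>growth\<close>.\<close>

definition levy_mass :: "real \<Rightarrow> real" where
  "levy_mass \<alpha> = frac_const \<alpha> * (LBINT z. growth \<alpha> z / \<bar>z\<bar> powr (1 + \<alpha>))"

text \<open>The part of that integral carried by the jumps shorter than \<epsilon>, which is what
  the truncation loses per unit of C^2 norm.\<close>

definition levy_error :: "real \<Rightarrow> real \<Rightarrow> real" where
  "levy_error \<alpha> \<epsilon> = frac_const \<alpha> *
     (LBINT z. indicator {z. \<bar>z\<bar> < \<epsilon>} z * (growth \<alpha> z / \<bar>z\<bar> powr (1 + \<alpha>)))"

lemma sets_levy [measurable_cong, simp]: "sets (levy \<alpha> \<epsilon>) = sets borel"
  by (simp add: levy_def)

lemma space_levy [simp]: "space (levy \<alpha> \<epsilon>) = UNIV"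
  by (simp add: levy_def)

lemma levy_density_measurable [measurable]: "levy_density \<alpha> \<epsilon> \<in> borel_measurable borel"
  unfolding levy_density_def by measurable

context
  fixes \<alpha> :: real
  assumes \<alpha>: "1 < \<alpha>" "\<alpha> < 2"
begin

lemma levy_density_nonneg: "0 \<le> levy_density \<alpha> \<epsilon> z"
  using frac_const_pos[OF \<alpha>] by (simp add: levy_density_def)

lemma levy_density_even: "levy_density \<alpha> \<epsilon> (- z) = levy_density \<alpha> \<epsilon> z"
  by (simp add: levy_density_def indicator_def)

lemma integral_levy:
  fixes f :: "real \<Rightarrow> real"
  assumes "f \<in> borel_measurable borel"
  shows "(\<integral>z. f z \<partial>levy \<alpha> \<epsilon>) = (LBINT z. levy_density \<alpha> \<epsilon> z * f z)"
  unfolding levy_def using assms levy_density_nonneg by (subst integral_density) auto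

lemma integrable_levy_iff:
  fixes f :: "real \<Rightarrow> real"
  assumes "f \<in> borel_measurable borel"
  shows "integrable (levy \<alpha> \<epsilon>) f \<longleftrightarrow> integrable lborel (\<lambda>z. levy_density \<alpha> \<epsilon> z * f z)"
  unfolding levy_def using assms levy_density_nonneg by (subst integrable_density) auto

text \<open>The majorant is integrated over the whole line, so the bound does not depend on
  \<epsilon>. This is the source of all estimates that are uniform in the truncation.\<close>

lemma levy_growth_bound:
  fixes f :: "real \<Rightarrow> real"
  assumes [measurable]: "f \<in> borel_measurable borel"
    and A: "0 \<le> A" "\<And>z. \<epsilon> \<le> \<bar>z\<bar> \<Longrightarrow> \<bar>f z\<bar> \<le> A * growth \<alpha> z"
  shows "integrable (levy \<alpha> \<epsilon>) f" "\<bar>\<integral>z. f z \<partial>levy \<alpha> \<epsilon>\<bar> \<le> A * levy_mass \<alpha>"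
proof -
  let ?g = "\<lambda>z. A * (frac_const \<alpha> * (growth \<alpha> z / \<bar>z\<bar> powr (1 + \<alpha>)))"
  have g: "integrable lborel ?g"
    using integrable_growth[OF \<alpha>] by (intro integrable_mult_right)
  have le: "\<bar>levy_density \<alpha> \<epsilon> z * f z\<bar> \<le> ?g z" for z
  proof (cases "\<epsilon> \<le> \<bar>z\<bar>")
    case True
    have "\<bar>levy_density \<alpha> \<epsilon> z * f z\<bar> \<le> levy_density \<alpha> \<epsilon> z * (A * growth \<alpha> z)"
      using A(2)[OF True] levy_density_nonneg by (simp add: abs_mult mult_left_mono)
    also have "\<dots> = ?g z" using True by (simp add: levy_density_def)
    finally show ?thesis .
  next
    case False
    then show ?thesis using A(1) frac_const_pos[OF \<alpha>] growth_nonneg[of \<alpha> z] by (simp add: levy_density_def)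
  qed
  have i: "integrable lborel (\<lambda>z. levy_density \<alpha> \<epsilon> z * f z)"
    by (rule Bochner_Integration.integrable_bound[OF g]) (use order_trans[OF le abs_ge_self] in auto)
  then show "integrable (levy \<alpha> \<epsilon>) f" by (simp add: integrable_levy_iff)
  have "\<bar>\<integral>z. levy_density \<alpha> \<epsilon> z * f z \<partial>lborel\<bar> \<le> (LBINT z. ?g z)"
    using Bochner_Integration.integral_norm_bound_integral[OF i g] le by auto
  moreover have "(LBINT z. ?g z) = A * levy_mass \<alpha>"
    by (simp only: integral_mult_right_zero levy_mass_def)
  ultimately show "\<bar>\<integral>z. f z \<partial>levy \<alpha> \<epsilon>\<bar> \<le> A * levy_mass \<alpha>"
    by (simp only: integral_levy[OF assms(1)])
qed

lemma levy_mass_nonneg: "0 \<le> levy_mass \<alpha>"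
  unfolding levy_mass_def using frac_const_pos[OF \<alpha>] growth_nonneg
  by (intro mult_nonneg_nonneg integral_nonneg_AE) auto

text \<open>Makes constants and the identity integrable under the truncated measure. The factors
  degenerate as \<epsilon> -> 0; they serve integrability only and enter no estimate.\<close>

lemma growth_lower:
  assumes "0 < \<epsilon>" "\<epsilon> \<le> 1" "\<epsilon> \<le> \<bar>z\<bar>"
  shows "1 \<le> 1 / \<epsilon>\<^sup>2 * growth \<alpha> z" "\<bar>z\<bar> \<le> 1 / \<epsilon> * growth \<alpha> z"
proof -
  have "1 \<le> 1 / \<epsilon>\<^sup>2 * growth \<alpha> z \<and> \<bar>z\<bar> \<le> 1 / \<epsilon> * growth \<alpha> z"
  proof (cases "\<bar>z\<bar> \<le> 1")
    case True
    have "\<epsilon>\<^sup>2 \<le> z\<^sup>2" using power_mono[of \<epsilon> "\<bar>z\<bar>" 2] assms by simp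
    moreover have "\<bar>z\<bar> * \<epsilon> \<le> z\<^sup>2" using mult_left_mono[of \<epsilon> "\<bar>z\<bar>" "\<bar>z\<bar>"] assms by (simp add: power2_eq_square)
    ultimately show ?thesis using growth_small[OF \<alpha> True] assms by (simp add: field_simps)
  next
    case False
    then have g: "\<bar>z\<bar> \<le> growth \<alpha> z" "1 \<le> growth \<alpha> z" using abs_le_growth[OF \<alpha>] by auto
    have "\<epsilon>\<^sup>2 \<le> 1" using assms by (simp add: power_le_one)
    moreover have "\<bar>z\<bar> * \<epsilon> \<le> \<bar>z\<bar>" using assms by (simp add: mult_left_le)
    ultimately show ?thesis using g assms by (simp add: field_simps)
  qed
  then show "1 \<le> 1 / \<epsilon>\<^sup>2 * growth \<alpha> z" "\<bar>z\<bar> \<le> 1 / \<epsilon> * growth \<alpha> z" by auto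
qed

lemma finite_measure_levy:
  assumes "0 < \<epsilon>" "\<epsilon> \<le> 1" shows "finite_measure (levy \<alpha> \<epsilon>)"
proof -
  have "integrable (levy \<alpha> \<epsilon>) (\<lambda>_. 1 :: real)"
    using growth_lower(1)[OF assms] assms by (intro levy_growth_bound(1)[of _ "1 / \<epsilon>\<^sup>2"]) auto
  then show ?thesis by (intro finite_measureI) (auto simp: integrable_iff_bounded)
qed

lemma integral_levy_reflect:
  fixes f :: "real \<Rightarrow> real"
  assumes [measurable]: "f \<in> borel_measurable borel"
  shows "(\<integral>z. f (- z) \<partial>levy \<alpha> \<epsilon>) = (\<integral>z. f z \<partial>levy \<alpha> \<epsilon>)"
  using integral_lborel_reflect[of "\<lambda>z. levy_density \<alpha> \<epsilon> z * f z"]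
  by (simp add: integral_levy levy_density_even)

lemma integrable_levy_id:
  assumes "0 < \<epsilon>" "\<epsilon> \<le> 1" shows "integrable (levy \<alpha> \<epsilon>) (\<lambda>z. z)"
  using growth_lower(2)[OF assms] assms by (intro levy_growth_bound(1)[of _ "1 / \<epsilon>"]) auto

text \<open>By symmetry the compensator \<open>f1 x * z\<close> has integral zero, so it can be
  inserted into or removed from a truncated jump integral at no cost; the truncated operators are
  therefore written without it.\<close>

lemma integral_levy_id: "(\<integral>z. z \<partial>levy \<alpha> \<epsilon>) = 0"
  using integral_levy_reflect[of "\<lambda>z. z" \<epsilon>] by simp

lemma levy_bounded_integrable:
  fixes f :: "real \<Rightarrow> real"
  assumes "0 < \<epsilon>" "\<epsilon> \<le> 1" "f \<in> borel_measurable borel" "\<And>x. \<bar>f x\<bar> \<le> B"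
  shows "integrable (levy \<alpha> \<epsilon>) f"
proof -
  interpret finite_measure "levy \<alpha> \<epsilon>" by (rule finite_measure_levy[OF assms(1,2)])
  have "f \<in> borel_measurable (levy \<alpha> \<epsilon>)" using assms(3) by (simp add: measurable_cong_sets[OF sets_levy refl])
  then show ?thesis using assms(4) by (intro integrable_const_bound[of _ B]) auto
qed

lemma levy_weight_bound:
  assumes "0 < \<epsilon>" "\<epsilon> \<le> 1" and [measurable]: "f \<in> borel_measurable borel" and "\<And>x. \<bar>f x\<bar> \<le> B"
    and A: "0 \<le> A" "\<And>z. \<bar>f (x + z) - f x - d * z\<bar> \<le> A * growth \<alpha> z"
  shows "\<bar>\<integral>z. f (x + z) - f x \<partial>levy \<alpha> \<epsilon>\<bar> \<le> A * levy_mass \<alpha>"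
proof -
  have i: "integrable (levy \<alpha> \<epsilon>) (\<lambda>z. f (x + z) - f x)"
  proof (rule levy_bounded_integrable[OF assms(1,2), where B="2 * B"])
    show "\<bar>f (x + z) - f x\<bar> \<le> 2 * B" for z using assms(4)[of "x + z"] assms(4)[of x] by linarith
  qed measurable
  have d: "integrable (levy \<alpha> \<epsilon>) (\<lambda>z. d * z)" "(\<integral>z. d * z \<partial>levy \<alpha> \<epsilon>) = 0"
    using integrable_levy_id[OF assms(1,2)] by (simp_all add: integral_levy_id)
  have "(\<integral>z. f (x + z) - f x \<partial>levy \<alpha> \<epsilon>) = (\<integral>z. f (x + z) - f x - d * z \<partial>levy \<alpha> \<epsilon>)"
    using Bochner_Integration.integral_diff[OF i d(1)] d(2) by simp
  moreover have "\<bar>\<integral>z. f (x + z) - f x - d * z \<partial>levy \<alpha> \<epsilon>\<bar> \<le> A * levy_mass \<alpha>"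
    by (rule levy_growth_bound(2)) (use A in auto)
  ultimately show ?thesis by simp
qed

text \<open>\<open>frac_lap\<close> carries a minus sign, so the sum is a difference of operators.
  With the compensator inserted, the integrands cancel for |z| \<ge> \<epsilon>, and for |z| <
  \<epsilon> \<le> 1 Taylor gives B z^2, which is B times \<open>growth\<close>.\<close>

lemma levy_approx:
  assumes "0 < \<epsilon>" "\<epsilon> \<le> 1" "C2_bounded f f1 f2 B"
  shows "\<bar>frac_lap \<alpha> f x + (\<integral>z. f (x + z) - f x \<partial>levy \<alpha> \<epsilon>)\<bar> \<le> B * levy_error \<alpha> \<epsilon>"
proof -
  note [measurable] = C2_bounded_measurable(1,2)[OF assms(3)]
  let ?h = "\<lambda>z. f (x + z) - f x - f1 x * z"
  let ?k = "\<lambda>z. ?h z / \<bar>z\<bar> powr (1 + \<alpha>)"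
  note fD = C2_boundedD[OF assms(3)]
  have i: "integrable (levy \<alpha> \<epsilon>) (\<lambda>z. f (x + z) - f x)"
  proof (rule levy_bounded_integrable[OF assms(1,2), where B="2 * B"])
    show "\<bar>f (x + z) - f x\<bar> \<le> 2 * B" for z using fD(3)[of "x + z"] fD(3)[of x] by linarith
  qed measurable
  have d: "integrable (levy \<alpha> \<epsilon>) (\<lambda>z. f1 x * z)" "(\<integral>z. f1 x * z \<partial>levy \<alpha> \<epsilon>) = 0"
    using integrable_levy_id[OF assms(1,2)] by (simp_all add: integral_levy_id)
  have i2: "integrable (levy \<alpha> \<epsilon>) ?h"
    by (rule Bochner_Integration.integrable_diff[OF i d(1)])
  have "(\<integral>z. f (x + z) - f x \<partial>levy \<alpha> \<epsilon>) = (\<integral>z. ?h z \<partial>levy \<alpha> \<epsilon>)"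
    using Bochner_Integration.integral_diff[OF i d(1)] d(2) by simp
  also have "\<dots> = (LBINT z. levy_density \<alpha> \<epsilon> z * ?h z)" by (simp add: integral_levy)
  finally have e1: "(\<integral>z. f (x + z) - f x \<partial>levy \<alpha> \<epsilon>) = (LBINT z. levy_density \<alpha> \<epsilon> z * ?h z)" .
  have ik: "integrable lborel (\<lambda>z. frac_const \<alpha> * ?k z)"
    by (intro integrable_mult_right integrable_compensated[OF \<alpha> assms(3)])
  have il: "integrable lborel (\<lambda>z. levy_density \<alpha> \<epsilon> z * ?h z)"
    using i2 by (simp add: integrable_levy_iff)
  have "frac_lap \<alpha> f x = - (LBINT z. frac_const \<alpha> * ?k z)"
    by (simp only: frac_lap_C2[OF assms(3)] integral_mult_right_zero mult_minus_left)
  then have eq: "frac_lap \<alpha> f x + (\<integral>z. f (x + z) - f x \<partial>levy \<alpha> \<epsilon>)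
    = (LBINT z. levy_density \<alpha> \<epsilon> z * ?h z - frac_const \<alpha> * ?k z)"
    using Bochner_Integration.integral_diff[OF il ik] e1 by linarith
  let ?g = "\<lambda>z. B * (frac_const \<alpha> * (indicator {z. \<bar>z\<bar> < \<epsilon>} z * (growth \<alpha> z / \<bar>z\<bar> powr (1 + \<alpha>))))"
  have ig: "integrable lborel ?g"
    by (intro integrable_mult_right Bochner_Integration.integrable_bound[OF integrable_growth[OF \<alpha>]] AE_I2)
       (auto split: split_indicator)
  have le: "norm (levy_density \<alpha> \<epsilon> z * ?h z - frac_const \<alpha> * ?k z) \<le> ?g z" for z
  proof (cases "\<epsilon> \<le> \<bar>z\<bar>")
    case False
    then have "\<bar>?h z\<bar> \<le> B * growth \<alpha> z"
      using C2_bounded_compensated_square[OF assms(3), of x z] growth_small[OF \<alpha>, of z] assms(2) by simp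
    then have "frac_const \<alpha> * (\<bar>?h z\<bar> / \<bar>z\<bar> powr (1 + \<alpha>)) \<le> frac_const \<alpha> * (B * growth \<alpha> z / \<bar>z\<bar> powr (1 + \<alpha>))"
      using frac_const_pos[OF \<alpha>] by (intro mult_left_mono divide_right_mono) auto
    then show ?thesis using False frac_const_pos[OF \<alpha>]
      by (simp add: levy_density_def abs_mult mult_ac)
  qed (simp add: levy_density_def)
  have "norm (LBINT z. levy_density \<alpha> \<epsilon> z * ?h z - frac_const \<alpha> * ?k z) \<le> (LBINT z. ?g z)"
    by (rule Bochner_Integration.integral_norm_bound_integral[OF Bochner_Integration.integrable_diff[OF il ik] ig le])
  also have "(LBINT z. ?g z) = B * levy_error \<alpha> \<epsilon>"
    by (simp only: integral_mult_right_zero levy_error_def)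
  finally show ?thesis unfolding eq by simp
qed

lemma levy_error_tendsto: "((\<lambda>\<epsilon>. levy_error \<alpha> \<epsilon>) \<longlongrightarrow> 0) (at_right 0)"
proof -
  let ?s = "\<lambda>(\<epsilon>::real) (z::real). indicator {z. \<bar>z\<bar> < \<epsilon>} z * (growth \<alpha> z / \<bar>z\<bar> powr (1 + \<alpha>))"
  have "((\<lambda>\<epsilon>. (LBINT z. ?s \<epsilon> z)) \<longlongrightarrow> 0) (at_right 0)"
  proof (subst tendsto_at_iff_sequentially, intro allI impI)
    fix X :: "nat \<Rightarrow> real" assume X: "\<forall>i. X i \<in> {0<..} - {0}" "X \<longlonglongrightarrow> 0"
    have "(\<lambda>i. LBINT z. ?s (X i) z) \<longlonglongrightarrow> (\<integral>z. (0::real) \<partial>(lborel::real measure))"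
    proof (rule integral_dominated_convergence[OF _ _ integrable_growth[OF \<alpha>]])
      show "AE z in lborel. (\<lambda>i. ?s (X i) z) \<longlonglongrightarrow> 0"
      proof (rule AE_I2)
        fix z :: real
        show "(\<lambda>i. ?s (X i) z) \<longlonglongrightarrow> 0"
        proof (cases "z = 0")
          case False
          then have "\<forall>\<^sub>F i in sequentially. X i < \<bar>z\<bar>" using X(2) by (intro order_tendstoD) auto
          then have "\<forall>\<^sub>F i in sequentially. ?s (X i) z = 0" by eventually_elim auto
          then show ?thesis by (rule tendsto_eventually)
        qed simp
      qed
      show "AE z in lborel. norm (?s (X i) z) \<le> growth \<alpha> z / \<bar>z\<bar> powr (1 + \<alpha>)" for i
        using growth_nonneg by (intro AE_I2) (auto split: split_indicator)
    qed measurable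
    then show "((\<lambda>\<epsilon>. LBINT z. ?s \<epsilon> z) \<circ> X) \<longlonglongrightarrow> 0" by (simp add: o_def)
  qed
  from tendsto_mult_left[OF this, of "frac_const \<alpha>"] show ?thesis by (simp add: levy_error_def)
qed

lemma levy_error_small:
  assumes "0 < e" "0 < \<rho>" obtains \<epsilon> where "0 < \<epsilon>" "\<epsilon> \<le> 1" "\<epsilon> \<le> \<rho>" "B * levy_error \<alpha> \<epsilon> < e"
proof -
  have "((\<lambda>\<epsilon>. B * levy_error \<alpha> \<epsilon>) \<longlongrightarrow> B * 0) (at_right 0)"
    by (intro tendsto_mult_left levy_error_tendsto)
  then have 1: "\<forall>\<^sub>F \<epsilon> in at_right 0. B * levy_error \<alpha> \<epsilon> < e" using assms by (intro order_tendstoD) auto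
  have 2: "\<forall>\<^sub>F \<epsilon> in at_right 0. \<epsilon> \<in> {0<..<min 1 \<rho>}" using assms by (intro eventually_at_right_real) auto
  obtain \<epsilon> where "B * levy_error \<alpha> \<epsilon> < e" "\<epsilon> \<in> {0<..<min 1 \<rho>}"
    using eventually_happens'[OF _ eventually_conj[OF 1 2]] by auto
  then show ?thesis by (intro that[of \<epsilon>]) auto
qed

text \<open>All jumps outside [\<rho>, 2\<rho>] are discarded, and on this interval the density is
  at least its value at 2\<rho>. The integral I is a gauge integral because it will come from the
  fundamental theorem of calculus.\<close>

lemma levy_lower:
  assumes "0 < \<epsilon>" "\<epsilon> \<le> \<rho>" "\<And>z. 0 \<le> k z" "integrable (levy \<alpha> \<epsilon>) k" and [measurable]: "k \<in> borel_measurable borel"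
    and "(k has_integral I) {\<rho>..2 * \<rho>}"
  shows "frac_const \<alpha> / (2 * \<rho>) powr (1 + \<alpha>) * I \<le> (\<integral>z. k z \<partial>levy \<alpha> \<epsilon>)"
proof -
  let ?c = "frac_const \<alpha> / (2 * \<rho>) powr (1 + \<alpha>)"
  have "k absolutely_integrable_on {\<rho>..2 * \<rho>}"
    by (rule nonnegative_absolutely_integrable_1) (use assms in auto)
  then have i: "integrable lborel (\<lambda>z. indicator {\<rho>..2*\<rho>} z * k z)"
    unfolding set_integrable_def by (subst (asm) integrable_completion) auto
  then have "set_integrable lborel {\<rho>..2*\<rho>} k" by (simp add: set_integrable_def)
  from set_borel_integral_eq_integral(2)[OF this]
  have I: "(LBINT z. indicator {\<rho>..2*\<rho>} z * k z) = I"
    using assms(6) by (simp add: set_lebesgue_integral_def has_integral_integrable_integral)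
  have "?c * I = (LBINT z. ?c * (indicator {\<rho>..2*\<rho>} z * k z))" by (simp add: I)
  also have "\<dots> \<le> (LBINT z. levy_density \<alpha> \<epsilon> z * k z)"
  proof (rule integral_mono)
    show "integrable lborel (\<lambda>z. ?c * (indicator {\<rho>..2*\<rho>} z * k z))" using i by (intro integrable_mult_right)
    show "integrable lborel (\<lambda>z. levy_density \<alpha> \<epsilon> z * k z)" using assms by (simp flip: integrable_levy_iff)
    fix z
    show "?c * (indicator {\<rho>..2*\<rho>} z * k z) \<le> levy_density \<alpha> \<epsilon> z * k z"
    proof (cases "z \<in> {\<rho>..2*\<rho>}")
      case True
      then have "\<bar>z\<bar> powr (1 + \<alpha>) \<le> (2 * \<rho>) powr (1 + \<alpha>)" using \<alpha> assms by (intro powr_mono2) auto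
      then have "?c \<le> frac_const \<alpha> / \<bar>z\<bar> powr (1 + \<alpha>)"
        using True assms frac_const_pos[OF \<alpha>] by (intro divide_left_mono mult_pos_pos) auto
      then have "?c * k z \<le> frac_const \<alpha> / \<bar>z\<bar> powr (1 + \<alpha>) * k z" using assms(3) by (rule mult_right_mono)
      then show ?thesis using True assms(1,2) by (simp add: levy_density_def)
    next
      case False
      then show ?thesis using assms(3) levy_density_nonneg by simp
    qed
  qed
  also have "\<dots> = (\<integral>z. k z \<partial>levy \<alpha> \<epsilon>)" by (simp add: integral_levy)
  finally show ?thesis .
qed

end

section \<open>Jump operators of finite symmetric measures\<close>

text \<open>The mean value inequality on the convex set I dominates all difference quotients by k;
  the limit is taken along sequences so that dominated convergence applies.\<close>

lemma has_derivative_lebesgue_integral: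
  fixes g :: "real \<Rightarrow> 'a \<Rightarrow> real"
  assumes "open I" "convex I" "\<tau> \<in> I" "integrable M k"
    and int: "\<And>s. s \<in> I \<Longrightarrow> integrable M (g s)"
    and D: "\<And>s x. s \<in> I \<Longrightarrow> x \<in> space M \<Longrightarrow> ((\<lambda>s. g s x) has_real_derivative g' s x) (at s)"
    and bnd: "\<And>s x. s \<in> I \<Longrightarrow> x \<in> space M \<Longrightarrow> \<bar>g' s x\<bar> \<le> k x"
    and meas: "g' \<tau> \<in> borel_measurable M"
  shows "((\<lambda>s. \<integral>x. g s x \<partial>M) has_real_derivative (\<integral>x. g' \<tau> x \<partial>M)) (at \<tau>)"
proof -
  have "((\<lambda>s. \<integral>x. g s x \<partial>M) has_real_derivative (\<integral>x. g' \<tau> x \<partial>M)) (at \<tau> within I)"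
    unfolding has_field_derivative_iff
  proof (subst tendsto_at_iff_sequentially, intro allI impI)
    fix X :: "nat \<Rightarrow> real" assume X: "\<forall>i. X i \<in> I - {\<tau>}" "X \<longlonglongrightarrow> \<tau>"
    have lim: "(\<lambda>i. \<integral>x. (g (X i) x - g \<tau> x) / (X i - \<tau>) \<partial>M) \<longlonglongrightarrow> (\<integral>x. g' \<tau> x \<partial>M)"
    proof (rule integral_dominated_convergence[OF meas _ \<open>integrable M k\<close>])
      show "(\<lambda>x. (g (X i) x - g \<tau> x) / (X i - \<tau>)) \<in> borel_measurable M" for i
        using borel_measurable_integrable[OF int[of "X i"]] borel_measurable_integrable[OF int[of \<tau>]] X assms(3) by auto
      show "AE x in M. (\<lambda>i. (g (X i) x - g \<tau> x) / (X i - \<tau>)) \<longlonglongrightarrow> g' \<tau> x"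
      proof (rule AE_I2)
        fix x assume x: "x \<in> space M"
        have "((\<lambda>s. (g s x - g \<tau> x) / (s - \<tau>)) \<longlongrightarrow> g' \<tau> x) (at \<tau> within I)"
          using D[OF assms(3) x] by (auto simp: has_field_derivative_iff intro: tendsto_within_subset)
        then show "(\<lambda>i. (g (X i) x - g \<tau> x) / (X i - \<tau>)) \<longlonglongrightarrow> g' \<tau> x"
          using X unfolding tendsto_at_iff_sequentially by (auto simp: o_def)
      qed
      show "AE x in M. norm ((g (X i) x - g \<tau> x) / (X i - \<tau>)) \<le> k x" for i
      proof (rule AE_I2)
        fix x assume x: "x \<in> space M"
        have "\<bar>g (X i) x - g \<tau> x\<bar> \<le> k x * \<bar>X i - \<tau>\<bar>"
          using X assms(2,3) D x bnd by (intro deriv_bound_lipschitz[of I _ "\<lambda>s. g' s x"]) auto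
        then show "norm ((g (X i) x - g \<tau> x) / (X i - \<tau>)) \<le> k x"
          using X(1)[rule_format, of i] by (simp add: field_simps)
      qed
    qed
    have eq: "(\<integral>x. (g (X i) x - g \<tau> x) / (X i - \<tau>) \<partial>M) = ((\<integral>x. g (X i) x \<partial>M) - (\<integral>x. g \<tau> x \<partial>M)) / (X i - \<tau>)" for i
      using Bochner_Integration.integral_diff[OF int[of "X i"] int[of \<tau>]] X assms(3) by simp
    show "((\<lambda>y. ((\<integral>x. g y x \<partial>M) - (\<integral>x. g \<tau> x \<partial>M)) / (y - \<tau>)) \<circ> X) \<longlonglongrightarrow> (\<integral>x. g' \<tau> x \<partial>M)"
      using lim unfolding eq by (simp add: o_def)
  qed
  then show ?thesis using at_within_open[OF assms(3,1)] by simp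
qed

lemma DERIV_borel_measurable:
  fixes f f' :: "real \<Rightarrow> real"
  assumes "\<And>x. (f has_real_derivative f' x) (at x)" shows "f \<in> borel_measurable borel"
  using assms by (intro borel_measurable_continuous_onI continuous_at_imp_continuous_on ballI DERIV_isCont)

lemma isCont_borel_measurable:
  fixes f :: "real \<Rightarrow> real"
  assumes "\<And>x. isCont f x" shows "f \<in> borel_measurable borel"
  using assms by (intro borel_measurable_continuous_onI continuous_at_imp_continuous_on ballI)

lemma integral_derivative_vanishing:
  fixes f f' :: "real \<Rightarrow> real"
  assumes "\<And>x. (f has_real_derivative f' x) (at x)" "\<And>x. isCont f' x" "integrable lborel f'"
    and "(f \<longlongrightarrow> 0) at_top" "(f \<longlongrightarrow> 0) at_bot"
  shows "(LBINT x. f' x) = 0"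
proof -
  have "(LBINT x=-\<infinity>..\<infinity>. f' x) = 0 - 0"
  proof (rule interval_integral_FTC_integrable)
    show "((f \<circ> real_of_ereal) \<longlongrightarrow> 0) (at_right (- \<infinity>))" "((f \<circ> real_of_ereal) \<longlongrightarrow> 0) (at_left \<infinity>)"
      using assms(4,5) by (simp_all add: at_right_MInf at_left_PInf filterlim_filtermap o_def)
  qed (use assms in \<open>auto simp: has_real_derivative_iff_has_vector_derivative set_integrable_def\<close>)
  then show ?thesis by (simp add: interval_lebesgue_integral_def set_lebesgue_integral_def)
qed

lemma integrable_mult_bounded:
  fixes f g :: "real \<Rightarrow> real"
  assumes g: "integrable lborel g" and f: "f \<in> borel_measurable borel" "\<And>x. \<bar>f x\<bar> \<le> B"
  shows "integrable lborel (\<lambda>x. f x * g x)"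
proof (rule Bochner_Integration.integrable_bound[OF integrable_mult_right[OF g, of B]])
  show "AE x in lborel. norm (f x * g x) \<le> norm (B * g x)"
  proof (rule AE_I2)
    fix x
    have "\<bar>f x\<bar> \<le> \<bar>B\<bar>" using f(2)[of x] by linarith
    then show "norm (f x * g x) \<le> norm (B * g x)" by (simp add: abs_mult mult_right_mono)
  qed
qed (use g f in measurable)

definition jump :: "real measure \<Rightarrow> (real \<Rightarrow> real) \<Rightarrow> real \<Rightarrow> real" where
  "jump N f x = (\<integral>z. f (x + z) - f x \<partial>N)"

locale symmetric_measure = finite_measure N for N :: "real measure" +
  assumes sets_N [measurable_cong]: "sets N = sets borel"
    and reflect: "\<And>f :: real \<Rightarrow> real. f \<in> borel_measurable borel \<Longrightarrow> (\<integral>z. f (- z) \<partial>N) = (\<integral>z. f z \<partial>N)"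
begin

lemma space_N [simp]: "space N = UNIV"
  using sets_eq_imp_space_eq[OF sets_N] by simp

lemma integrable_bounded:
  fixes f :: "real \<Rightarrow> real"
  assumes "f \<in> borel_measurable borel" "\<And>x. \<bar>f x\<bar> \<le> B" shows "integrable N f"
proof -
  have "f \<in> borel_measurable N" using assms(1) by (simp add: measurable_cong_sets[OF sets_N refl])
  then show ?thesis using assms(2) by (intro integrable_const_bound[of _ B]) auto
qed

lemma integrable_bounded_shift:
  fixes f :: "real \<Rightarrow> real"
  assumes [measurable]: "f \<in> borel_measurable borel" and "\<And>x. \<bar>f x\<bar> \<le> B"
  shows "integrable N (\<lambda>z. f (x + z))" "integrable N (\<lambda>z. f (x - z))"
  by (rule integrable_bounded[of _ B]; use assms(2) in \<open>simp\<close>)+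

lemma jump_measurable [measurable]:
  assumes [measurable]: "f \<in> borel_measurable borel"
  shows "jump N f \<in> borel_measurable borel"
  unfolding jump_def by measurable

lemma jump_eq:
  assumes "f \<in> borel_measurable borel" "\<And>x. \<bar>f x\<bar> \<le> B"
  shows "jump N f x = (\<integral>z. f (x + z) \<partial>N) - measure N UNIV * f x"
  unfolding jump_def using Bochner_Integration.integral_diff[OF integrable_bounded_shift(1)[OF assms] integrable_const]
  by simp

lemma abs_shift_integral_le:
  fixes f :: "real \<Rightarrow> real"
  assumes [measurable]: "f \<in> borel_measurable borel" and B: "\<And>x. \<bar>f x\<bar> \<le> B"
  shows "\<bar>\<integral>z. f (x + z) \<partial>N\<bar> \<le> measure N UNIV * B"
  using Bochner_Integration.integral_norm_bound_integral[OF integrable_bounded_shift(1)[OF assms] integrable_const, of x B] B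
  by simp

lemma abs_jump_le:
  assumes [measurable]: "f \<in> borel_measurable borel" and B: "\<And>x. \<bar>f x\<bar> \<le> B"
  shows "\<bar>jump N f x\<bar> \<le> 2 * measure N UNIV * B"
proof -
  have "\<bar>measure N UNIV * f x\<bar> \<le> measure N UNIV * B"
    using B by (simp add: abs_mult mult_left_mono)
  then show ?thesis
    using abs_shift_integral_le[OF assms, of x] unfolding jump_eq[OF assms] by linarith
qed

text \<open>Fubini for f(x + z) g(x), which is integrable on the product since N is finite, f
  bounded and g integrable. The substitution x -> x - z moves the shift onto g, and the symmetry of
  N turns g(x - z) into g(x + z); the terms with the total mass of N coincide.\<close>

lemma jump_self_adjoint:
  assumes f [measurable]: "f \<in> borel_measurable borel" and B: "\<And>x. \<bar>f x\<bar> \<le> B"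
    and g: "integrable lborel g" and B': "\<And>x. \<bar>g x\<bar> \<le> B'"
  shows "(LBINT x. jump N f x * g x) = (LBINT x. f x * jump N g x)"
    and "integrable lborel (\<lambda>x. f x * jump N g x)"
proof -
  interpret P: pair_sigma_finite lborel N ..
  interpret Q: pair_sigma_finite N lborel ..
  have gm [measurable]: "g \<in> borel_measurable borel" using g by auto
  have B0: "0 \<le> B" using B[of 0] by linarith
  let ?F = "\<lambda>x z. f (x + z) * g x"
  let ?G = "\<lambda>z x. f x * g (x - z)"
  have gs: "integrable lborel (\<lambda>x. g (x - z))" for z
    using lborel_integrable_real_affine[OF g, of 1 "- z"] by (simp add: add.commute)
  have F: "integrable (lborel \<Otimes>\<^sub>M N) (case_prod ?F)"
  proof (rule P.Fubini_integrable)
    show "integrable lborel (\<lambda>x. \<integral>z. norm (case_prod ?F (x, z)) \<partial>N)"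
    proof (rule Bochner_Integration.integrable_bound[OF integrable_mult_right[OF g, of "measure N UNIV * B"]])
      show "AE x in lborel. norm (\<integral>z. norm (case_prod ?F (x, z)) \<partial>N) \<le> norm (measure N UNIV * B * g x)"
      proof (rule AE_I2)
        fix x
        have "norm (\<integral>z. norm (case_prod ?F (x, z)) \<partial>N) = (\<integral>z. \<bar>f (x + z)\<bar> \<partial>N) * \<bar>g x\<bar>"
          by (simp add: abs_mult)
        also have "\<dots> \<le> (measure N UNIV * B) * \<bar>g x\<bar>"
          using abs_shift_integral_le[of "\<lambda>x. \<bar>f x\<bar>" B x] B by (intro mult_right_mono) auto
        finally show "norm (\<integral>z. norm (case_prod ?F (x, z)) \<partial>N) \<le> norm (measure N UNIV * B * g x)"
          using B0 by (simp add: abs_mult)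
      qed
    qed measurable
    show "AE x in lborel. integrable N (\<lambda>z. case_prod ?F (x, z))"
      using integrable_bounded_shift(1)[OF f B] by auto
  qed measurable
  have G: "integrable (N \<Otimes>\<^sub>M lborel) (case_prod ?G)"
  proof (rule Q.Fubini_integrable)
    show "AE z in N. integrable lborel (\<lambda>x. case_prod ?G (z, x))"
      using integrable_mult_bounded[OF gs f B] by auto
    have b: "(LBINT x. \<bar>f x\<bar> * \<bar>g (x - z)\<bar>) \<le> B * (LBINT x. \<bar>g x\<bar>)" for z
    proof -
      have "(LBINT x. \<bar>f x\<bar> * \<bar>g (x - z)\<bar>) \<le> (LBINT x. B * \<bar>g (x - z)\<bar>)"
        using integrable_abs[OF integrable_mult_bounded[OF gs f B, of z]] gs[of z] B
        by (intro integral_mono) (auto simp: mult_right_mono abs_mult)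
      also have "\<dots> = B * (LBINT x. \<bar>g (x - z)\<bar>)" by simp
      also have "(LBINT x. \<bar>g (x - z)\<bar>) = (LBINT x. \<bar>g x\<bar>)"
        using lborel_integral_real_affine[of 1 "\<lambda>x. \<bar>g x\<bar>" "- z"] by (simp add: add.commute)
      finally show ?thesis .
    qed
    show "integrable N (\<lambda>z. LBINT x. norm (case_prod ?G (z, x)))"
    proof (rule integrable_bounded[of _ "B * (LBINT x. \<bar>g x\<bar>)"])
      show "\<bar>\<integral>x. norm (case_prod ?G (z, x)) \<partial>lborel\<bar> \<le> B * (LBINT x. \<bar>g x\<bar>)" for z
        using b[of z] by (simp add: abs_mult)
    qed measurable
  qed measurable
  have "(\<integral>x. (\<integral>z. f (x + z) \<partial>N) * g x \<partial>lborel) = (\<integral>x. \<integral>z. ?F x z \<partial>N \<partial>lborel)" by simp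
  also have "\<dots> = (\<integral>z. \<integral>x. ?F x z \<partial>lborel \<partial>N)" using P.Fubini_integral[OF F] by simp
  also have "\<dots> = (\<integral>z. \<integral>x. ?G z x \<partial>lborel \<partial>N)"
  proof (rule Bochner_Integration.integral_cong[OF refl])
    show "(LBINT x. ?F x z) = (LBINT x. ?G z x)" for z
      using lborel_integral_real_affine[of 1 "\<lambda>x. ?F x z" "- z"] by (simp add: add.commute)
  qed
  also have "\<dots> = (\<integral>x. \<integral>z. ?G z x \<partial>N \<partial>lborel)" using Q.Fubini_integral[OF G] by simp
  also have "\<dots> = (\<integral>x. f x * (\<integral>z. g (x + z) \<partial>N) \<partial>lborel)"
    using reflect[of "\<lambda>z. g (_ + z)"] by simp
  finally have eq: "(\<integral>x. (\<integral>z. f (x + z) \<partial>N) * g x \<partial>lborel) = (\<integral>x. f x * (\<integral>z. g (x + z) \<partial>N) \<partial>lborel)" .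
  have i1: "integrable lborel (\<lambda>x. (\<integral>z. f (x + z) \<partial>N) * g x)"
    using P.integrable_fst[OF F] by simp
  have "integrable lborel (\<lambda>x. \<integral>z. ?G z x \<partial>N)" using Q.integrable_snd[OF G] by simp
  then have i2: "integrable lborel (\<lambda>x. f x * (\<integral>z. g (x + z) \<partial>N))"
    using reflect[of "\<lambda>z. g (_ + z)"] by simp
  have i3: "integrable lborel (\<lambda>x. measure N UNIV * (f x * g x))"
    by (intro integrable_mult_right integrable_mult_bounded[OF g f B])
  have e1: "jump N f x * g x = (\<integral>z. f (x + z) \<partial>N) * g x - measure N UNIV * (f x * g x)" for x
    by (simp add: jump_eq[OF f B] algebra_simps)
  have e2: "f x * jump N g x = f x * (\<integral>z. g (x + z) \<partial>N) - measure N UNIV * (f x * g x)" for x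
    by (simp add: jump_eq[OF gm B'] algebra_simps)
  show "(LBINT x. jump N f x * g x) = (LBINT x. f x * jump N g x)"
    unfolding e1 e2 Bochner_Integration.integral_diff[OF i1 i3] Bochner_Integration.integral_diff[OF i2 i3] eq ..
  show "integrable lborel (\<lambda>x. f x * jump N g x)"
    unfolding e2 by (rule Bochner_Integration.integrable_diff[OF i2 i3])
qed

text \<open>The convex function sqrt(s^2 + e^2) lies above its tangent at w x, and Kato's inequality
  is this tangent inequality integrated over the jumps. Smoothing |s| keeps the weighted norm
  differentiable in time.\<close>

lemma kato_pointwise:
  fixes w :: "real \<Rightarrow> real"
  assumes "0 < e" and w: "w \<in> borel_measurable borel" "\<And>x. \<bar>w x\<bar> \<le> K"
  shows "w x / sqrt ((w x)\<^sup>2 + e\<^sup>2) * jump N w x \<le> jump N (\<lambda>x. sqrt ((w x)\<^sup>2 + e\<^sup>2)) x"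
proof -
  let ?h = "\<lambda>x. sqrt ((w x)\<^sup>2 + e\<^sup>2)"
  note [measurable] = w(1)
  have hp: "0 < ?h y" for y using assms(1) by (simp add: add_nonneg_pos)
  have hb: "\<bar>?h y\<bar> \<le> K + e" for y
  proof -
    have "?h y \<le> \<bar>w y\<bar> + \<bar>e\<bar>" by (rule sqrt_sum_squares_le_sum_abs)
    then show ?thesis using w(2)[of y] hp[of y] assms(1) by auto
  qed
  have i1: "integrable N (\<lambda>z. w (x + z) - w x)"
    by (intro Bochner_Integration.integrable_diff integrable_bounded_shift(1)[OF w] integrable_const)
  have i2: "integrable N (\<lambda>z. ?h (x + z) - ?h x)"
    by (intro Bochner_Integration.integrable_diff integrable_bounded_shift(1)[OF _ hb] integrable_const) measurable
  have "w x / ?h x * (w y - w x) \<le> ?h y - ?h x" for y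
  proof -
    \<comment> \<open>Cauchy-Schwarz for the plane vectors (w x, e) and (w y, e); after division by
      \<open>?h x\<close> it becomes the tangent inequality.\<close>
    have "(w x * w y + e * e)\<^sup>2 \<le> ((w x)\<^sup>2 + e\<^sup>2) * ((w y)\<^sup>2 + e\<^sup>2)"
      using zero_le_power2[of "w x * e - w y * e"] by (simp add: power2_eq_square algebra_simps)
    then have "\<bar>w x * w y + e * e\<bar> \<le> ?h x * ?h y"
      by (metis real_sqrt_abs real_sqrt_le_mono real_sqrt_mult)
    moreover have "?h x * ?h x = (w x)\<^sup>2 + e\<^sup>2" by simp
    ultimately have "w x * (w y - w x) \<le> ?h x * (?h y - ?h x)"
      by (simp add: power2_eq_square algebra_simps)
    then show ?thesis
      by (subst times_divide_eq_left, subst pos_divide_le_eq[OF hp]) (simp only: mult.commute)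
  qed
  then have "(\<integral>z. w x / ?h x * (w (x + z) - w x) \<partial>N) \<le> (\<integral>z. ?h (x + z) - ?h x \<partial>N)"
    by (intro integral_mono integrable_mult_right i1 i2)
  then show ?thesis by (simp add: jump_def)
qed

end

text \<open>Domination of \<open>\<psi>'\<close> by \<open>\<psi>\<close> lets Gronwall absorb the
  transport term, and the vanishing at both ends removes the boundary terms of the integration by
  parts.\<close>

locale weight =
  fixes \<psi> \<psi>' :: "real \<Rightarrow> real" and B\<psi> \<kappa>1 :: real
  assumes nonneg: "0 \<le> \<psi> x"
    and bounded: "\<psi> x \<le> B\<psi>"
    and integrable: "integrable lborel \<psi>"
    and deriv: "(\<psi> has_real_derivative \<psi>' x) (at x)"
    and cont: "isCont \<psi>' x"
    and deriv_bound: "\<bar>\<psi>' x\<bar> \<le> \<kappa>1 * \<psi> x"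
    and vanish: "(\<psi> \<longlongrightarrow> 0) at_top" "(\<psi> \<longlongrightarrow> 0) at_bot"
begin

lemma measurable_weight [measurable]: "\<psi> \<in> borel_measurable borel" "\<psi>' \<in> borel_measurable borel"
  by (rule DERIV_borel_measurable[OF deriv], rule isCont_borel_measurable[OF cont])

lemma integrable_bounded_mult_weight:
  assumes "f \<in> borel_measurable borel" "\<And>x. \<bar>f x\<bar> \<le> C"
  shows "integrable lborel (\<lambda>x. f x * \<psi> x)"
  by (rule integrable_mult_bounded[OF integrable assms])

lemma integral_transport_vanishes:
  fixes g g' :: "real \<Rightarrow> real"
  assumes "\<And>x. (g has_real_derivative g' x) (at x)" "\<And>x. isCont g' x"
    and "\<And>x. \<bar>g x\<bar> \<le> C" "\<And>x. \<bar>g' x\<bar> \<le> C"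
  shows "(LBINT x. g' x * \<psi> x + g x * \<psi>' x) = 0"
    and "integrable lborel (\<lambda>x. g' x * \<psi> x + g x * \<psi>' x)"
proof -
  have [measurable]: "g \<in> borel_measurable borel" "g' \<in> borel_measurable borel"
    by (rule DERIV_borel_measurable[OF assms(1)], rule isCont_borel_measurable[OF assms(2)])
  have i2: "integrable lborel (\<lambda>x. g x * \<psi>' x)"
  proof (rule Bochner_Integration.integrable_bound[OF integrable_mult_right[OF integrable, of "C * \<kappa>1"]])
    show "AE x in lborel. norm (g x * \<psi>' x) \<le> norm (C * \<kappa>1 * \<psi> x)"
    proof (rule AE_I2)
      fix x
      have "\<bar>g x\<bar> * \<bar>\<psi>' x\<bar> \<le> C * (\<kappa>1 * \<psi> x)"
        using assms(3)[of x] deriv_bound[of x] by (intro mult_mono) auto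
      also have "\<dots> \<le> \<bar>C * (\<kappa>1 * \<psi> x)\<bar>" by (rule abs_ge_self)
      finally show "norm (g x * \<psi>' x) \<le> norm (C * \<kappa>1 * \<psi> x)" by (simp add: abs_mult mult.assoc)
    qed
  qed measurable
  show i: "integrable lborel (\<lambda>x. g' x * \<psi> x + g x * \<psi>' x)"
    using assms(4) by (intro Bochner_Integration.integrable_add i2 integrable_bounded_mult_weight) auto
  have lim: "((\<lambda>x. g x * \<psi> x) \<longlongrightarrow> 0) F" if "(\<psi> \<longlongrightarrow> 0) F" for F
  proof (rule Lim_null_comparison)
    show "\<forall>\<^sub>F x in F. norm (g x * \<psi> x) \<le> C * \<psi> x"
      using assms(3) nonneg by (intro always_eventually) (simp add: abs_mult mult_right_mono)
    show "((\<lambda>x. C * \<psi> x) \<longlongrightarrow> 0) F" using tendsto_mult_left[OF that, of C] by simp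
  qed
  show "(LBINT x. g' x * \<psi> x + g x * \<psi>' x) = 0"
  proof (rule integral_derivative_vanishing[OF _ _ i lim[OF vanish(1)] lim[OF vanish(2)]])
    show "((\<lambda>x. g x * \<psi> x) has_real_derivative g' x * \<psi> x + g x * \<psi>' x) (at x)" for x
      using DERIV_mult[OF assms(1) deriv, of x] by (simp add: algebra_simps)
    show "isCont (\<lambda>x. g' x * \<psi> x + g x * \<psi>' x) x" for x
      by (intro continuous_intros assms(2) cont DERIV_isCont[OF assms(1)] DERIV_isCont[OF deriv])
  qed
qed

end

section \<open>Weighted Kato inequality\<close>

locale kato = symmetric_measure N + weight \<psi> \<psi>' B\<psi> \<kappa>1
  for N :: "real measure" and \<psi> \<psi>' :: "real \<Rightarrow> real" and B\<psi> \<kappa>1 :: real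
begin

text \<open>Gronwall for the weighted integral J of sqrt(W^2 + e^2). Jump operator and transport are
  moved onto the weight, where \<kappa> absorbs them. The equation is required only up to an error
  \<open>F\<close>, so one statement serves both the truncation error and a nonlinearity treated as
  a source.\<close>

lemma weighted_L1_bound:
  fixes W Wt Wx b bx :: "real \<Rightarrow> real \<Rightarrow> real" and F \<Phi> :: "real \<Rightarrow> real"
  assumes I: "open I" "convex I" "s \<in> I" "t \<in> I" "s \<le> t"
    and Wt: "\<And>\<tau> x. \<tau> \<in> I \<Longrightarrow> ((\<lambda>r. W r x) has_real_derivative Wt \<tau> x) (at \<tau>)"
    and Wx: "\<And>\<tau> x. \<tau> \<in> I \<Longrightarrow> (W \<tau> has_real_derivative Wx \<tau> x) (at x)"
    and Wxc: "\<And>\<tau> x. \<tau> \<in> I \<Longrightarrow> isCont (Wx \<tau>) x"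
    and Wtm: "\<And>\<tau>. \<tau> \<in> I \<Longrightarrow> Wt \<tau> \<in> borel_measurable borel"
    and K: "\<And>\<tau> x. \<tau> \<in> I \<Longrightarrow> \<bar>W \<tau> x\<bar> \<le> K" "\<And>\<tau> x. \<tau> \<in> I \<Longrightarrow> \<bar>Wt \<tau> x\<bar> \<le> K"
      "\<And>\<tau> x. \<tau> \<in> I \<Longrightarrow> \<bar>Wx \<tau> x\<bar> \<le> K"
    and bx: "\<And>\<tau> x. \<tau> \<in> I \<Longrightarrow> (b \<tau> has_real_derivative bx \<tau> x) (at x)"
    and bxc: "\<And>\<tau> x. \<tau> \<in> I \<Longrightarrow> isCont (bx \<tau>) x"
    and B: "\<And>\<tau> x. \<tau> \<in> I \<Longrightarrow> \<bar>b \<tau> x\<bar> \<le> B" "\<And>\<tau> x. \<tau> \<in> I \<Longrightarrow> \<bar>bx \<tau> x\<bar> \<le> B"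
    and eq: "\<And>\<tau> x. \<tau> \<in> I \<Longrightarrow>
      \<bar>Wt \<tau> x - jump N (W \<tau>) x + (bx \<tau> x * W \<tau> x + b \<tau> x * Wx \<tau> x)\<bar> \<le> F \<tau>"
    and \<Phi>: "\<And>\<tau>. \<tau> \<in> I \<Longrightarrow> (\<Phi> has_real_derivative F \<tau>) (at \<tau>)"
    and \<kappa>: "0 \<le> \<kappa>" "\<And>\<tau> x. \<tau> \<in> I \<Longrightarrow> jump N \<psi> x + \<bar>b \<tau> x\<bar> * \<bar>\<psi>' x\<bar> \<le> \<kappa> * \<psi> x"
  shows "(LBINT x. \<bar>W t x\<bar> * \<psi> x)
    \<le> exp (\<kappa> * (t - s)) * ((LBINT x. \<bar>W s x\<bar> * \<psi> x) + (LBINT x. \<psi> x) * (\<Phi> t - \<Phi> s))"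
proof -
  have Wm: "W \<tau> \<in> borel_measurable borel" if "\<tau> \<in> I" for \<tau> using Wx[OF that] by (rule DERIV_borel_measurable)
  have K0: "0 \<le> K" and B0: "0 \<le> B" using K(1)[OF I(3), of 0] B(1)[OF I(3), of 0] by auto
  have F0: "0 \<le> F \<tau>" if "\<tau> \<in> I" for \<tau> using eq[OF that, of 0] by linarith
  define P where "P = (LBINT x. \<psi> x)"
  have P0: "0 \<le> P" unfolding P_def using nonneg by (intro integral_nonneg_AE) auto
  \<comment> \<open>The surplus for fixed e has two origins: e P, because J exceeds the weighted
    norm by at most that much at time s, and e P B (t - s), because q W is not h but h - e^2 /
    h.\<close>
  have step: "(LBINT x. \<bar>W t x\<bar> * \<psi> x)
      \<le> exp (\<kappa> * (t - s)) * ((LBINT x. \<bar>W s x\<bar> * \<psi> x) + P * (\<Phi> t - \<Phi> s) + e * (P + P * B * (t - s)))"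
    if e: "0 < e" for e
  proof -
    define h where "h \<tau> x = sqrt ((W \<tau> x)\<^sup>2 + e\<^sup>2)" for \<tau> x
    have he: "e \<le> h \<tau> x" for \<tau> x unfolding h_def using e by (intro real_le_rsqrt) auto
    then have hp: "0 < h \<tau> x" for \<tau> x using e by (rule less_le_trans[rotated])
    have hW: "\<bar>W \<tau> x\<bar> \<le> h \<tau> x" for \<tau> x unfolding h_def by (intro real_le_rsqrt) auto
    have hle: "h \<tau> x \<le> \<bar>W \<tau> x\<bar> + e" for \<tau> x
      using sqrt_sum_squares_le_sum_abs[of "W \<tau> x" e] e by (simp add: h_def)
    have hsq: "h \<tau> x * h \<tau> x = (W \<tau> x)\<^sup>2 + e\<^sup>2" for \<tau> x by (simp add: h_def)
    have q1: "\<bar>W \<tau> x / h \<tau> x\<bar> \<le> 1" for \<tau> x using hW[of \<tau> x] hp[of \<tau> x] by (simp add: abs_divide)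
    have hK: "\<bar>h \<tau> x\<bar> \<le> K + e" if "\<tau> \<in> I" for \<tau> x using hle[of \<tau> x] K(1)[OF that, of x] hp[of \<tau> x] by simp
    have hm: "h \<tau> \<in> borel_measurable borel" if "\<tau> \<in> I" for \<tau>
      using Wm[OF that] unfolding h_def by measurable
    have hD: "((\<lambda>r. sqrt ((f r)\<^sup>2 + e\<^sup>2)) has_real_derivative f \<tau> / sqrt ((f \<tau>)\<^sup>2 + e\<^sup>2) * f') (at \<tau>)"
      if "(f has_real_derivative f') (at \<tau>)" for f :: "real \<Rightarrow> real" and f' \<tau>
    proof -
      have "0 < (f \<tau>)\<^sup>2 + e\<^sup>2" using e by (simp add: add_nonneg_pos)
      then show ?thesis using that by (auto intro!: derivative_eq_intros simp: field_simps)
    qed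
    define J where "J \<tau> = (LBINT x. h \<tau> x * \<psi> x)" for \<tau>
    define J' where "J' \<tau> = (LBINT x. W \<tau> x / h \<tau> x * Wt \<tau> x * \<psi> x)" for \<tau>
    have qK: "\<bar>W \<tau> x / h \<tau> x * Wt \<tau> x\<bar> \<le> K" if "\<tau> \<in> I" for \<tau> x
      using mult_mono[OF q1[of \<tau> x] K(2)[OF that, of x]] by (simp add: abs_mult)
    have qm: "(\<lambda>x. W \<tau> x / h \<tau> x * Wt \<tau> x) \<in> borel_measurable borel" if "\<tau> \<in> I" for \<tau>
      using Wm[OF that] hm[OF that] Wtm[OF that] by measurable
    have ih: "integrable lborel (\<lambda>x. h \<tau> x * \<psi> x)" if "\<tau> \<in> I" for \<tau>
      by (rule integrable_bounded_mult_weight[OF hm[OF that] hK[OF that]])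
    have JD: "(J has_real_derivative J' \<tau>) (at \<tau>)" if "\<tau> \<in> I" for \<tau>
      unfolding J_def J'_def
    proof (rule has_derivative_lebesgue_integral[OF I(1,2) that integrable_mult_right[OF integrable, of K]])
      show "((\<lambda>r. h r x * \<psi> x) has_real_derivative W r x / h r x * Wt r x * \<psi> x) (at r)" if "r \<in> I" for r x
        unfolding h_def using hD[OF Wt[OF that, of x]] by (intro DERIV_cmult_right)
      show "\<bar>W r x / h r x * Wt r x * \<psi> x\<bar> \<le> K * \<psi> x" if "r \<in> I" for r x
        using mult_right_mono[OF qK[OF that, of x] nonneg[of x]] nonneg[of x] by (simp add: abs_mult)
      show "(\<lambda>x. W \<tau> x / h \<tau> x * Wt \<tau> x * \<psi> x) \<in> borel_measurable lborel"
        using qm[OF that] by measurable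
    qed (use ih in auto)
    have J'_le: "J' \<tau> \<le> \<kappa> * J \<tau> + (F \<tau> + B * e) * P" if \<tau>: "\<tau> \<in> I" for \<tau>
    proof -
      define g where "g x = b \<tau> x * h \<tau> x" for x
      define g' where "g' x = bx \<tau> x * h \<tau> x + b \<tau> x * (W \<tau> x / h \<tau> x * Wx \<tau> x)" for x
      have hx: "(h \<tau> has_real_derivative W \<tau> x / h \<tau> x * Wx \<tau> x) (at x)" for x
        unfolding h_def using hD[OF Wx[OF \<tau>, of x]] .
      have gD: "(g has_real_derivative g' x) (at x)" for x
        unfolding g_def g'_def using DERIV_mult[OF bx[OF \<tau>, of x] hx[of x]] by (simp add: algebra_simps)
      have gc: "isCont g' x" for x
        unfolding g'_def using DERIV_isCont[OF bx[OF \<tau>]] DERIV_isCont[OF hx] DERIV_isCont[OF Wx[OF \<tau>]] bxc[OF \<tau>] Wxc[OF \<tau>]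
          hp[of \<tau>] by (intro continuous_intros) (auto simp: less_imp_neq[symmetric] less_imp_neq[OF hp, symmetric])
      have bh: "\<bar>b \<tau> x * h \<tau> x\<bar> \<le> B * (K + e)" "\<bar>bx \<tau> x * h \<tau> x\<bar> \<le> B * (K + e)" for x
        unfolding abs_mult using B0 by (intro mult_mono B[OF \<tau>] hK[OF \<tau>]; simp)+
      have "\<bar>W \<tau> x / h \<tau> x * Wx \<tau> x\<bar> \<le> K" for x
        using mult_mono[OF q1[of \<tau> x] K(3)[OF \<tau>, of x]] by (simp add: abs_mult)
      then have "\<bar>b \<tau> x * (W \<tau> x / h \<tau> x * Wx \<tau> x)\<bar> \<le> B * K" for x
        unfolding abs_mult[of "b \<tau> x"] using B0 by (intro mult_mono B[OF \<tau>]) auto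
      then have gb: "\<bar>g' x\<bar> \<le> B * (K + e) + B * K" for x
        unfolding g'_def using bh(2)[of x] abs_triangle_ineq order_trans by (smt (verit))
      have ga: "\<bar>g x\<bar> \<le> B * (K + e) + B * K" for x
        using bh(1)[of x] mult_nonneg_nonneg[OF B0 K0] by (simp add: g_def)
      note tr = integral_transport_vanishes[OF gD gc ga gb]
      have \<psi>b: "\<bar>\<psi> x\<bar> \<le> B\<psi>" for x using nonneg bounded by simp
      note sa = jump_self_adjoint[OF hm[OF \<tau>] hK[OF \<tau>] integrable \<psi>b]
      have i1: "integrable lborel (\<lambda>x. jump N (h \<tau>) x * \<psi> x)"
        by (rule integrable_bounded_mult_weight[OF jump_measurable[OF hm[OF \<tau>]] abs_jump_le[OF hm[OF \<tau>] hK[OF \<tau>]]])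
      have i2: "integrable lborel (\<lambda>x. \<kappa> * (h \<tau> x * \<psi> x))" "integrable lborel (\<lambda>x. (F \<tau> + B * e) * \<psi> x)"
        using ih[OF \<tau>] integrable by auto
      \<comment> \<open>The equation is multiplied by q = W / h, the derivative of h with respect to
        W. Then bx q W + b q Wx is the x-derivative of \<open>g\<close> = b h, up to bx e^2 / h. The
        terms are arranged so that on integration the jump terms cancel by self-adjointness and the
        last bracket is an exact derivative.\<close>
      have pw: "W \<tau> x / h \<tau> x * Wt \<tau> x * \<psi> x \<le> jump N (h \<tau>) x * \<psi> x - h \<tau> x * jump N \<psi> x
         + (\<kappa> * (h \<tau> x * \<psi> x) + (F \<tau> + B * e) * \<psi> x - (g' x * \<psi> x + g x * \<psi>' x))" for x
      proof -
        define q where "q = W \<tau> x / h \<tau> x"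
        define R where "R = Wt \<tau> x - jump N (W \<tau>) x + (bx \<tau> x * W \<tau> x + b \<tau> x * Wx \<tau> x)"
        have "\<bar>q * R\<bar> \<le> 1 * F \<tau>"
          unfolding abs_mult using q1[of \<tau> x] eq[OF \<tau>, of x] by (intro mult_mono) (auto simp: q_def R_def)
        then have qR: "q * R \<le> F \<tau>" by simp
        have qj: "q * jump N (W \<tau>) x \<le> jump N (h \<tau>) x"
          using kato_pointwise[OF e Wm[OF \<tau>] K(1)[OF \<tau>], of x] by (simp add: q_def h_def[abs_def])
        have qW: "q * W \<tau> x = h \<tau> x - e\<^sup>2 / h \<tau> x"
          using hsq[of \<tau> x] hp[of \<tau> x] by (simp add: q_def power2_eq_square field_simps)
        have eh: "0 \<le> e\<^sup>2 / h \<tau> x" "e\<^sup>2 / h \<tau> x \<le> e"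
          using he[of \<tau> x] hp[of \<tau> x] e by (auto simp: power2_eq_square field_simps)
        have "\<bar>bx \<tau> x * (e\<^sup>2 / h \<tau> x)\<bar> \<le> B * e"
          unfolding abs_mult using B0 eh by (intro mult_mono B[OF \<tau>]) auto
        then have bq: "bx \<tau> x * (e\<^sup>2 / h \<tau> x) \<le> B * e" by linarith
        have "q * Wt \<tau> x = q * R + q * jump N (W \<tau>) x - bx \<tau> x * (q * W \<tau> x) - b \<tau> x * (q * Wx \<tau> x)"
          by (simp add: R_def algebra_simps)
        also have "\<dots> = q * R + q * jump N (W \<tau>) x + bx \<tau> x * (e\<^sup>2 / h \<tau> x) - g' x"
          unfolding qW by (simp add: g'_def q_def algebra_simps)
        also have "\<dots> \<le> F \<tau> + jump N (h \<tau>) x + B * e - g' x" using qR qj bq by linarith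
        finally have "q * Wt \<tau> x * \<psi> x \<le> (F \<tau> + jump N (h \<tau>) x + B * e - g' x) * \<psi> x"
          using nonneg by (intro mult_right_mono)
        moreover have "g x * \<psi>' x \<le> h \<tau> x * (\<kappa> * \<psi> x - jump N \<psi> x)"
        proof -
          have "g x * \<psi>' x \<le> h \<tau> x * (\<bar>b \<tau> x\<bar> * \<bar>\<psi>' x\<bar>)"
            unfolding g_def using hp[of \<tau> x] abs_ge_self[of "b \<tau> x * \<psi>' x"]
            by (simp add: abs_mult mult.assoc mult.left_commute)
          also have "\<dots> \<le> h \<tau> x * (\<kappa> * \<psi> x - jump N \<psi> x)"
            using \<kappa>(2)[OF \<tau>, of x] hp[of \<tau> x] by (intro mult_left_mono) auto
          finally show ?thesis .
        qed
        ultimately show ?thesis unfolding q_def by (simp add: algebra_simps)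
      qed
      have "J' \<tau> \<le> (LBINT x. jump N (h \<tau>) x * \<psi> x - h \<tau> x * jump N \<psi> x
         + (\<kappa> * (h \<tau> x * \<psi> x) + (F \<tau> + B * e) * \<psi> x - (g' x * \<psi> x + g x * \<psi>' x)))"
        unfolding J'_def
        by (intro integral_mono pw integrable_bounded_mult_weight[OF qm[OF \<tau>] qK[OF \<tau>]]
            Bochner_Integration.integrable_add Bochner_Integration.integrable_diff i1 i2 sa(2) tr(2))
      also have "\<dots> = (LBINT x. jump N (h \<tau>) x * \<psi> x) - (LBINT x. h \<tau> x * jump N \<psi> x)
         + ((LBINT x. \<kappa> * (h \<tau> x * \<psi> x)) + (LBINT x. (F \<tau> + B * e) * \<psi> x)
           - (LBINT x. g' x * \<psi> x + g x * \<psi>' x))"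
        using i1 i2 sa(2) tr(2) by (simp only: Bochner_Integration.integral_add Bochner_Integration.integral_diff
            Bochner_Integration.integrable_add Bochner_Integration.integrable_diff)
      also have "\<dots> = \<kappa> * J \<tau> + (F \<tau> + B * e) * P"
        unfolding sa(1) tr(1) by (simp add: J_def P_def)
      finally show ?thesis .
    qed
    \<comment> \<open>The integrating factor times J minus a primitive of the source. Since the
      source is nonnegative and the factor is at most 1 after time s, H is nonincreasing.\<close>
    define H where "H \<tau> = exp (- \<kappa> * (\<tau> - s)) * J \<tau> - P * (\<Phi> \<tau> + B * e * \<tau>)" for \<tau>
    have HD: "(H has_real_derivative exp (- \<kappa> * (\<tau> - s)) * (J' \<tau> - \<kappa> * J \<tau>) - P * (F \<tau> + B * e)) (at \<tau>)"
      if "\<tau> \<in> I" for \<tau>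
      unfolding H_def by (auto intro!: derivative_eq_intros JD[OF that] \<Phi>[OF that] simp: algebra_simps)
    have sub: "{s..t} \<subseteq> I" using I(2-4) by (metis atLeastatMost_empty_iff closed_segment_eq_real_ivl closed_segment_subset empty_subsetI)
    have "H t \<le> H s"
    proof (rule DERIV_nonpos_imp_nonincreasing[OF I(5)])
      fix \<tau> assume "s \<le> \<tau>" "\<tau> \<le> t"
      then have \<tau>: "\<tau> \<in> I" using sub by auto
      have "exp (- \<kappa> * (\<tau> - s)) * (J' \<tau> - \<kappa> * J \<tau>) \<le> exp (- \<kappa> * (\<tau> - s)) * ((F \<tau> + B * e) * P)"
        using J'_le[OF \<tau>] by (intro mult_left_mono) auto
      also have "\<dots> \<le> 1 * ((F \<tau> + B * e) * P)"
        using F0[OF \<tau>] B0 e P0 \<kappa>(1) \<open>s \<le> \<tau>\<close> by (intro mult_right_mono mult_nonneg_nonneg add_nonneg_nonneg) auto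
      finally have "exp (- \<kappa> * (\<tau> - s)) * (J' \<tau> - \<kappa> * J \<tau>) - P * (F \<tau> + B * e) \<le> 0" by (simp add: mult.commute)
      then show "\<exists>y. (H has_real_derivative y) (at \<tau>) \<and> y \<le> 0" using HD[OF \<tau>] by blast
    qed
    then have "exp (- \<kappa> * (t - s)) * J t \<le> J s + P * (\<Phi> t - \<Phi> s) + P * B * e * (t - s)"
      by (simp add: H_def algebra_simps)
    then have "exp (\<kappa> * (t - s)) * (exp (- \<kappa> * (t - s)) * J t)
        \<le> exp (\<kappa> * (t - s)) * (J s + P * (\<Phi> t - \<Phi> s) + P * B * e * (t - s))"
      by (intro mult_left_mono) auto
    then have main: "J t \<le> exp (\<kappa> * (t - s)) * (J s + P * (\<Phi> t - \<Phi> s) + P * B * e * (t - s))"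
      by (simp add: mult.assoc[symmetric] mult_exp_exp)
    have iW: "integrable lborel (\<lambda>x. \<bar>W \<tau> x\<bar> * \<psi> x)" if "\<tau> \<in> I" for \<tau>
      using Wm[OF that] K(1)[OF that] by (intro integrable_bounded_mult_weight) auto
    have "(LBINT x. \<bar>W t x\<bar> * \<psi> x) \<le> J t"
      unfolding J_def using hW nonneg by (intro integral_mono iW I ih mult_right_mono) auto
    moreover have "J s \<le> (LBINT x. \<bar>W s x\<bar> * \<psi> x + e * \<psi> x)"
      unfolding J_def using mult_right_mono[OF hle nonneg]
      by (intro integral_mono Bochner_Integration.integrable_add iW I ih integrable_mult_right integrable)
         (simp add: distrib_right)
    moreover have "(LBINT x. \<bar>W s x\<bar> * \<psi> x + e * \<psi> x) = (LBINT x. \<bar>W s x\<bar> * \<psi> x) + e * P"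
      using Bochner_Integration.integral_add[OF iW[OF I(3)] integrable_mult_right[OF integrable, of e]]
      by (simp add: P_def)
    ultimately show ?thesis
    proof -
      assume a: "(LBINT x. \<bar>W t x\<bar> * \<psi> x) \<le> J t"
        and b: "J s \<le> (LBINT x. \<bar>W s x\<bar> * \<psi> x + e * \<psi> x)"
        and c: "(LBINT x. \<bar>W s x\<bar> * \<psi> x + e * \<psi> x) = (LBINT x. \<bar>W s x\<bar> * \<psi> x) + e * P"
      note a
      also note main
      also have "exp (\<kappa> * (t - s)) * (J s + P * (\<Phi> t - \<Phi> s) + P * B * e * (t - s))
        \<le> exp (\<kappa> * (t - s)) * ((LBINT x. \<bar>W s x\<bar> * \<psi> x) + P * (\<Phi> t - \<Phi> s) + e * (P + P * B * (t - s)))"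
        using b c by (intro mult_left_mono) (auto simp: algebra_simps)
      finally show ?thesis .
    qed
  qed
  define E where "E = exp (\<kappa> * (t - s))"
  define Z where "Z = P + P * B * (t - s)"
  have "((\<lambda>e. E * ((LBINT x. \<bar>W s x\<bar> * \<psi> x) + P * (\<Phi> t - \<Phi> s) + e * Z))
     \<longlongrightarrow> E * ((LBINT x. \<bar>W s x\<bar> * \<psi> x) + P * (\<Phi> t - \<Phi> s) + 0 * Z)) (at_right 0)"
    by (intro tendsto_intros)
  moreover have "\<forall>\<^sub>F e in at_right 0. (LBINT x. \<bar>W t x\<bar> * \<psi> x)
      \<le> E * ((LBINT x. \<bar>W s x\<bar> * \<psi> x) + P * (\<Phi> t - \<Phi> s) + e * Z)"
    using step by (auto simp: eventually_at_right_less E_def Z_def intro: eventually_mono[OF eventually_at_right_less])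
  ultimately have "(LBINT x. \<bar>W t x\<bar> * \<psi> x)
      \<le> E * ((LBINT x. \<bar>W s x\<bar> * \<psi> x) + P * (\<Phi> t - \<Phi> s) + 0 * Z)"
    by (intro tendsto_lowerbound) auto
  then show ?thesis by (simp add: E_def P_def)
qed

end

section \<open>Polynomially decaying weights\<close>

text \<open>For the jump operator only an upper bound is demanded, since Gronwall acts in one
  direction, but with one constant for all truncations. The bound 2 on the weight leaves room for
  the tail weights.\<close>

definition levy_weight :: "real \<Rightarrow> (real \<Rightarrow> real) \<Rightarrow> (real \<Rightarrow> real) \<Rightarrow> real \<Rightarrow> bool" where
  "levy_weight \<alpha> \<psi> \<psi>' k \<longleftrightarrow> weight \<psi> \<psi>' 2 k \<and> 0 \<le> k \<and>
     (\<forall>\<epsilon> x. 0 < \<epsilon> \<longrightarrow> \<epsilon> \<le> 1 \<longrightarrow> jump (levy \<alpha> \<epsilon>) \<psi> x \<le> k * \<psi> x)"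

context
  fixes \<alpha> :: real
  assumes \<alpha>: "1 < \<alpha>" "\<alpha> < 2"
begin

lemma symmetric_measure_levy:
  assumes "0 < \<epsilon>" "\<epsilon> \<le> 1" shows "symmetric_measure (levy \<alpha> \<epsilon>)"
proof -
  interpret finite_measure "levy \<alpha> \<epsilon>" by (rule finite_measure_levy[OF \<alpha> assms])
  show ?thesis by unfold_locales (simp_all add: integral_levy_reflect[OF \<alpha>])
qed

text \<open>For each truncation the error is added to the source, and \<epsilon> -> 0 removes it
  again. In the exponent, k pays for the jumps and k B for the transport. The regularity bounds K,
  K' and Bx, which may degenerate near t = 0, leave no trace in the result.\<close>

lemma weighted_L1_bound_levy:
  fixes W Wt Wx b bx :: "real \<Rightarrow> real \<Rightarrow> real" and F \<Phi> :: "real \<Rightarrow> real"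
  assumes w: "levy_weight \<alpha> \<psi> \<psi>' k"
    and I: "open I" "convex I" "s \<in> I" "t \<in> I" "s \<le> t"
    and Wt: "\<And>\<tau> x. \<tau> \<in> I \<Longrightarrow> ((\<lambda>r. W r x) has_real_derivative Wt \<tau> x) (at \<tau>)"
    and Wx: "\<And>\<tau> x. \<tau> \<in> I \<Longrightarrow> (W \<tau> has_real_derivative Wx \<tau> x) (at x)"
    and Wxc: "\<And>\<tau> x. \<tau> \<in> I \<Longrightarrow> isCont (Wx \<tau>) x"
    and Wtm: "\<And>\<tau>. \<tau> \<in> I \<Longrightarrow> Wt \<tau> \<in> borel_measurable borel"
    and K: "\<And>\<tau> x. \<tau> \<in> I \<Longrightarrow> \<bar>W \<tau> x\<bar> \<le> K" "\<And>\<tau> x. \<tau> \<in> I \<Longrightarrow> \<bar>Wt \<tau> x\<bar> \<le> K"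
      "\<And>\<tau> x. \<tau> \<in> I \<Longrightarrow> \<bar>Wx \<tau> x\<bar> \<le> K"
    and bx: "\<And>\<tau> x. \<tau> \<in> I \<Longrightarrow> (b \<tau> has_real_derivative bx \<tau> x) (at x)"
    and bxc: "\<And>\<tau> x. \<tau> \<in> I \<Longrightarrow> isCont (bx \<tau>) x"
    and B: "\<And>\<tau> x. \<tau> \<in> I \<Longrightarrow> \<bar>b \<tau> x\<bar> \<le> B" "\<And>\<tau> x. \<tau> \<in> I \<Longrightarrow> \<bar>bx \<tau> x\<bar> \<le> Bx"
    and eq: "\<And>\<epsilon> \<tau> x. 0 < \<epsilon> \<Longrightarrow> \<epsilon> \<le> 1 \<Longrightarrow> \<tau> \<in> I \<Longrightarrow>
      \<bar>Wt \<tau> x - jump (levy \<alpha> \<epsilon>) (W \<tau>) x + (bx \<tau> x * W \<tau> x + b \<tau> x * Wx \<tau> x)\<bar> \<le> F \<tau> + K' * levy_error \<alpha> \<epsilon>"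
    and \<Phi>: "\<And>\<tau>. \<tau> \<in> I \<Longrightarrow> (\<Phi> has_real_derivative F \<tau>) (at \<tau>)"
  shows "(LBINT x. \<bar>W t x\<bar> * \<psi> x)
    \<le> exp (k * (1 + B) * (t - s)) * ((LBINT x. \<bar>W s x\<bar> * \<psi> x) + (LBINT x. \<psi> x) * (\<Phi> t - \<Phi> s))"
proof -
  interpret weight \<psi> \<psi>' 2 k using w by (simp add: levy_weight_def)
  have k0: "0 \<le> k" using w by (simp add: levy_weight_def)
  have B0: "0 \<le> B" using B(1)[OF I(3), of 0] by auto
  define P where "P = (LBINT x. \<psi> x)"
  have step: "(LBINT x. \<bar>W t x\<bar> * \<psi> x)
    \<le> exp (k * (1 + B) * (t - s)) * ((LBINT x. \<bar>W s x\<bar> * \<psi> x)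
       + P * ((\<Phi> t + K' * levy_error \<alpha> \<epsilon> * t) - (\<Phi> s + K' * levy_error \<alpha> \<epsilon> * s)))"
    if \<epsilon>: "0 < \<epsilon>" "\<epsilon> \<le> 1" for \<epsilon>
  proof -
    interpret symmetric_measure "levy \<alpha> \<epsilon>" by (rule symmetric_measure_levy[OF \<epsilon>])
    interpret kato "levy \<alpha> \<epsilon>" \<psi> \<psi>' 2 k by unfold_locales
    show ?thesis unfolding P_def
    proof (rule weighted_L1_bound[where b=b and bx=bx and B="max B Bx" and F="\<lambda>\<tau>. F \<tau> + K' * levy_error \<alpha> \<epsilon>"
          and \<Phi>="\<lambda>\<tau>. \<Phi> \<tau> + K' * levy_error \<alpha> \<epsilon> * \<tau>" and Wt=Wt and Wx=Wx and K=K, OF I Wt Wx Wxc Wtm K bx bxc])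
      show "\<bar>b \<tau> x\<bar> \<le> max B Bx" "\<bar>bx \<tau> x\<bar> \<le> max B Bx" if "\<tau> \<in> I" for \<tau> x
        using B(1)[OF that, of x] B(2)[OF that, of x] by auto
      show "((\<lambda>\<tau>. \<Phi> \<tau> + K' * levy_error \<alpha> \<epsilon> * \<tau>) has_real_derivative F \<tau> + K' * levy_error \<alpha> \<epsilon>) (at \<tau>)" if "\<tau> \<in> I" for \<tau>
        by (auto intro!: derivative_eq_intros \<Phi>[OF that])
      show "0 \<le> k * (1 + B)" using k0 B0 by simp
      show "jump (levy \<alpha> \<epsilon>) \<psi> x + \<bar>b \<tau> x\<bar> * \<bar>\<psi>' x\<bar> \<le> k * (1 + B) * \<psi> x" if "\<tau> \<in> I" for \<tau> x
      proof -
        have "\<bar>b \<tau> x\<bar> * \<bar>\<psi>' x\<bar> \<le> B * (k * \<psi> x)"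
          using B(1)[OF that] deriv_bound B0 by (intro mult_mono) auto
        moreover have "jump (levy \<alpha> \<epsilon>) \<psi> x \<le> k * \<psi> x" using w \<epsilon> by (simp add: levy_weight_def)
        ultimately show ?thesis by (simp add: algebra_simps)
      qed
    qed (use eq \<epsilon> in auto)
  qed
  define E where "E = exp (k * (1 + B) * (t - s))"
  define Y where "Y = (LBINT x. \<bar>W s x\<bar> * \<psi> x)"
  have "((\<lambda>\<epsilon>. E * (Y + P * ((\<Phi> t + K' * levy_error \<alpha> \<epsilon> * t) - (\<Phi> s + K' * levy_error \<alpha> \<epsilon> * s))))
     \<longlongrightarrow> E * (Y + P * ((\<Phi> t + K' * 0 * t) - (\<Phi> s + K' * 0 * s)))) (at_right 0)"
    by (intro tendsto_intros levy_error_tendsto[OF \<alpha>])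
  moreover have "\<forall>\<^sub>F \<epsilon> in at_right 0. \<epsilon> \<in> {0<..<1::real}" by (rule eventually_at_right_real) simp
  then have "\<forall>\<^sub>F \<epsilon> in at_right 0. (LBINT x. \<bar>W t x\<bar> * \<psi> x)
      \<le> E * (Y + P * ((\<Phi> t + K' * levy_error \<alpha> \<epsilon> * t) - (\<Phi> s + K' * levy_error \<alpha> \<epsilon> * s)))"
    by eventually_elim (use step in \<open>auto simp: E_def Y_def\<close>)
  ultimately have "(LBINT x. \<bar>W t x\<bar> * \<psi> x)
      \<le> E * (Y + P * ((\<Phi> t + K' * 0 * t) - (\<Phi> s + K' * 0 * s)))"
    by (intro tendsto_lowerbound) auto
  then show ?thesis by (simp add: E_def Y_def P_def)
qed

text \<open>Decays like |x|^(-(1+\<alpha>)/2): fast enough to be integrable, yet slower than the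
  Levy density |z|^(-1-\<alpha>), so that long jumps from far away into the bulk of the weight cost
  no more than a multiple of its local value.\<close>

definition bump :: "real \<Rightarrow> real" where
  "bump x = (1 + x\<^sup>2) powr (- ((1 + \<alpha>) / 4))"

definition bump' :: "real \<Rightarrow> real" where
  "bump' x = - ((1 + \<alpha>) / 2) * x / (1 + x\<^sup>2) * bump x"

definition bump'' :: "real \<Rightarrow> real" where
  "bump'' x = ((1 + \<alpha>) / 2) * (((5 + \<alpha>) / 2 * x\<^sup>2 / (1 + x\<^sup>2) - 1) / (1 + x\<^sup>2)) * bump x"

lemma one_plus_square_pos: "0 < 1 + (x::real)\<^sup>2" by (simp add: add_pos_nonneg)

lemma bump_pos: "0 < bump x" using one_plus_square_pos[of x] by (simp add: bump_def)

lemma bump_le_1: "bump x \<le> 1"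
proof -
  have "(1 + x\<^sup>2) powr (- ((1 + \<alpha>) / 4)) \<le> (1 + x\<^sup>2) powr 0"
    using \<alpha> by (intro powr_mono) auto
  then show ?thesis using one_plus_square_pos[of x] by (simp add: bump_def)
qed

lemma bump_deriv: "(bump has_real_derivative bump' x) (at x)"
proof -
  have p: "((\<lambda>y. y powr (- ((1 + \<alpha>) / 4))) has_real_derivative
      - ((1 + \<alpha>) / 4) * (1 + x\<^sup>2) powr (- ((1 + \<alpha>) / 4) - 1)) (at (1 + x\<^sup>2))"
    by (rule has_real_derivative_powr[OF one_plus_square_pos])
  have q: "((\<lambda>x. 1 + x\<^sup>2) has_real_derivative 2 * x) (at x)"
    by (auto intro!: derivative_eq_intros)
  have "(bump has_real_derivative - ((1 + \<alpha>) / 4) * (1 + x\<^sup>2) powr (- ((1 + \<alpha>) / 4) - 1) * (2 * x)) (at x)"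
    unfolding bump_def[abs_def] by (rule DERIV_chain2[OF p q])
  also have "- ((1 + \<alpha>) / 4) * (1 + x\<^sup>2) powr (- ((1 + \<alpha>) / 4) - 1) * (2 * x) = bump' x"
  proof -
    define y where "y = bump x / (1 + x\<^sup>2)"
    have "(1 + x\<^sup>2) powr (- ((1 + \<alpha>) / 4) - 1) = y"
      unfolding y_def bump_def powr_diff using one_plus_square_pos[of x] by simp
    moreover have "bump' x = - ((1 + \<alpha>) / 2) * x * y" by (simp add: bump'_def y_def)
    ultimately show ?thesis by (simp add: field_simps)
  qed
  finally show ?thesis .
qed

lemma bump_deriv2: "(bump' has_real_derivative bump'' x) (at x)"
proof -
  define B where "B = bump x"
  have q: "1 + x\<^sup>2 \<noteq> 0" using one_plus_square_pos[of x] by simp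
  have "((\<lambda>x. - ((1 + \<alpha>) / 2) * x / (1 + x\<^sup>2)) has_real_derivative
     (- ((1 + \<alpha>) / 2) * (1 + x\<^sup>2) - (- ((1 + \<alpha>) / 2) * x) * (2 * x)) / ((1 + x\<^sup>2) * (1 + x\<^sup>2))) (at x)"
    by (rule DERIV_divide) (use q in \<open>auto intro!: derivative_eq_intros\<close>)
  from DERIV_mult[OF this bump_deriv]
  have "((\<lambda>x. - ((1 + \<alpha>) / 2) * x / (1 + x\<^sup>2) * bump x) has_real_derivative
     (- ((1 + \<alpha>) / 2) * (1 + x\<^sup>2) - (- ((1 + \<alpha>) / 2) * x) * (2 * x)) / ((1 + x\<^sup>2) * (1 + x\<^sup>2)) * bump x
      + (- ((1 + \<alpha>) / 2) * x / (1 + x\<^sup>2)) * bump' x) (at x)"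
    by (simp only: mult.commute)
  moreover have "(- ((1 + \<alpha>) / 2) * (1 + x\<^sup>2) - (- ((1 + \<alpha>) / 2) * x) * (2 * x)) / ((1 + x\<^sup>2) * (1 + x\<^sup>2)) * bump x
      + (- ((1 + \<alpha>) / 2) * x / (1 + x\<^sup>2)) * bump' x = bump'' x"
    unfolding bump'_def bump''_def B_def[symmetric] using q
    by (simp add: divide_simps) algebra
  ultimately show ?thesis by (simp add: bump'_def[abs_def])
qed

lemma bump'_bound: "\<bar>bump' x\<bar> \<le> bump x"
proof -
  have "2 * \<bar>x\<bar> \<le> 1 + x\<^sup>2" using zero_le_power2[of "\<bar>x\<bar> - 1"] by (simp add: power2_eq_square algebra_simps)
  moreover have "(1 + \<alpha>) / 2 * \<bar>x\<bar> \<le> 2 * \<bar>x\<bar>" using \<alpha> by (intro mult_right_mono) auto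
  ultimately have "\<bar>(1 + \<alpha>) / 2 * x\<bar> \<le> 1 + x\<^sup>2" using \<alpha> by (simp add: abs_mult)
  then have "\<bar>(1 + \<alpha>) / 2 * x / (1 + x\<^sup>2)\<bar> \<le> 1"
    using one_plus_square_pos[of x] by (simp add: abs_divide)
  then have "\<bar>(1 + \<alpha>) / 2 * x / (1 + x\<^sup>2)\<bar> * bump x \<le> 1 * bump x"
    using bump_pos[of x] by (intro mult_right_mono) auto
  then show ?thesis using bump_pos[of x] by (simp add: bump'_def abs_mult)
qed

lemma bump''_bound: "\<bar>bump'' x\<bar> \<le> 8 * bump x"
proof -
  let ?r = "x\<^sup>2 / (1 + x\<^sup>2)" and ?c = "(5 + \<alpha>) / 2"
  have r: "0 \<le> ?r" "?r \<le> 1" using one_plus_square_pos[of x] by (auto simp: field_simps)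
  have "?c * ?r \<le> 4 * 1" using \<alpha> r by (intro mult_mono) auto
  moreover have "0 \<le> ?c * ?r" using \<alpha> r by (intro mult_nonneg_nonneg) auto
  ultimately have "\<bar>?c * x\<^sup>2 / (1 + x\<^sup>2) - 1\<bar> \<le> 4" by auto
  then have "\<bar>(?c * x\<^sup>2 / (1 + x\<^sup>2) - 1) / (1 + x\<^sup>2)\<bar> \<le> 4 / 1"
    unfolding abs_divide using one_plus_square_pos[of x] by (intro frac_le) auto
  then have "\<bar>(1 + \<alpha>) / 2\<bar> * \<bar>(?c * x\<^sup>2 / (1 + x\<^sup>2) - 1) / (1 + x\<^sup>2)\<bar> \<le> 2 * 4"
    using \<alpha> by (intro mult_mono) auto
  then have "\<bar>(1 + \<alpha>) / 2 * ((?c * x\<^sup>2 / (1 + x\<^sup>2) - 1) / (1 + x\<^sup>2))\<bar> * bump x \<le> 8 * bump x"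
    unfolding abs_mult using bump_pos[of x] by (intro mult_right_mono) auto
  then show ?thesis using bump_pos[of x] by (simp add: bump''_def abs_mult)
qed

text \<open>Peetre's inequality 1 + x^2 \<le> 2 (1 + z^2) (1 + (x + z)^2), raised to a negative
  power.\<close>

lemma bump_shift: "bump (x + z) \<le> (2 * (1 + z\<^sup>2)) powr ((1 + \<alpha>) / 4) * bump x"
proof -
  have "1 + x\<^sup>2 \<le> 2 * (1 + z\<^sup>2) * (1 + (x + z)\<^sup>2)"
  proof -
    \<comment> \<open>The difference of the two sides, written as a sum of squares.\<close>
    have "0 \<le> (x + 2 * z)\<^sup>2 + 1 + 2 * (z * (x + z))\<^sup>2" by simp
    then show ?thesis by (simp add: power2_eq_square algebra_simps)
  qed
  then have "(2 * (1 + z\<^sup>2) * (1 + (x + z)\<^sup>2)) powr (- ((1 + \<alpha>) / 4)) \<le> (1 + x\<^sup>2) powr (- ((1 + \<alpha>) / 4))"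
    using \<alpha> one_plus_square_pos[of x] by (intro powr_mono2') auto
  then have "(2 * (1 + z\<^sup>2)) powr (- ((1 + \<alpha>) / 4)) * bump (x + z) \<le> bump x"
    using one_plus_square_pos[of z] one_plus_square_pos[of "x + z"] by (simp add: bump_def powr_mult)
  then show ?thesis
    using one_plus_square_pos[of z] by (simp add: powr_minus field_simps)
qed

lemma bump_shift_small: "\<bar>z\<bar> \<le> 1 \<Longrightarrow> bump (x + z) \<le> 4 * bump x"
proof -
  assume "\<bar>z\<bar> \<le> 1"
  then have "z\<^sup>2 \<le> 1" by (simp add: abs_square_le_1)
  then have "(2 * (1 + z\<^sup>2)) powr ((1 + \<alpha>) / 4) \<le> 4 powr ((1 + \<alpha>) / 4)"
    using \<alpha> by (intro powr_mono2) auto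
  also have "\<dots> \<le> 4 powr 1" using \<alpha> by (intro powr_mono) auto
  finally have "(2 * (1 + z\<^sup>2)) powr ((1 + \<alpha>) / 4) * bump x \<le> 4 * bump x"
    using bump_pos[of x] by (intro mult_right_mono) auto
  then show ?thesis using bump_shift[of x z] by linarith
qed

lemma bump_shift_large: "1 \<le> \<bar>z\<bar> \<Longrightarrow> bump (x + z) \<le> 4 * growth \<alpha> z * bump x"
proof -
  assume z: "1 \<le> \<bar>z\<bar>"
  then have z2: "1 \<le> z\<^sup>2" by (metis abs_1 abs_le_square_iff one_power2)
  have "(2 * (1 + z\<^sup>2)) powr ((1 + \<alpha>) / 4) \<le> (4 * z\<^sup>2) powr ((1 + \<alpha>) / 4)"
    using \<alpha> z2 by (intro powr_mono2) auto
  also have "\<dots> = 4 powr ((1 + \<alpha>) / 4) * (\<bar>z\<bar> powr 2) powr ((1 + \<alpha>) / 4)"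
    using z by (simp add: powr_mult)
  also have "(\<bar>z\<bar> powr 2) powr ((1 + \<alpha>) / 4) = growth \<alpha> z"
  proof -
    have "2 * ((1 + \<alpha>) / 4) = (1 + \<alpha>) / 2" by simp
    then show ?thesis by (simp only: powr_powr growth_large[OF \<alpha> z])
  qed
  also have "4 powr ((1 + \<alpha>) / 4) * growth \<alpha> z \<le> 4 powr 1 * growth \<alpha> z"
    using \<alpha> growth_nonneg by (intro mult_right_mono powr_mono) auto
  finally have "(2 * (1 + z\<^sup>2)) powr ((1 + \<alpha>) / 4) * bump x \<le> 4 * growth \<alpha> z * bump x"
    using bump_pos[of x] by (intro mult_right_mono) auto
  then show ?thesis using bump_shift[of x z] by linarith
qed

text \<open>What matters is the factor \<open>bump x\<close> on the right. For |z| \<le> 1 the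
  constant 32 is 8 from \<open>bump''_bound\<close> times 4 from comparing \<open>bump\<close> at
  points of distance at most 1. For longer jumps each term is at most a multiple of
  \<open>bump x * growth \<alpha> z\<close>, because \<open>growth\<close> has the same exponent as
  the loss in Peetre's inequality.\<close>

lemma bump_compensated: "\<bar>bump (x + z) - bump x - bump' x * z\<bar> \<le> 32 * bump x * growth \<alpha> z"
proof (cases "\<bar>z\<bar> \<le> 1")
  case True
  have "\<bar>bump (x + z) - bump x - bump' x * z\<bar> \<le> 32 * bump x * z\<^sup>2"
  proof (rule taylor2_bound[OF bump_deriv bump_deriv2])
    fix y assume "\<bar>y - x\<bar> \<le> \<bar>z\<bar>"
    then show "\<bar>bump'' y\<bar> \<le> 32 * bump x"
      using bump''_bound[of y] bump_shift_small[of "y - x" x] True by simp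
  qed
  then show ?thesis using growth_small[OF \<alpha> True] by simp
next
  case False
  then have z: "1 \<le> \<bar>z\<bar>" by simp
  have "\<bar>bump' x * z\<bar> \<le> bump x * growth \<alpha> z"
    unfolding abs_mult using bump'_bound abs_le_growth[OF \<alpha> z] bump_pos[of x] by (intro mult_mono) auto
  moreover have "bump x * 1 \<le> bump x * growth \<alpha> z"
    using abs_le_growth(2)[OF \<alpha> z] bump_pos[of x] by (intro mult_left_mono) auto
  moreover have "bump (x + z) \<le> 4 * (bump x * growth \<alpha> z)"
    using bump_shift_large[OF z, of x] by (simp add: mult_ac)
  moreover have "0 \<le> bump x * growth \<alpha> z" using bump_pos[of x] growth_nonneg[of \<alpha> z] by simp
  ultimately show ?thesis using bump_pos[of x] bump_pos[of "x + z"] unfolding mult.assoc by linarith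
qed

lemma bump_measurable [measurable]: "bump \<in> borel_measurable borel"
  by (rule DERIV_borel_measurable[OF bump_deriv])

lemma bump_integrable: "integrable lborel bump"
proof -
  define g where "g x = indicator {0..1} x * x powr 0 + indicator {1..} x * x powr (- ((1 + \<alpha>) / 2))" for x :: real
  have g: "integrable lborel g" unfolding g_def
    using \<alpha> by (intro Bochner_Integration.integrable_add integrable_powr_near_0 integrable_powr_tail) auto
  have g0: "0 \<le> g x" for x by (simp add: g_def)
  have pos: "bump x \<le> g x" if "0 < x" for x
  proof (cases "x \<le> 1")
    case True then show ?thesis using that bump_le_1[of x] by (simp add: g_def add_increasing2)
  next
    case False
    have "bump x \<le> (x powr 2) powr (- ((1 + \<alpha>) / 4))"
      unfolding bump_def using that \<alpha> by (intro powr_mono2') auto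
    also have "\<dots> = x powr (- ((1 + \<alpha>) / 2))"
    proof -
      have "2 * (- ((1 + \<alpha>) / 4)) = - ((1 + \<alpha>) / 2)" by simp
      then show ?thesis by (simp only: powr_powr)
    qed
    also have "\<dots> \<le> g x" using False by (simp add: g_def)
    finally show ?thesis .
  qed
  show ?thesis
  proof (rule Bochner_Integration.integrable_bound)
    show "integrable lborel (\<lambda>z. g z + g (- z))"
      using g integrable_lborel_reflect by (intro Bochner_Integration.integrable_add)
    show "AE z in lborel. norm (bump z) \<le> norm (g z + g (- z))"
      \<comment> \<open>The origin has to be left out: \<open>0 powr 0 = 0\<close>, so the majorant
        vanishes there while \<open>bump 0 = 1\<close>.\<close>
      using AE_lborel_singleton[of 0]
    proof eventually_elim
      case (elim z)
      have "bump z \<le> g z + g (- z)"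
      proof (cases "z > 0")
        case True then show ?thesis using pos[of z] g0[of "-z"] by simp
      next
        case False
        then show ?thesis using pos[of "-z"] g0[of z] elim by (simp add: bump_def)
      qed
      then show ?case using bump_pos[of z] by simp
    qed
  qed measurable
qed

lemma bump_vanish: "(bump \<longlongrightarrow> 0) at_top" "(bump \<longlongrightarrow> 0) at_bot"
proof -
  have 1: "filterlim (\<lambda>x::real. 1 + x\<^sup>2) at_top at_top"
    by (intro filterlim_tendsto_add_at_top[OF tendsto_const] filterlim_pow_at_top filterlim_ident) auto
  then show t: "(bump \<longlongrightarrow> 0) at_top"
    unfolding bump_def using \<alpha> by (intro tendsto_neg_powr) auto
  have "(\<lambda>x. bump (- x)) = bump" by (simp add: fun_eq_iff bump_def)
  then show "(bump \<longlongrightarrow> 0) at_bot" using t by (simp add: filterlim_at_bot_mirror)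
qed

section \<open>Dilated weights and their Levy estimates\<close>

definition scaled_bump :: "real \<Rightarrow> real \<Rightarrow> real" where
  "scaled_bump R x = bump (x / R)"

definition scaled_bump' :: "real \<Rightarrow> real \<Rightarrow> real" where
  "scaled_bump' R x = bump' (x / R) / R"

text \<open>Both exponents in \<open>growth\<close> exceed 1, so a dilation by R gains at least one
  factor 1/R. This gain makes the Gronwall constants of the dilated weights tend to zero.\<close>

lemma growth_scale: "1 \<le> R \<Longrightarrow> growth \<alpha> (z / R) \<le> growth \<alpha> z / R"
proof -
  assume R: "1 \<le> R"
  have "R powr 1 \<le> R powr ((1 + \<alpha>) / 2)" using R \<alpha> by (intro powr_mono) auto
  then have R1: "R \<le> R powr ((1 + \<alpha>) / 2)" using R by simp
  have "R * 1 \<le> R * R" using R by (intro mult_left_mono) auto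
  then have R2: "R \<le> R\<^sup>2" by (simp add: power2_eq_square)
  have "(z / R)\<^sup>2 \<le> z\<^sup>2 / R" using R R2 by (simp add: power_divide frac_le)
  moreover have "\<bar>z / R\<bar> powr ((1 + \<alpha>) / 2) \<le> \<bar>z\<bar> powr ((1 + \<alpha>) / 2) / R"
    using R R1 by (simp add: abs_divide powr_divide frac_le)
  ultimately have "growth \<alpha> (z / R) \<le> min (z\<^sup>2 / R) (\<bar>z\<bar> powr ((1 + \<alpha>) / 2) / R)"
    unfolding growth_def by (rule min.mono)
  also have "\<dots> = growth \<alpha> z / R" using R by (simp add: growth_def min_divide_distrib_right)
  finally show ?thesis .
qed

lemma scaled_bump_bounds: "0 < scaled_bump R x" "scaled_bump R x \<le> 1"
  by (simp_all add: scaled_bump_def bump_pos bump_le_1)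

lemma scaled_bump_deriv:
  assumes "1 \<le> R" shows "(scaled_bump R has_real_derivative scaled_bump' R x) (at x)"
proof -
  have "((\<lambda>x. bump (x / R)) has_real_derivative bump' (x / R) * (1 / R)) (at x)"
    by (rule DERIV_chain2[OF bump_deriv]) (use assms in \<open>auto intro!: derivative_eq_intros\<close>)
  then show ?thesis by (simp add: scaled_bump_def[abs_def] scaled_bump'_def)
qed

lemma scaled_bump'_bound: "1 \<le> R \<Longrightarrow> \<bar>scaled_bump' R x\<bar> \<le> scaled_bump R x / R"
  using bump'_bound[of "x / R"] by (simp add: scaled_bump'_def scaled_bump_def abs_divide divide_right_mono)

lemma scaled_bump'_cont: "1 \<le> R \<Longrightarrow> isCont (scaled_bump' R) x"
  unfolding scaled_bump'_def[abs_def]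
  by (intro continuous_intros isCont_o2[OF _ DERIV_isCont[OF bump_deriv2]]) auto

lemma scaled_bump_measurable [measurable]: "scaled_bump R \<in> borel_measurable borel"
  unfolding scaled_bump_def[abs_def] by measurable

lemma scaled_bump_integrable: "1 \<le> R \<Longrightarrow> integrable lborel (scaled_bump R)"
  unfolding scaled_bump_def[abs_def]
  using lborel_integrable_real_affine[OF bump_integrable, of "1 / R" 0] by simp

lemma scaled_bump_vanish:
  assumes "1 \<le> R" shows "(scaled_bump R \<longlongrightarrow> 0) at_top" "(scaled_bump R \<longlongrightarrow> 0) at_bot"
proof -
  have "filterlim (\<lambda>x. x / R) at_top at_top"
    using filterlim_tendsto_pos_mult_at_top[OF tendsto_const[of "1/R"] _ filterlim_ident] assms by simp
  then show t: "(scaled_bump R \<longlongrightarrow> 0) at_top"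
    unfolding scaled_bump_def[abs_def] by (rule filterlim_compose[OF bump_vanish(1)])
  have "(\<lambda>x. scaled_bump R (- x)) = scaled_bump R" by (simp add: fun_eq_iff bump_def scaled_bump_def)
  then show "(scaled_bump R \<longlongrightarrow> 0) at_bot" using t by (simp add: filterlim_at_bot_mirror)
qed

lemma scaled_bump_jump:
  assumes "1 \<le> R" "0 < \<epsilon>" "\<epsilon> \<le> 1"
  shows "\<bar>jump (levy \<alpha> \<epsilon>) (scaled_bump R) x\<bar> \<le> 32 * levy_mass \<alpha> * scaled_bump R x / R"
proof -
  have "\<bar>jump (levy \<alpha> \<epsilon>) (scaled_bump R) x\<bar> \<le> 32 * scaled_bump R x / R * levy_mass \<alpha>"
    unfolding jump_def
  proof (rule levy_weight_bound[OF \<alpha> assms(2,3) scaled_bump_measurable])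
    show "\<bar>scaled_bump R x\<bar> \<le> 1" for x using scaled_bump_bounds[of R x] by simp
    show "0 \<le> 32 * scaled_bump R x / R" using scaled_bump_bounds[of R x] assms by simp
    show "\<bar>scaled_bump R (x + z) - scaled_bump R x - scaled_bump' R x * z\<bar> \<le> 32 * scaled_bump R x / R * growth \<alpha> z" for z
    proof -
      have "\<bar>bump (x / R + z / R) - bump (x / R) - bump' (x / R) * (z / R)\<bar> \<le> 32 * bump (x / R) * growth \<alpha> (z / R)"
        by (rule bump_compensated)
      also have "\<dots> \<le> 32 * bump (x / R) * (growth \<alpha> z / R)"
        using growth_scale[OF assms(1)] bump_pos[of "x / R"] by (intro mult_left_mono) auto
      finally show ?thesis by (simp add: scaled_bump_def scaled_bump'_def add_divide_distrib)
    qed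
  qed
  then show ?thesis by (simp add: mult_ac)
qed

text \<open>One constant for both demands on a weight: 32 \<open>levy_mass\<close> covers the jumps,
  the summand 1 the derivative.\<close>

definition weight_const :: real where
  "weight_const = 32 * levy_mass \<alpha> + 1"

lemma weight_const_ge_1: "1 \<le> weight_const"
  using levy_mass_nonneg[OF \<alpha>] by (simp add: weight_const_def)

lemma scaled_bump_weight:
  assumes R: "1 \<le> R"
  shows "levy_weight \<alpha> (scaled_bump R) (scaled_bump' R) (weight_const / R)"
  unfolding levy_weight_def
proof (intro conjI allI impI)
  have b: "scaled_bump R x / R \<le> weight_const / R * scaled_bump R x" for x
    using mult_right_mono[OF weight_const_ge_1, of "scaled_bump R x / R"] scaled_bump_bounds[of R x] R by simp
  show "weight (scaled_bump R) (scaled_bump' R) 2 (weight_const / R)"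
  proof
    fix x
    show "\<bar>scaled_bump' R x\<bar> \<le> weight_const / R * scaled_bump R x"
      using scaled_bump'_bound[OF R, of x] b[of x] by linarith
    show "0 \<le> scaled_bump R x" "scaled_bump R x \<le> 2" using scaled_bump_bounds[of R x] by simp_all
  qed (use R scaled_bump_integrable scaled_bump_deriv scaled_bump'_cont scaled_bump_vanish in auto)
  show "0 \<le> weight_const / R" using weight_const_ge_1 R by simp
  fix \<epsilon> x :: real assume "0 < \<epsilon>" "\<epsilon> \<le> 1"
  then have "jump (levy \<alpha> \<epsilon>) (scaled_bump R) x \<le> 32 * levy_mass \<alpha> * scaled_bump R x / R"
    using scaled_bump_jump[OF R] by (meson abs_ge_self order_trans)
  also have "\<dots> \<le> weight_const / R * scaled_bump R x"
    using scaled_bump_bounds[of R x] R by (simp add: weight_const_def divide_right_mono)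
  finally show "jump (levy \<alpha> \<epsilon>) (scaled_bump R) x \<le> weight_const / R * scaled_bump R x" .
qed

lemma scaled_bump_mono: "1 \<le> R \<Longrightarrow> R \<le> S \<Longrightarrow> scaled_bump R x \<le> scaled_bump S x"
proof -
  assume RS: "1 \<le> R" "R \<le> S"
  then have "(\<bar>x\<bar> / S)\<^sup>2 \<le> (\<bar>x\<bar> / R)\<^sup>2" by (intro power_mono divide_left_mono) auto
  then have "(x / S)\<^sup>2 \<le> (x / R)\<^sup>2" by (simp add: power_divide)
  then show ?thesis
    unfolding scaled_bump_def bump_def using \<alpha> one_plus_square_pos by (intro powr_mono2') auto
qed

text \<open>As \<open>S \<rightarrow> \<infinity>\<close> these weights increase to \<open>1 - scaled_bump R\<close> up to \<open>1 / R\<close>, which measures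
  the mass far away from the origin.\<close>

definition tail_weight :: "real \<Rightarrow> real \<Rightarrow> real \<Rightarrow> real" where
  "tail_weight R S x = (1 + 1 / R) * scaled_bump S x - scaled_bump R x"

definition tail_weight' :: "real \<Rightarrow> real \<Rightarrow> real \<Rightarrow> real" where
  "tail_weight' R S x = (1 + 1 / R) * scaled_bump' S x - scaled_bump' R x"

text \<open>At the origin \<open>scaled_bump S - scaled_bump R\<close> has a minimum with value
  zero, where its jump operator is positive if R < S, so no bound by a multiple of the weight itself
  could hold. The extra \<open>scaled_bump S / R\<close> lifts the weight just enough to dominate
  the terms of size 1/R coming from the inner bump. Here the constant stays bounded instead of
  small, which suffices because the tail is compared with an earlier tail that is small
  itself.\<close>

lemma tail_weight:
  assumes R: "1 \<le> R" "R \<le> S"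
  shows "levy_weight \<alpha> (tail_weight R S) (tail_weight' R S) (3 * weight_const)"
  unfolding levy_weight_def
proof (intro conjI allI impI)
  have S: "1 \<le> S" using R by simp
  have c1: "1 + 1 / R \<le> 2" "0 \<le> 1 + 1 / R" using R by (auto simp: field_simps)
  have lower: "scaled_bump S x / R \<le> tail_weight R S x" for x
    using scaled_bump_mono[OF R, of x] by (simp add: tail_weight_def algebra_simps)
  \<comment> \<open>The outer bump costs at most twice \<open>scaled_bump S x / R\<close>, by 1 +
    1/R \<le> 2 and R \<le> S, and the inner one at most once this amount, which is itself at most
    \<open>tail_weight R S x\<close>. Used with c = 1 for the derivative and c = 32
    \<open>levy_mass\<close> for the jumps.\<close>
  have sum_le: "(1 + 1 / R) * (c * scaled_bump S x / S) + c * scaled_bump R x / R \<le> 3 * c * tail_weight R S x"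
    if "0 \<le> c" for c x
  proof -
    have "scaled_bump S x / S \<le> scaled_bump S x / R"
      using R scaled_bump_bounds[of S x] by (intro divide_left_mono) auto
    then have "(1 + 1 / R) * (scaled_bump S x / S) \<le> 2 * (scaled_bump S x / R)"
      using c1 S scaled_bump_bounds[of S x] by (intro mult_mono) auto
    moreover have "scaled_bump R x / R \<le> scaled_bump S x / R"
      using scaled_bump_mono[OF R, of x] R by (intro divide_right_mono) auto
    ultimately have "(1 + 1 / R) * (scaled_bump S x / S) + scaled_bump R x / R \<le> 3 * tail_weight R S x"
      using lower[of x] by linarith
    from mult_left_mono[OF this that] show ?thesis by (simp add: algebra_simps)
  qed
  show "weight (tail_weight R S) (tail_weight' R S) 2 (3 * weight_const)"
  proof
    fix x
    show tn: "0 \<le> tail_weight R S x" using lower[of x] scaled_bump_bounds[of S x] R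
      by (meson divide_nonneg_nonneg less_imp_le order_trans zero_le_one)
    have "(1 + 1 / R) * scaled_bump S x \<le> 2 * 1"
      using c1 scaled_bump_bounds[of S x] by (intro mult_mono) auto
    then show "tail_weight R S x \<le> 2" using scaled_bump_bounds[of R x] by (simp add: tail_weight_def)
    show "(tail_weight R S has_real_derivative tail_weight' R S x) (at x)"
      unfolding tail_weight_def[abs_def] tail_weight'_def
      by (intro DERIV_diff DERIV_cmult scaled_bump_deriv R S)
    show "isCont (tail_weight' R S) x"
      unfolding tail_weight'_def[abs_def] by (intro continuous_intros scaled_bump'_cont R S)
    have "\<bar>tail_weight' R S x\<bar> \<le> (1 + 1 / R) * \<bar>scaled_bump' S x\<bar> + \<bar>scaled_bump' R x\<bar>"
      unfolding tail_weight'_def using c1 by (intro order_trans[OF abs_triangle_ineq4]) (simp add: abs_mult)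
    also have "\<dots> \<le> (1 + 1 / R) * (scaled_bump S x / S) + scaled_bump R x / R"
      using c1 by (intro add_mono mult_left_mono scaled_bump'_bound R S) auto
    also have "\<dots> \<le> 3 * tail_weight R S x" using sum_le[of 1 x] by simp
    also have "\<dots> \<le> 3 * weight_const * tail_weight R S x"
      using weight_const_ge_1 tn by (simp add: mult_right_mono mult_le_cancel_right1)
    finally show "\<bar>tail_weight' R S x\<bar> \<le> 3 * weight_const * tail_weight R S x" .
  next
    show "integrable lborel (tail_weight R S)" unfolding tail_weight_def[abs_def]
      by (intro Bochner_Integration.integrable_diff integrable_mult_right scaled_bump_integrable R S)
    show "(tail_weight R S \<longlongrightarrow> 0) at_top" "(tail_weight R S \<longlongrightarrow> 0) at_bot"
      using tendsto_diff[OF tendsto_mult_left[OF scaled_bump_vanish(1)[OF S], of "1 + 1 / R"] scaled_bump_vanish(1)[OF R(1)]]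
        tendsto_diff[OF tendsto_mult_left[OF scaled_bump_vanish(2)[OF S], of "1 + 1 / R"] scaled_bump_vanish(2)[OF R(1)]]
      by (simp_all add: tail_weight_def[abs_def])
  qed
  show "0 \<le> 3 * weight_const" using weight_const_ge_1 by simp
  fix \<epsilon> x :: real assume \<epsilon>: "0 < \<epsilon>" "\<epsilon> \<le> 1"
  interpret symmetric_measure "levy \<alpha> \<epsilon>" by (rule symmetric_measure_levy[OF \<epsilon>])
  have ab: "\<bar>scaled_bump r y\<bar> \<le> 1" for r y using scaled_bump_bounds[of r y] by simp
  have i: "integrable (levy \<alpha> \<epsilon>) (\<lambda>z. scaled_bump r (x + z) - scaled_bump r x)" for r
    by (intro Bochner_Integration.integrable_diff integrable_bounded_shift(1)[OF scaled_bump_measurable ab] integrable_const)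
  have "jump (levy \<alpha> \<epsilon>) (tail_weight R S) x = (\<integral>z. (1 + 1 / R) * (scaled_bump S (x + z) - scaled_bump S x)
     - (scaled_bump R (x + z) - scaled_bump R x) \<partial>levy \<alpha> \<epsilon>)"
    unfolding jump_def tail_weight_def by (intro Bochner_Integration.integral_cong refl) (simp only: algebra_simps)
  also have "\<dots> = (1 + 1 / R) * jump (levy \<alpha> \<epsilon>) (scaled_bump S) x - jump (levy \<alpha> \<epsilon>) (scaled_bump R) x"
    using Bochner_Integration.integral_diff[OF integrable_mult_right[OF i[of S], of "1 + 1 / R"] i[of R]]
    by (simp only: jump_def integral_mult_right_zero)
  also have "\<dots> \<le> (1 + 1 / R) * (32 * levy_mass \<alpha> * scaled_bump S x / S) + 32 * levy_mass \<alpha> * scaled_bump R x / R"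
  proof -
    have "jump (levy \<alpha> \<epsilon>) (scaled_bump S) x \<le> 32 * levy_mass \<alpha> * scaled_bump S x / S"
      using scaled_bump_jump[OF S \<epsilon>, of x] by linarith
    from mult_left_mono[OF this c1(2)] show ?thesis
      using scaled_bump_jump[OF R(1) \<epsilon>, of x] by linarith
  qed
  also have "\<dots> \<le> 3 * (32 * levy_mass \<alpha>) * tail_weight R S x"
    using levy_mass_nonneg[OF \<alpha>] by (intro sum_le) auto
  also have "\<dots> \<le> 3 * weight_const * tail_weight R S x"
    using order_trans[OF _ lower[of x], of 0] scaled_bump_bounds[of S x] R
    by (intro mult_right_mono) (auto simp: weight_const_def)
  finally show "jump (levy \<alpha> \<epsilon>) (tail_weight R S) x \<le> 3 * weight_const * tail_weight R S x" .
qed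

end

section \<open>Regularity of solutions for positive times\<close>

text \<open>Derivatives are expressed by \<open>deriv\<close> and not by the family D of
  \<open>Cb_inf_on\<close>: that family is only known to exist for each time interval separately,
  whereas \<open>dx\<close> and \<open>dt\<close> have one meaning for all of them.\<close>

definition dx :: "(real \<Rightarrow> real \<Rightarrow> real) \<Rightarrow> real \<Rightarrow> real \<Rightarrow> real" where
  "dx u t x = deriv (u t) x"

definition dt :: "(real \<Rightarrow> real \<Rightarrow> real) \<Rightarrow> real \<Rightarrow> real \<Rightarrow> real" where
  "dt u t x = deriv (\<lambda>s. u s x) t"

lemma C2_bounded_diff:
  assumes "C2_bounded f f1 f2 K" "C2_bounded g g1 g2 K'"
  shows "C2_bounded (\<lambda>x. f x - g x) (\<lambda>x. f1 x - g1 x) (\<lambda>x. f2 x - g2 x) (K + K')"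
proof -
  have "\<bar>a - b\<bar> \<le> K + K'" if "\<bar>a\<bar> \<le> K" "\<bar>b\<bar> \<le> K'" for a b :: real using that by linarith
  then show ?thesis using assms unfolding C2_bounded_def by (auto intro!: derivative_intros)
qed

text \<open>The finitely many derivatives that the estimates use, under one bound K on a fixed time
  interval. K may degenerate as the interval approaches 0, so it must disappear from every estimate
  that is to reach t = 0.\<close>

definition regular_flow :: "real \<Rightarrow> real set \<Rightarrow> (real \<Rightarrow> real \<Rightarrow> real) \<Rightarrow> real \<Rightarrow> bool" where
  "regular_flow \<alpha> I u K \<longleftrightarrow> (\<forall>t\<in>I.
     C2_bounded (u t) (dx u t) (dx (dx u) t) K \<and>
     C2_bounded (dx u t) (dx (dx u) t) (dx (dx (dx u)) t) K \<and>
     (\<forall>x. ((\<lambda>s. u s x) has_real_derivative dt u t x) (at t) \<and>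
        ((\<lambda>s. dx u s x) has_real_derivative dt (dx u) t x) (at t) \<and>
        (dt u t has_real_derivative dt (dx u) t x) (at x) \<and>
        isCont (dt (dx u) t) x \<and>
        \<bar>dt u t x\<bar> \<le> K \<and> \<bar>dt (dx u) t x\<bar> \<le> K \<and>
        dt u t x + frac_lap \<alpha> (u t) x + u t x * dx u t x = 0))"

text \<open>The mixed derivative is the single entry \<open>D 1 1\<close>, so equality of the two
  orders of differentiation is built into the smoothness condition. The solution agrees with D only
  for times in the interval; as this is open, time derivatives carry over.\<close>

lemma is_solution_regular_flow:
  assumes sol: "is_solution \<alpha> u0 u" and a: "0 < a" "a < T"
  obtains K where "regular_flow \<alpha> {a<..<T} u K"
proof -
  let ?I = "{a<..<T}"
  from sol a have "Cb_inf_on ?I u" unfolding is_solution_def by auto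
  then obtain D :: "nat \<Rightarrow> nat \<Rightarrow> real \<Rightarrow> real \<Rightarrow> real" where
    D0: "\<And>t x. t \<in> ?I \<Longrightarrow> D 0 0 t x = u t x" and
    Dt: "\<And>i j t x. t \<in> ?I \<Longrightarrow> ((\<lambda>s. D i j s x) has_real_derivative D (Suc i) j t x) (at t)" and
    Dx: "\<And>i j t x. t \<in> ?I \<Longrightarrow> ((\<lambda>y. D i j t y) has_real_derivative D i (Suc j) t x) (at x)" and
    Db: "\<And>i j. Cb_on ?I (D i j)"
    unfolding Cb_inf_on_def by blast
  have "\<forall>i j. \<exists>B. \<forall>t\<in>?I. \<forall>x. \<bar>D i j t x\<bar> \<le> B"
  proof (intro allI)
    fix i j
    from Db[of i j] obtain B where "\<forall>y \<in> (\<lambda>(t, x). D i j t x) ` (?I \<times> UNIV). norm y \<le> B"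
      unfolding Cb_on_def bounded_iff by auto
    then show "\<exists>B. \<forall>t\<in>?I. \<forall>x. \<bar>D i j t x\<bar> \<le> B" by (intro exI[of _ B]) auto
  qed
  then obtain B where B: "\<And>i j t x. t \<in> ?I \<Longrightarrow> \<bar>D i j t x\<bar> \<le> B i j" by metis
  \<comment> \<open>At most one time derivative and three space derivatives occur.\<close>
  define K where "K = Max (insert 0 ((\<lambda>(i, j). B i j) ` ({..1} \<times> {..3})))"
  have K: "\<bar>D i j t x\<bar> \<le> K" if "t \<in> ?I" "i \<le> 1" "j \<le> 3" for i j t x
  proof -
    have "B i j \<in> (\<lambda>(i, j). B i j) ` ({..1} \<times> {..3})" using that by (intro image_eqI[of _ _ "(i, j)"]) auto
    then have "B i j \<le> K" unfolding K_def by (intro Max_ge) auto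
    then show ?thesis using B[OF that(1), of i j x] by simp
  qed
  have u: "u t = D 0 0 t" if "t \<in> ?I" for t using D0[OF that] by auto
  have x1: "dx v t = D i (Suc j) t" if "t \<in> ?I" "\<And>s. s \<in> ?I \<Longrightarrow> v s = D i j s" for v i j t
    using DERIV_imp_deriv[OF Dx[OF that(1), of i j]] that(2)[OF that(1)] by (intro ext) (simp add: dx_def)
  have t0: "((\<lambda>s. v s x) has_real_derivative D (Suc i) j t x) (at t)"
    if "t \<in> ?I" "\<And>s. s \<in> ?I \<Longrightarrow> v s = D i j s" for v i j t x
    using Dt[OF that(1), of i j x] by (rule has_field_derivative_transform_within_open[where S="?I"]) (use that in auto)
  have t1: "dt v t = D (Suc i) j t" if "t \<in> ?I" "\<And>s. s \<in> ?I \<Longrightarrow> v s = D i j s" for v i j t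
    using DERIV_imp_deriv[OF t0[OF that]] by (intro ext) (simp add: dt_def)
  have v1: "dx u t = D 0 1 t" if "t \<in> ?I" for t using x1[OF that u] by simp
  have v2: "dx (dx u) t = D 0 2 t" if "t \<in> ?I" for t using x1[OF that v1] by (simp add: numeral_2_eq_2)
  have v3: "dx (dx (dx u)) t = D 0 3 t" if "t \<in> ?I" for t using x1[OF that v2] by (simp add: numeral_3_eq_3 numeral_2_eq_2)
  have w0: "dt u t = D 1 0 t" if "t \<in> ?I" for t using t1[OF that u] by simp
  have w1: "dt (dx u) t = D 1 1 t" if "t \<in> ?I" for t using t1[OF that v1] by simp
  have "regular_flow \<alpha> ?I u K"
    unfolding regular_flow_def
  proof (intro ballI conjI allI)
    fix t x assume t: "t \<in> ?I"
    have pde: "\<forall>T>0. (\<forall>t\<in>{0<..<T}. \<forall>x. deriv (\<lambda>s. u s x) t + frac_lap \<alpha> (u t) x + u t x * deriv (u t) x = 0)"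
      using sol unfolding is_solution_def by blast
    have "0 < T" "t \<in> {0<..<T}" using t a by auto
    then show "dt u t x + frac_lap \<alpha> (u t) x + u t x * dx u t x = 0"
      using pde unfolding dt_def dx_def by blast
    show "C2_bounded (u t) (dx u t) (dx (dx u) t) K"
      unfolding C2_bounded_def u[OF t] v1[OF t] v2[OF t]
      using Dx[OF t, of 0 0] Dx[OF t, of 0 1] K[OF t, of 0] by (auto simp: numeral_2_eq_2)
    show "C2_bounded (dx u t) (dx (dx u) t) (dx (dx (dx u)) t) K"
      unfolding C2_bounded_def v1[OF t] v2[OF t] v3[OF t]
      using Dx[OF t, of 0 1] Dx[OF t, of 0 2] K[OF t, of 0] by (auto simp: numeral_2_eq_2 numeral_3_eq_3)
    show "((\<lambda>s. u s x) has_real_derivative dt u t x) (at t)"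
      unfolding w0[OF t] using t0[OF t u] by simp
    show "((\<lambda>s. dx u s x) has_real_derivative dt (dx u) t x) (at t)"
      unfolding w1[OF t] using t0[OF t v1] by simp
    show "(dt u t has_real_derivative dt (dx u) t x) (at x)"
      unfolding w0[OF t] w1[OF t] using Dx[OF t, of 1 0] by simp
    show "isCont (dt (dx u) t) x"
      unfolding w1[OF t] using Dx[OF t, of 1 1] by (rule DERIV_isCont)
    show "\<bar>dt u t x\<bar> \<le> K" "\<bar>dt (dx u) t x\<bar> \<le> K"
      unfolding w0[OF t] w1[OF t] using K[OF t, of 1] by auto
  qed
  then show ?thesis by (rule that)
qed

text \<open>In contrast to the bounds on derivatives, this one reaches down to t = 0. The
  normalisation M \<ge> 1 keeps the constants built from M positive.\<close>

lemma is_solution_bounded: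
  assumes sol: "is_solution \<alpha> u0 u" and T: "0 < T"
  obtains M where "1 \<le> M" "\<And>t x. 0 < t \<Longrightarrow> t < T \<Longrightarrow> \<bar>u t x\<bar> \<le> M"
proof -
  from sol T have "Cb_on {0<..<T} u" unfolding is_solution_def by blast
  then obtain B where "\<forall>y \<in> (\<lambda>(t, x). u t x) ` ({0<..<T} \<times> UNIV). norm y \<le> B"
    unfolding Cb_on_def bounded_iff by auto
  then have "\<bar>u t x\<bar> \<le> max 1 B" if "0 < t" "t < T" for t x using that by (auto simp: le_max_iff_disj)
  then show ?thesis by (intro that[of "max 1 B"]) auto
qed

text \<open>Differentiation under the integral sign: the x-derivative of the compensated increment
  of f is the compensated increment of f1, dominated by \<open>growth\<close> uniformly in
  x.\<close>

lemma frac_lap_deriv: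
  assumes \<alpha>: "1 < \<alpha>" "\<alpha> < 2" and f: "C2_bounded f f1 f2 K" "C2_bounded f1 f2 f3 K"
    and m: "\<And>x. isCont f2 x"
  shows "(frac_lap \<alpha> f has_real_derivative frac_lap \<alpha> f1 x) (at x)"
proof -
  have [measurable]: "f \<in> borel_measurable borel" "f1 \<in> borel_measurable borel" "f2 \<in> borel_measurable borel"
    using C2_bounded_measurable[OF f(1)] isCont_borel_measurable[OF m] by auto
  let ?q = "\<lambda>f f1 s z. (f (s + z) - f s - f1 s * z) / \<bar>z\<bar> powr (1 + \<alpha>)"
  have "((\<lambda>s. LBINT z. ?q f f1 s z) has_real_derivative (LBINT z. ?q f1 f2 x z)) (at x)"
  proof (rule has_derivative_lebesgue_integral[of UNIV _ _ "\<lambda>z. 3 * K * (growth \<alpha> z / \<bar>z\<bar> powr (1 + \<alpha>))"])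
    show "integrable lborel (\<lambda>z. 3 * K * (growth \<alpha> z / \<bar>z\<bar> powr (1 + \<alpha>)))"
      using integrable_growth[OF \<alpha>] by (intro integrable_mult_right)
    show "integrable lborel (?q f f1 s)" for s
      by (rule integrable_compensated[OF \<alpha> f(1)])
    show "((\<lambda>s. ?q f f1 s z) has_real_derivative ?q f1 f2 s z) (at s)" for s z
    proof -
      have "((\<lambda>s. f (s + z)) has_real_derivative f1 (s + z)) (at s)"
        using C2_boundedD(1)[OF f(1), of "s + z"] by (simp add: DERIV_shift)
      then show ?thesis
        by (intro DERIV_cdivide DERIV_diff DERIV_cmult_right C2_boundedD(1)[OF f(1)] C2_boundedD(2)[OF f(1)])
    qed
    show "\<bar>?q f1 f2 s z\<bar> \<le> 3 * K * (growth \<alpha> z / \<bar>z\<bar> powr (1 + \<alpha>))" for s z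
      using C2_bounded_compensated_growth[OF \<alpha> f(2), of s z] by (simp add: abs_divide divide_right_mono)
    show "?q f1 f2 x \<in> borel_measurable lborel" by measurable
  qed auto
  from DERIV_cmult[OF this, of "- frac_const \<alpha>"]
  show ?thesis
    unfolding frac_lap_C2[OF f(2)] by (simp add: frac_lap_C2[OF f(1), abs_def])
qed

context
  fixes \<alpha> I u K
  assumes \<alpha>: "1 < \<alpha>" "\<alpha> < 2" and flow: "regular_flow \<alpha> I u K"
begin

lemma flow_C2: "t \<in> I \<Longrightarrow> C2_bounded (u t) (dx u t) (dx (dx u) t) K"
  "t \<in> I \<Longrightarrow> C2_bounded (dx u t) (dx (dx u) t) (dx (dx (dx u)) t) K"
  using flow by (auto simp: regular_flow_def)

lemma flow_time_deriv:
  "t \<in> I \<Longrightarrow> ((\<lambda>s. u s x) has_real_derivative dt u t x) (at t)"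
  "t \<in> I \<Longrightarrow> ((\<lambda>s. dx u s x) has_real_derivative dt (dx u) t x) (at t)"
  "t \<in> I \<Longrightarrow> (dt u t has_real_derivative dt (dx u) t x) (at x)"
  "t \<in> I \<Longrightarrow> isCont (dt (dx u) t) x"
  "t \<in> I \<Longrightarrow> \<bar>dt u t x\<bar> \<le> K" "t \<in> I \<Longrightarrow> \<bar>dt (dx u) t x\<bar> \<le> K"
  using flow by (auto simp: regular_flow_def)

lemma flow_equation: "t \<in> I \<Longrightarrow> dt u t x + frac_lap \<alpha> (u t) x + u t x * dx u t x = 0"
  using flow by (auto simp: regular_flow_def)

text \<open>Solving the equation for \<open>dt u\<close> exhibits an explicit x-derivative of it,
  which uniqueness of derivatives identifies with \<open>dt (dx u)\<close>.\<close>

lemma flow_deriv_equation: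
  assumes t: "t \<in> I"
  shows "dt (dx u) t x + frac_lap \<alpha> (dx u t) x + (dx u t x * dx u t x + u t x * dx (dx u) t x) = 0"
proof -
  note C = flow_C2[OF t]
  have c: "isCont (dx (dx u) t) x" for x using C2_boundedD(2)[OF C(2)] by (rule DERIV_isCont)
  have e: "dt u t = (\<lambda>x. - frac_lap \<alpha> (u t) x - u t x * dx u t x)"
    using flow_equation[OF t] by (intro ext) (simp add: algebra_simps eq_neg_iff_add_eq_0 add.commute)
  have "((\<lambda>x. - frac_lap \<alpha> (u t) x - u t x * dx u t x) has_real_derivative
     - frac_lap \<alpha> (dx u t) x - (dx u t x * dx u t x + dx (dx u) t x * u t x)) (at x)"
    by (intro DERIV_diff DERIV_minus DERIV_mult' frac_lap_deriv[OF \<alpha> C c] DERIV_mult C2_boundedD(1,2)[OF C(1)])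
  then have "dt (dx u) t x = - frac_lap \<alpha> (dx u t) x - (dx u t x * dx u t x + dx (dx u) t x * u t x)"
    using flow_time_deriv(3)[OF t, of x] unfolding e by (rule DERIV_unique[rotated])
  then show ?thesis by (simp add: algebra_simps)
qed

lemma levy_approx_jump:
  assumes "0 < \<epsilon>" "\<epsilon> \<le> 1" "C2_bounded f f1 f2 B"
  shows "\<bar>frac_lap \<alpha> f x + jump (levy \<alpha> \<epsilon>) f x\<bar> \<le> B * levy_error \<alpha> \<epsilon>"
  using levy_approx[OF \<alpha> assms] by (simp add: jump_def)

end

section \<open>Gradient bound by the nonlinear maximum principle\<close>

text \<open>A quantitative Fermat rule: a step k in either direction gives |q1 x| \<le> e/k + K k,
  and k = sqrt e balances the two terms.\<close>

lemma abs_deriv_near_max: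
  assumes q: "C2_bounded q q1 q2 K" and e: "0 < e" and max: "\<And>y. q y \<le> q x + e"
  shows "\<bar>q1 x\<bar> \<le> (1 + K) * sqrt e"
proof -
  let ?k = "sqrt e"
  have k: "0 < ?k" "?k * ?k = e" using e by auto
  have "\<bar>q (x + ?k) - q x - q1 x * ?k\<bar> \<le> K * ?k\<^sup>2" "\<bar>q (x + - ?k) - q x - q1 x * - ?k\<bar> \<le> K * (- ?k)\<^sup>2"
    by (rule C2_bounded_compensated_square[OF q])+
  then have "q1 x * ?k \<le> e + K * e" "- q1 x * ?k \<le> e + K * e"
    using max[of "x + ?k"] max[of "x + - ?k"] e by (auto simp: abs_le_iff)
  then have "\<bar>q1 x\<bar> * ?k \<le> (1 + K) * ?k * ?k" using k by (auto simp: abs_if algebra_simps)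
  then show ?thesis using k(1) by simp
qed

context
  fixes \<alpha> :: real
  assumes \<alpha>: "1 < \<alpha>" "\<alpha> < 2"
begin

text \<open>The derivative of a function bounded by M cannot stay close to the height q x over an
  interval much longer than M / q x. Its drop there, weighed with the Levy density at distance of
  order M / q x, yields the power q x^(1+\<alpha>). The condition \<epsilon> \<le> 4 M / q x keeps
  the truncation away from that interval, and \<open>e\<close> times the total mass is the price for
  x being only nearly maximal.\<close>

lemma jump_near_max:
  assumes \<epsilon>: "0 < \<epsilon>" "\<epsilon> \<le> 1" "\<epsilon> \<le> 4 * M / q x" and M: "0 < M"
    and q: "q \<in> borel_measurable borel" "\<And>y. \<bar>q y\<bar> \<le> K" "0 < q x" "0 \<le> e" "\<And>y. q y \<le> q x + e"
    and U: "\<And>y. (U has_real_derivative q y) (at y)" "\<And>y. \<bar>U y\<bar> \<le> M"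
  shows "jump (levy \<alpha> \<epsilon>) q x \<le> e * measure (levy \<alpha> \<epsilon>) UNIV
    - frac_const \<alpha> * 2 * M / (8 * M) powr (1 + \<alpha>) * q x powr (1 + \<alpha>)"
proof -
  interpret symmetric_measure "levy \<alpha> \<epsilon>" by (rule symmetric_measure_levy[OF \<alpha> \<epsilon>(1,2)])
  note [measurable] = q(1)
  \<comment> \<open>Only the increments in \<open>[\<rho>, 2 \<rho>]\<close> are used: there \<open>q\<close> integrates to at most \<open>2 M\<close>, while
    \<open>\<rho> * q x = 4 M\<close>.\<close>
  define \<rho> where "\<rho> = 4 * M / q x"
  have \<rho>: "0 < \<rho>" using M q(3) by (simp add: \<rho>_def)
  define k where "k z = q x + e - q (x + z)" for z
  have k0: "0 \<le> k z" for z using q(5)[of "x + z"] by (simp add: k_def)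
  have ik: "integrable (levy \<alpha> \<epsilon>) k"
    unfolding k_def by (intro Bochner_Integration.integrable_diff integrable_const integrable_bounded_shift(1)[OF q(1,2)])
  have "((\<lambda>z. (q x + e) * z - U (x + z)) has_real_derivative k z) (at z)" for z
  proof -
    have "((\<lambda>z. U (x + z)) has_real_derivative q (x + z)) (at z)"
      using U(1)[of "x + z"] DERIV_at_within_shift[of U "q (x + z)" x z UNIV] by simp
    then show ?thesis unfolding k_def by (auto intro!: derivative_eq_intros)
  qed
  then have I: "(k has_integral ((q x + e) * (2 * \<rho>) - U (x + 2 * \<rho>) - ((q x + e) * \<rho> - U (x + \<rho>)))) {\<rho>..2 * \<rho>}"
    using \<rho> by (intro fundamental_theorem_of_calculus)
      (auto simp: has_real_derivative_iff_has_vector_derivative intro: has_vector_derivative_at_within)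
  have "q x * \<rho> = 4 * M" using q(3) by (simp add: \<rho>_def)
  moreover have "0 \<le> e * \<rho>" using q(4) \<rho> by simp
  ultimately have "2 * M \<le> (q x + e) * (2 * \<rho>) - U (x + 2 * \<rho>) - ((q x + e) * \<rho> - U (x + \<rho>))"
    using U(2)[of "x + 2 * \<rho>"] U(2)[of "x + \<rho>"] by (simp add: abs_le_iff algebra_simps)
  then have "frac_const \<alpha> / (2 * \<rho>) powr (1 + \<alpha>) * (2 * M) \<le> frac_const \<alpha> / (2 * \<rho>) powr (1 + \<alpha>)
     * ((q x + e) * (2 * \<rho>) - U (x + 2 * \<rho>) - ((q x + e) * \<rho> - U (x + \<rho>)))"
    using frac_const_pos[OF \<alpha>] by (intro mult_left_mono) auto
  also have "\<dots> \<le> (\<integral>z. k z \<partial>levy \<alpha> \<epsilon>)"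
  proof (rule levy_lower[OF \<alpha> \<epsilon>(1) _ k0 ik _ I])
    show "\<epsilon> \<le> \<rho>" using \<epsilon>(3) by (simp add: \<rho>_def)
    show "k \<in> borel_measurable borel" unfolding k_def by measurable
  qed
  also have "\<dots> = e * measure (levy \<alpha> \<epsilon>) UNIV - jump (levy \<alpha> \<epsilon>) q x"
  proof -
    have "(\<integral>z. k z \<partial>levy \<alpha> \<epsilon>) = (\<integral>z. q x + e \<partial>levy \<alpha> \<epsilon>) - (\<integral>z. q (x + z) \<partial>levy \<alpha> \<epsilon>)"
      unfolding k_def by (intro Bochner_Integration.integral_diff integrable_const integrable_bounded_shift(1)[OF q(1,2)])
    then show ?thesis by (simp add: jump_eq[OF q(1,2)] algebra_simps)
  qed
  finally have "jump (levy \<alpha> \<epsilon>) q x \<le> e * measure (levy \<alpha> \<epsilon>) UNIV - frac_const \<alpha> / (2 * \<rho>) powr (1 + \<alpha>) * (2 * M)"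
    by simp
  also have "frac_const \<alpha> / (2 * \<rho>) powr (1 + \<alpha>) * (2 * M)
      = frac_const \<alpha> * 2 * M / (8 * M) powr (1 + \<alpha>) * q x powr (1 + \<alpha>)"
    using q(3) M by (simp add: \<rho>_def powr_divide)
  finally show ?thesis .
qed

text \<open>The power p = 1/\<alpha> is dictated by scaling: with s the time elapsed since a and f =
  s^p |u_x|, the damping term s^(1+p) |u_x|^(1+\<alpha>) becomes f^(1+\<alpha>). Starting at a > 0
  provides the regularity; neither a nor K occurs explicitly in the conclusion, so that a -> 0
  remains possible.\<close>

lemma gradient_sup_inequality:
  assumes flow: "regular_flow \<alpha> {a<..<T} u K" and a: "0 < a" "a < T"
    and M: "0 < M" "\<And>t x. t \<in> {a<..<T} \<Longrightarrow> \<bar>u t x\<bar> \<le> M"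
    and p: "p = 1 / \<alpha>"
    and S: "0 < S" "\<And>t x. t \<in> {a<..<T} \<Longrightarrow> (t - a) powr p * \<bar>dx u t x\<bar> \<le> S"
    and sup: "\<And>\<eta>. 0 < \<eta> \<Longrightarrow> \<exists>t\<in>{a<..<T}. \<exists>x. S - \<eta> < (t - a) powr p * \<bar>dx u t x\<bar>"
    and e0: "0 < e0"
  shows "frac_const \<alpha> * 2 * M / (8 * M) powr (1 + \<alpha>) * S powr (1 + \<alpha>)
    \<le> p * S + T powr (1 - p) * S\<^sup>2 + T powr (1 + p) * e0"
proof -
  let ?I = "{a<..<T}"
  define c' where "c' = frac_const \<alpha> * 2 * M / (8 * M) powr (1 + \<alpha>)"
  have c'0: "0 \<le> c'" using frac_const_pos[OF \<alpha>] M(1) by (simp add: c'_def)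
  have p01: "0 < p" "p < 1" "p * \<alpha> = 1" using \<alpha> p by auto
  note C = flow_C2[OF \<alpha> flow] and td = flow_time_deriv[OF \<alpha> flow] and eq = flow_deriv_equation[OF \<alpha> flow]
  have K: "\<bar>dx u t x\<bar> \<le> K" if "t \<in> ?I" for t x using C2_boundedD(4)[OF C(1)[OF that]] .
  have K0: "0 < K"
  proof -
    obtain t x where "t \<in> ?I" "S - S / 2 < (t - a) powr p * \<bar>dx u t x\<bar>" using sup[of "S / 2"] S(1) by auto
    then have "0 < (t - a) powr p * \<bar>dx u t x\<bar>" using S(1) by linarith
    then have "0 < \<bar>dx u t x\<bar>" by (metis abs_ge_zero mult_zero_right order_less_le)
    then show ?thesis using K[OF \<open>t \<in> ?I\<close>, of x] by linarith
  qed
  have "0 < 4 * M / K" using M(1) K0 by simp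
  \<comment> \<open>Fixed before \<eta>, so that the total mass of the truncated measure is a
    constant in the limit \<eta> -> 0. As q never exceeds K, this \<epsilon> is admissible in
    \<open>jump_near_max\<close> at every point.\<close>
  then obtain \<epsilon> where \<epsilon>: "0 < \<epsilon>" "\<epsilon> \<le> 1" "\<epsilon> \<le> 4 * M / K" "K * levy_error \<alpha> \<epsilon> < e0"
    using levy_error_small[OF \<alpha> e0, of "4 * M / K" K] by blast
  note \<epsilon>K = \<epsilon>(3)
  \<comment> \<open>Where f exceeds S / 2 one has (t - a)^p K > S / 2, that is t - a > \<tau>0. Near
    maxima thus stay away from t = a, where the derivative of (t - a)^p blows up.\<close>
  define \<tau>0 where "\<tau>0 = (S / (2 * K)) powr \<alpha>"
  have \<tau>0: "0 < \<tau>0" using S(1) K0 by (simp add: \<tau>0_def)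
  define L where "L = p * (\<tau>0 / 2) powr (p - 1) * K + T powr p * K"
  have L0: "0 \<le> L" using p01 K0 by (simp add: L_def)
  \<comment> \<open>The defect of the maximum after a move back in time by at most sqrt \<eta>, with
    f being L-Lipschitz there; \<open>e1\<close> is the resulting defect of the spatial profile
    without the factor s^p. \<open>R\<close> gathers all remainders, of which only the term with e0
    survives \<eta> -> 0.\<close>
  define \<omega> where "\<omega> \<eta> = \<eta> + L * sqrt \<eta>" for \<eta>
  define e1 where "e1 \<eta> = \<omega> \<eta> / (\<tau>0 / 2) powr p" for \<eta>
  define N where "N = measure (levy \<alpha> \<epsilon>) UNIV"
  define R where "R \<eta> = T * sqrt \<eta> + T powr (1 + p) * (e1 \<eta> * N + e0 + M * ((1 + K) * sqrt (e1 \<eta>)))" for \<eta>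
  have N0: "0 \<le> N" by (simp add: N_def)
  have main: "c' * (S - \<omega> \<eta>) powr (1 + \<alpha>) \<le> p * S + T powr (1 - p) * S\<^sup>2 + R \<eta>"
    if \<eta>: "0 < \<eta>" "\<eta> \<le> S / 2" "sqrt \<eta> \<le> \<tau>0 / 2" "\<omega> \<eta> < S" for \<eta>
  proof -
    have \<omega>0: "0 < \<omega> \<eta>" using \<eta>(1) L0 by (simp add: \<omega>_def add_pos_nonneg)
    have e1p: "0 < e1 \<eta>" using \<omega>0 \<tau>0 by (simp add: e1_def)
    obtain t1 x where t1: "t1 \<in> ?I" and near: "S - \<eta> < (t1 - a) powr p * \<bar>dx u t1 x\<bar>" using sup[OF \<eta>(1)] by auto
    \<comment> \<open>Freezing the sign at the near maximum replaces |u_x| by a smooth function that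
      never exceeds it.\<close>
    define \<sigma> where "\<sigma> = (if dx u t1 x \<ge> 0 then 1 else - 1 :: real)"
    have \<sigma>: "\<bar>\<sigma>\<bar> = 1" "\<sigma> * \<sigma> = 1" "\<sigma> * dx u t1 x = \<bar>dx u t1 x\<bar>" by (auto simp: \<sigma>_def)
    have \<sigma>le: "\<sigma> * y \<le> \<bar>y\<bar>" for y by (auto simp: \<sigma>_def)
    define f where "f t = (t - a) powr p * (\<sigma> * dx u t x)" for t
    define f' where "f' t = p * (t - a) powr (p - 1) * (\<sigma> * dx u t x) + (t - a) powr p * (\<sigma> * dt (dx u) t x)" for t
    have fD: "(f has_real_derivative f' t) (at t)" if "t \<in> ?I" for t
    proof -
      have "((\<lambda>t. (t - a) powr p) has_real_derivative p * (t - a) powr (p - 1) * 1) (at t)"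
        by (rule DERIV_chain2[OF has_real_derivative_powr]) (use that in \<open>auto intro!: derivative_eq_intros\<close>)
      from DERIV_mult[OF this DERIV_cmult[OF td(2)[OF that, of x], of \<sigma>]]
      show ?thesis unfolding f_def[abs_def] f'_def by (simp add: algebra_simps)
    qed
    have fS: "f t \<le> S" if "t \<in> ?I" for t
    proof -
      have "f t \<le> (t - a) powr p * \<bar>dx u t x\<bar>" unfolding f_def by (intro mult_left_mono \<sigma>le) auto
      then show ?thesis using S(2)[OF that, of x] by linarith
    qed
    have f1: "S - \<eta> < f t1" using near by (simp add: f_def \<sigma>(3))
    have early: "\<tau>0 < t1 - a"
    proof -
      have "S / 2 < (t1 - a) powr p * K"
      proof -
        have "(t1 - a) powr p * \<bar>dx u t1 x\<bar> \<le> (t1 - a) powr p * K" using K[OF t1] by (intro mult_left_mono) auto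
        then show ?thesis using near \<eta>(2) by linarith
      qed
      then have "S / (2 * K) < (t1 - a) powr p" using K0 by (simp add: field_simps)
      then have "(S / (2 * K)) powr \<alpha> < ((t1 - a) powr p) powr \<alpha>"
        using S(1) K0 \<alpha> by (intro powr_less_mono2) auto
      also have "\<dots> = t1 - a" using t1 p01 by (simp add: powr_powr)
      finally show ?thesis by (simp add: \<tau>0_def)
    qed
    \<comment> \<open>The supremum need not be attained: going back in time by \<open>h\<close> from an almost maximal point,
      the mean value theorem yields an almost maximal point with \<open>f' t \<ge> - h\<close>.\<close>
    define h where "h = sqrt \<eta>"
    have h: "0 < h" "h \<le> \<tau>0 / 2" "h * h = \<eta>" using \<eta> by (auto simp: h_def)
    have sub: "s \<in> ?I \<and> \<tau>0 / 2 < s - a" if "t1 - h \<le> s" "s \<le> t1" for s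
      using that t1 early h \<tau>0 by auto
    obtain t where t: "t1 - h < t" "t < t1" and mvt: "f t1 - f (t1 - h) = (t1 - (t1 - h)) * f' t"
      using MVT2[of "t1 - h" t1 f f'] fD sub h(1) by auto
    have tI: "t \<in> ?I" and \<tau>: "\<tau>0 / 2 < t - a" using sub[of t] t by auto
    have f'low: "- h \<le> f' t"
    proof -
      have "- \<eta> \<le> h * f' t" using mvt f1 fS[of "t1 - h"] sub[of "t1 - h"] h by auto
      then have "h * (- h) \<le> h * f' t" using h(3) by simp
      then show ?thesis using h(1) by (simp only: mult_le_cancel_left_pos)
    qed
    have f'bd: "\<bar>f' s\<bar> \<le> L" if "s \<in> {t1 - h..t1}" for s
    proof -
      have s: "s \<in> ?I" "\<tau>0 / 2 < s - a" using sub[of s] that by auto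
      have "(s - a) powr (p - 1) \<le> (\<tau>0 / 2) powr (p - 1)" using s \<tau>0 p01 by (intro powr_mono2') auto
      then have "p * (s - a) powr (p - 1) * \<bar>dx u s x\<bar> \<le> p * (\<tau>0 / 2) powr (p - 1) * K"
        using K[OF s(1)] p01 by (intro mult_mono) auto
      moreover have "(s - a) powr p \<le> T powr p" using s a p01 by (intro powr_mono2) auto
      then have "(s - a) powr p * \<bar>dt (dx u) s x\<bar> \<le> T powr p * K"
        using td(6)[OF s(1)] by (intro mult_mono) auto
      ultimately have "p * (s - a) powr (p - 1) * \<bar>dx u s x\<bar> + (s - a) powr p * \<bar>dt (dx u) s x\<bar> \<le> L"
        unfolding L_def by (rule add_mono)
      moreover have "\<bar>f' s\<bar> \<le> p * (s - a) powr (p - 1) * \<bar>dx u s x\<bar> + (s - a) powr p * \<bar>dt (dx u) s x\<bar>"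
        unfolding f'_def using p01 \<sigma>(1) by (intro order_trans[OF abs_triangle_ineq]) (simp add: abs_mult)
      ultimately show ?thesis by linarith
    qed
    have ft: "S - \<omega> \<eta> < f t"
    proof -
      have "\<bar>f t1 - f t\<bar> \<le> L * \<bar>t1 - t\<bar>"
        by (rule deriv_bound_lipschitz[of "{t1 - h..t1}" f f']) (use fD sub f'bd t h in auto)
      also have "\<dots> \<le> L * h" using t L0 by (intro mult_left_mono) auto
      finally show ?thesis using f1 by (simp add: \<omega>_def h_def)
    qed
    define s where "s = t - a"
    have s: "0 < s" "s \<le> T" "\<tau>0 / 2 < s" using \<tau> \<tau>0 tI a by (auto simp: s_def)
    define q where "q y = \<sigma> * dx u t y" for y
    have fq: "f t = s powr p * q x" by (simp add: f_def q_def s_def)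
    have q0: "0 < q x"
    proof (rule zero_less_mult_pos)
      show "0 < s powr p * q x" using ft \<eta>(4) unfolding fq by linarith
    qed (use s(1) in simp)
    have qmax: "q y \<le> q x + e1 \<eta>" for y
    proof -
      have "s powr p * q y \<le> S"
        using S(2)[OF tI, of y] mult_left_mono[OF \<sigma>le, of "s powr p" "dx u t y"] by (simp add: q_def s_def)
      then have "s powr p * q y \<le> s powr p * q x + \<omega> \<eta>" using ft fq by simp
      then have "q y \<le> q x + \<omega> \<eta> / s powr p" using s(1) by (simp add: field_simps)
      also have "\<omega> \<eta> / s powr p \<le> e1 \<eta>"
        unfolding e1_def using s \<tau>0 \<omega>0 p01 by (intro divide_left_mono powr_mono2 mult_pos_pos) auto
      finally show ?thesis by simp
    qed
    have sc: "\<bar>\<sigma> * y\<bar> = \<bar>y\<bar>" for y using \<sigma>(1) by (simp add: abs_mult)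
    have qC: "C2_bounded q (\<lambda>y. \<sigma> * dx (dx u) t y) (\<lambda>y. \<sigma> * dx (dx (dx u)) t y) K"
      using C(2)[OF tI] unfolding C2_bounded_def q_def[abs_def] sc by (auto intro!: DERIV_cmult)
    \<comment> \<open>At an exact maximum the transport term u q_x would vanish; here it is of size
      sqrt(e1).\<close>
    have qd: "\<bar>\<sigma> * dx (dx u) t x\<bar> \<le> (1 + K) * sqrt (e1 \<eta>)"
      by (rule abs_deriv_near_max[OF qC e1p qmax])
    have qK: "\<bar>q y\<bar> \<le> K" for y using K[OF tI] by (simp add: q_def sc)
    have "jump (levy \<alpha> \<epsilon>) q x \<le> e1 \<eta> * N - c' * q x powr (1 + \<alpha>)"
      unfolding c'_def N_def
    proof (rule jump_near_max[where K=K and U="\<lambda>y. \<sigma> * u t y"])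
      have "4 * M / K \<le> 4 * M / q x" using qK[of x] q0 M(1) by (intro divide_left_mono) auto
      then show "\<epsilon> \<le> 4 * M / q x" using \<epsilon>K by linarith
      show "q \<in> borel_measurable borel" by (rule C2_bounded_measurable(1)[OF qC])
      show "0 \<le> e1 \<eta>" using e1p by simp
      show "((\<lambda>y. \<sigma> * u t y) has_real_derivative q y) (at y)" for y
        unfolding q_def by (intro DERIV_cmult C2_boundedD(1)[OF C(1)[OF tI]])
      show "\<bar>\<sigma> * u t y\<bar> \<le> M" for y using M(2)[OF tI] by (simp add: sc)
    qed (use \<epsilon> M(1) qK q0 qmax in auto)
    moreover have "jump (levy \<alpha> \<epsilon>) q x = \<sigma> * jump (levy \<alpha> \<epsilon>) (dx u t) x"
      by (simp add: jump_def q_def flip: right_diff_distrib)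
    moreover have "\<bar>\<sigma> * (frac_lap \<alpha> (dx u t) x + jump (levy \<alpha> \<epsilon>) (dx u t) x)\<bar> \<le> K * levy_error \<alpha> \<epsilon>"
      unfolding sc by (rule levy_approx_jump[OF \<alpha> flow \<epsilon>(1,2) C(2)[OF tI]])
    ultimately have lap: "- (\<sigma> * frac_lap \<alpha> (dx u t) x) \<le> e1 \<eta> * N - c' * q x powr (1 + \<alpha>) + e0"
      using \<epsilon>(4) unfolding distrib_left by linarith
    have "dt (dx u) t x = - frac_lap \<alpha> (dx u t) x - dx u t x * dx u t x - u t x * dx (dx u) t x"
      using eq[OF tI, of x] by linarith
    then have "\<sigma> * dt (dx u) t x = \<sigma> * (- frac_lap \<alpha> (dx u t) x - dx u t x * dx u t x - u t x * dx (dx u) t x)"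
      by (rule arg_cong)
    then have "\<sigma> * dt (dx u) t x = - (\<sigma> * frac_lap \<alpha> (dx u t) x) - \<sigma> * (dx u t x * dx u t x) - u t x * (\<sigma> * dx (dx u) t x)"
      by (simp only: right_diff_distrib mult_minus_right mult.left_commute)
    \<comment> \<open>The quadratic term helps only where u_x > 0; the estimate takes the worst case
      q^2 for either sign.\<close>
    moreover have "- (\<sigma> * (dx u t x * dx u t x)) \<le> (q x)\<^sup>2"
    proof -
      have "(q x)\<^sup>2 = \<bar>dx u t x * dx u t x\<bar>" using \<sigma>(2) by (simp add: q_def power2_eq_square algebra_simps)
      then show ?thesis using sc[of "dx u t x * dx u t x"] by (simp add: abs_le_iff)
    qed
    moreover have "- (u t x * (\<sigma> * dx (dx u) t x)) \<le> M * ((1 + K) * sqrt (e1 \<eta>))"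
    proof -
      have "\<bar>u t x * (\<sigma> * dx (dx u) t x)\<bar> \<le> M * ((1 + K) * sqrt (e1 \<eta>))"
        unfolding abs_mult[of "u t x"] using M qd tI by (intro mult_mono) auto
      then show ?thesis by linarith
    qed
    ultimately have gt: "\<sigma> * dt (dx u) t x \<le> (e1 \<eta> * N + e0 + M * ((1 + K) * sqrt (e1 \<eta>))) + (q x)\<^sup>2 - c' * q x powr (1 + \<alpha>)"
      using lap by linarith
    define r where "r = e1 \<eta> * N + e0 + M * ((1 + K) * sqrt (e1 \<eta>))"
    have r0: "0 \<le> r" unfolding r_def using e1p N0 e0 M(1) K0 by (intro add_nonneg_nonneg mult_nonneg_nonneg) auto
    have "- h \<le> p * s powr (p - 1) * q x + s powr p * (\<sigma> * dt (dx u) t x)"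
      using f'low by (simp add: f'_def q_def s_def)
    also have "\<dots> \<le> p * s powr (p - 1) * q x + s powr p * (r + (q x)\<^sup>2 - c' * q x powr (1 + \<alpha>))"
      using gt by (intro add_left_mono mult_left_mono) (auto simp: r_def)
    \<comment> \<open>Multiplication by s makes every main term a power of f = s^p q with a
      nonnegative power of s in front: s^(1+p) q^(1+\<alpha>) = f^(1+\<alpha>) by p \<alpha> = 1,
      and s^(1+p) q^2 = s^(1-p) f^2.\<close>
    finally have "s * (- h) \<le> s * (p * s powr (p - 1) * q x + s powr p * (r + (q x)\<^sup>2 - c' * q x powr (1 + \<alpha>)))"
      using s(1) by (intro mult_left_mono) auto
    also have "\<dots> = p * (s * s powr (p - 1)) * q x + s * s powr p * r + s * s powr p * (q x)\<^sup>2
        - c' * (s * s powr p * q x powr (1 + \<alpha>))"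
      by (simp add: algebra_simps)
    also have "s * s powr (p - 1) = s powr p" using s(1) by (simp add: powr_mult_base)
    also have "s * s powr p * q x powr (1 + \<alpha>) = (f t) powr (1 + \<alpha>)"
    proof -
      have "(s powr p) powr (1 + \<alpha>) = s powr (1 + p)" using p01(3) by (simp add: powr_powr distrib_left add.commute)
      also have "\<dots> = s * s powr p" using s(1) by (simp add: powr_add)
      finally show ?thesis using q0 s(1) unfolding fq by (simp add: powr_mult)
    qed
    also have "s * s powr p * (q x)\<^sup>2 = s powr (1 - p) * (f t)\<^sup>2"
    proof -
      have "s powr (1 - p) * (s powr p * s powr p) = s powr (1 - p + (p + p))" using s(1) by (simp only: powr_add)
      also have "\<dots> = s powr (1 + p)" by (simp add: add.commute)
      also have "\<dots> = s * s powr p" using s(1) by (simp add: powr_add)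
      finally have E: "s powr (1 - p) * (s powr p * s powr p) = s * s powr p" .
      have "s powr (1 - p) * (f t)\<^sup>2 = s powr (1 - p) * (s powr p * s powr p) * (q x)\<^sup>2"
        unfolding fq by (simp only: power2_eq_square mult_ac)
      then show ?thesis by (simp only: E)
    qed
    also have "s * s powr p = s powr (1 + p)" using s(1) by (simp add: powr_add)
    finally have fin: "c' * f t powr (1 + \<alpha>) \<le> p * f t + s powr (1 - p) * (f t)\<^sup>2 + s powr (1 + p) * r + s * h"
      by (simp add: fq algebra_simps)
    have f0: "0 < f t" using ft \<eta>(4) by linarith
    have "c' * (S - \<omega> \<eta>) powr (1 + \<alpha>) \<le> c' * f t powr (1 + \<alpha>)"
      using ft \<eta>(4) \<alpha> c'0 by (intro mult_left_mono powr_mono2) auto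
    also note fin
    also have "p * f t + s powr (1 - p) * (f t)\<^sup>2 + s powr (1 + p) * r + s * h
      \<le> p * S + T powr (1 - p) * S\<^sup>2 + T powr (1 + p) * r + T * h"
      using fS[OF tI] f0 s p01 r0 h by (intro add_mono mult_mono powr_mono2 power_mono) auto
    finally show ?thesis by (simp add: R_def r_def h_def)
  qed
  have l\<omega>: "(\<omega> \<longlongrightarrow> 0) (at_right 0)"
  proof -
    have "(\<omega> \<longlongrightarrow> 0 + L * sqrt 0) (at_right 0)" unfolding \<omega>_def[abs_def] by (intro tendsto_intros)
    then show ?thesis by simp
  qed
  have le1: "(e1 \<longlongrightarrow> 0) (at_right 0)"
    using tendsto_divide[OF l\<omega> tendsto_const[of "(\<tau>0 / 2) powr p"]] \<tau>0 by (simp add: e1_def[abs_def])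
  have lR: "(R \<longlongrightarrow> T powr (1 + p) * e0) (at_right 0)"
  proof -
    have "(R \<longlongrightarrow> T * sqrt 0 + T powr (1 + p) * (0 * N + e0 + M * ((1 + K) * sqrt 0))) (at_right 0)"
      unfolding R_def[abs_def] by (intro tendsto_intros le1)
    then show ?thesis by simp
  qed
  have lL: "((\<lambda>\<eta>. c' * (S - \<omega> \<eta>) powr (1 + \<alpha>)) \<longlongrightarrow> c' * S powr (1 + \<alpha>)) (at_right 0)"
  proof -
    have "((\<lambda>\<eta>. c' * (S - \<omega> \<eta>) powr (1 + \<alpha>)) \<longlongrightarrow> c' * (S - 0) powr (1 + \<alpha>)) (at_right 0)"
      using S(1) by (intro tendsto_intros l\<omega>) auto
    then show ?thesis by simp
  qed
  have ls: "((\<lambda>\<eta>. sqrt \<eta>) \<longlongrightarrow> 0) (at_right 0)"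
    using tendsto_real_sqrt[OF tendsto_ident_at[of 0 "{0<..}"]] by simp
  have "\<forall>\<^sub>F \<eta> in at_right 0. \<eta> \<in> {0<..<S / 2}" using S(1) by (intro eventually_at_right_real) auto
  moreover have "\<forall>\<^sub>F \<eta> in at_right 0. sqrt \<eta> < \<tau>0 / 2" using ls \<tau>0 by (intro order_tendstoD(2)) auto
  moreover have "\<forall>\<^sub>F \<eta> in at_right 0. \<omega> \<eta> < S" using l\<omega> S(1) by (intro order_tendstoD(2)) auto
  ultimately have "\<forall>\<^sub>F \<eta> in at_right 0. c' * (S - \<omega> \<eta>) powr (1 + \<alpha>) \<le> p * S + T powr (1 - p) * S\<^sup>2 + R \<eta>"
    by eventually_elim (use main in auto)
  from tendsto_le[OF _ tendsto_add[OF tendsto_const lR] lL this]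
  show ?thesis by (simp add: c'_def)
qed

text \<open>For S > 1 the linear term is at most p S^2, and division by S^2 leaves c S^(\<alpha>-1)
  \<le> p + T^(1-p), which bounds S because \<alpha> > 1; \<open>Q\<close> and \<open>A\<close> come
  from solving this. Neither depends on a, so a -> 0 gives the bound up to the initial time.\<close>

lemma gradient_bound:
  assumes sol: "is_solution \<alpha> u0 u" and T: "0 < T"
  obtains A where "0 \<le> A" "\<And>t x. 0 < t \<Longrightarrow> t < T \<Longrightarrow> \<bar>dx u t x\<bar> \<le> A * t powr (- (1 / \<alpha>))"
proof -
  define p where "p = 1 / \<alpha>"
  have p01: "0 < p" "p < 1" using \<alpha> by (auto simp: p_def)
  obtain M where M: "1 \<le> M" "\<And>t x. 0 < t \<Longrightarrow> t < T \<Longrightarrow> \<bar>u t x\<bar> \<le> M"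
    using is_solution_bounded[OF sol T] by blast
  define c where "c = frac_const \<alpha> * 2 * M / (8 * M) powr (1 + \<alpha>)"
  have c: "0 < c" using frac_const_pos[OF \<alpha>] M(1) by (simp add: c_def)
  define Q where "Q = (p + T powr (1 - p)) / c"
  define A where "A = max 1 (Q powr (1 / (\<alpha> - 1)))"
  have claim: "(t - a) powr p * \<bar>dx u t x\<bar> \<le> A" if a: "0 < a" "a < t" "t < T" for a t x
  proof -
    have aT: "a < T" using a by simp
    obtain K where flow: "regular_flow \<alpha> {a<..<T} u K" using is_solution_regular_flow[OF sol a(1) aT] by blast
    define Z where "Z = (\<lambda>(t, x). (t - a) powr p * \<bar>dx u t x\<bar>) ` ({a<..<T} \<times> UNIV)"
    have bdd: "bdd_above Z"
    proof (rule bdd_aboveI)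
      fix z assume "z \<in> Z"
      then obtain s y where s: "s \<in> {a<..<T}" and z: "z = (s - a) powr p * \<bar>dx u s y\<bar>" by (auto simp: Z_def)
      have "(s - a) powr p \<le> T powr p" using s a p01 by (intro powr_mono2) auto
      then show "z \<le> T powr p * K"
        unfolding z using C2_boundedD(4)[OF flow_C2(1)[OF \<alpha> flow s]] by (intro mult_mono) auto
    qed
    have memZ: "(s - a) powr p * \<bar>dx u s y\<bar> \<in> Z" if "s \<in> {a<..<T}" for s y
      using that unfolding Z_def by (intro image_eqI[of _ _ "(s, y)"]) auto
    define S where "S = Sup Z"
    have upper: "(s - a) powr p * \<bar>dx u s y\<bar> \<le> S" if "s \<in> {a<..<T}" for s y
      unfolding S_def by (rule cSup_upper[OF memZ[OF that] bdd])
    have "S \<le> A"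
    proof (cases "S \<le> 1")
      case True then show ?thesis by (simp add: A_def)
    next
      case False
      have sup: "\<exists>s\<in>{a<..<T}. \<exists>y. S - \<eta> < (s - a) powr p * \<bar>dx u s y\<bar>" if \<eta>: "0 < \<eta>" for \<eta>
      proof -
        have "Z \<noteq> {}" using memZ[of t x] a by auto
        then obtain z where "z \<in> Z" "S - \<eta> < z" using less_cSup_iff[OF _ bdd, of "S - \<eta>"] \<eta> by (auto simp: S_def)
        then show ?thesis by (auto simp: Z_def)
      qed
      have ineq: "c * S powr (1 + \<alpha>) \<le> p * S + T powr (1 - p) * S\<^sup>2 + T powr (1 + p) * e" if "0 < e" for e
        unfolding c_def
      proof (rule gradient_sup_inequality[OF flow a(1) aT])
        show "\<bar>u t x\<bar> \<le> M" if "t \<in> {a<..<T}" for t x using M(2)[of t x] that a(1) by auto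
      qed (use False M(1) that upper sup p_def in auto)
      have "c * S powr (1 + \<alpha>) \<le> p * S + T powr (1 - p) * S\<^sup>2"
      proof (rule field_le_epsilon)
        fix e :: real assume "0 < e"
        then show "c * S powr (1 + \<alpha>) \<le> p * S + T powr (1 - p) * S\<^sup>2 + e"
          using ineq[of "e / T powr (1 + p)"] T by simp
      qed
      also have "p * S \<le> p * S\<^sup>2" using False p01 by (intro mult_left_mono) (auto simp: power2_eq_square)
      finally have "c * S powr (1 + \<alpha>) \<le> (p + T powr (1 - p)) * S\<^sup>2" by (simp add: algebra_simps)
      also have "S powr (1 + \<alpha>) = S powr (\<alpha> - 1) * S\<^sup>2"
      proof -
        have "S powr (\<alpha> - 1) * S powr 2 = S powr (\<alpha> - 1 + 2)" by (simp only: powr_add)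
        then show ?thesis using False by (simp add: add.commute)
      qed
      finally have "c * S powr (\<alpha> - 1) * S\<^sup>2 \<le> (p + T powr (1 - p)) * S\<^sup>2" by (simp add: mult.assoc)
      then have "c * S powr (\<alpha> - 1) \<le> p + T powr (1 - p)" using False by (simp add: mult_le_cancel_right)
      then have "S powr (\<alpha> - 1) \<le> Q" using c by (simp add: Q_def field_simps)
      then have "(S powr (\<alpha> - 1)) powr (1 / (\<alpha> - 1)) \<le> Q powr (1 / (\<alpha> - 1))"
        using \<alpha> by (intro powr_mono2) auto
      then have "S \<le> Q powr (1 / (\<alpha> - 1))" using \<alpha> False by (simp add: powr_powr)
      then show ?thesis by (simp add: A_def)
    qed
    then show ?thesis using upper[of t x] a by fastforce
  qed
  have "\<bar>dx u t x\<bar> \<le> A * t powr (- (1 / \<alpha>))" if t: "0 < t" "t < T" for t x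
  proof -
    have "((\<lambda>a. (t - a) powr p * \<bar>dx u t x\<bar>) \<longlongrightarrow> (t - 0) powr p * \<bar>dx u t x\<bar>) (at_right 0)"
      using t by (intro tendsto_intros) auto
    moreover have "\<forall>\<^sub>F a in at_right 0. a \<in> {0<..<t}" using t by (intro eventually_at_right_real)
    then have "\<forall>\<^sub>F a in at_right 0. (t - a) powr p * \<bar>dx u t x\<bar> \<le> A"
      by eventually_elim (use claim t in auto)
    ultimately have "(t - 0) powr p * \<bar>dx u t x\<bar> \<le> A" by (intro tendsto_upperbound) auto
    then show ?thesis using t by (simp add: p_def powr_minus field_simps)
  qed
  then show ?thesis by (intro that[of A]) (auto simp: A_def)
qed

end

section \<open>Local averages\<close>

definition average :: "real measure \<Rightarrow> (real \<Rightarrow> real) \<Rightarrow> real \<Rightarrow> real" where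
  "average Q f x = (\<integral>y. f (x + y) \<partial>Q)"

locale averaging_measure = finite_measure Q for Q :: "real measure" +
  assumes sets_Q [measurable_cong]: "sets Q = sets borel" and total_mass: "measure Q UNIV = 1"
begin

lemma space_Q [simp]: "space Q = UNIV"
  using sets_eq_imp_space_eq[OF sets_Q] by simp

lemma average_integrable:
  fixes f :: "real \<Rightarrow> real"
  assumes [measurable]: "f \<in> borel_measurable borel" and "\<And>x. \<bar>f x\<bar> \<le> B"
  shows "integrable Q (\<lambda>y. f (x + y))"
proof -
  have "(\<lambda>y. f (x + y)) \<in> borel_measurable Q" by measurable
  then show ?thesis using assms(2) by (intro integrable_const_bound[of _ B]) auto
qed

lemma average_measurable [measurable]:
  assumes [measurable]: "f \<in> borel_measurable borel"
  shows "average Q f \<in> borel_measurable borel"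
  unfolding average_def by measurable

lemma average_bound:
  assumes [measurable]: "f \<in> borel_measurable borel" and B: "\<And>x. \<bar>f x\<bar> \<le> B"
  shows "\<bar>average Q f x\<bar> \<le> B"
  unfolding average_def
  using Bochner_Integration.integral_norm_bound_integral[OF average_integrable[OF assms] integrable_const, of x B] B
  by (simp add: total_mass)

lemma average_deriv:
  assumes D: "\<And>x. (f has_real_derivative f1 x) (at x)" and m [measurable]: "f1 \<in> borel_measurable borel"
    and B: "\<And>x. \<bar>f x\<bar> \<le> B" "\<And>x. \<bar>f1 x\<bar> \<le> B"
  shows "(average Q f has_real_derivative average Q f1 x) (at x)"
  unfolding average_def[abs_def]
proof (rule has_derivative_lebesgue_integral[of UNIV _ _ "\<lambda>_. B"])
  have [measurable]: "f \<in> borel_measurable borel" by (rule DERIV_borel_measurable[OF D])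
  show "integrable Q (\<lambda>y. f (s + y))" for s by (rule average_integrable[OF _ B(1)]) measurable
  show "((\<lambda>s. f (s + y)) has_real_derivative f1 (s + y)) (at s)" for s y
    using D[of "s + y"] by (simp add: DERIV_shift)
  show "(\<lambda>y. f1 (x + y)) \<in> borel_measurable Q" by measurable
qed (use B in auto)

lemma average_C2_bounded:
  assumes "C2_bounded f f1 f2 B" "f2 \<in> borel_measurable borel"
  shows "C2_bounded (average Q f) (average Q f1) (average Q f2) B"
  unfolding C2_bounded_def
  using average_deriv[of f f1 B] average_deriv[of f1 f2 B] C2_boundedD[OF assms(1)]
    average_bound[of f B] average_bound[of f1 B] average_bound[of f2 B] C2_bounded_measurable(1,2)[OF assms(1)] assms(2)
  by blast

lemma average_time_deriv:
  assumes I: "open I" "convex I" "\<tau> \<in> I"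
    and D: "\<And>s x. s \<in> I \<Longrightarrow> ((\<lambda>r. W r x) has_real_derivative Wt s x) (at s)"
    and m: "\<And>s. s \<in> I \<Longrightarrow> W s \<in> borel_measurable borel" "\<And>s. s \<in> I \<Longrightarrow> Wt s \<in> borel_measurable borel"
    and B: "\<And>s x. s \<in> I \<Longrightarrow> \<bar>W s x\<bar> \<le> B" "\<And>s x. s \<in> I \<Longrightarrow> \<bar>Wt s x\<bar> \<le> B"
  shows "((\<lambda>r. average Q (W r) x) has_real_derivative average Q (Wt \<tau>) x) (at \<tau>)"
  unfolding average_def
proof (rule has_derivative_lebesgue_integral[OF I integrable_const[of B]])
  show "integrable Q (\<lambda>y. W s (x + y))" if "s \<in> I" for s by (rule average_integrable[OF m(1)[OF that] B(1)[OF that]])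
  show "(\<lambda>y. Wt \<tau> (x + y)) \<in> borel_measurable Q"
    using m(2)[OF I(3)] by measurable
qed (use D B in auto)

lemma average_diff:
  assumes f: "f \<in> borel_measurable borel" "\<And>x. \<bar>f x\<bar> \<le> B"
    and g: "g \<in> borel_measurable borel" "\<And>x. \<bar>g x\<bar> \<le> B'"
  shows "average Q (\<lambda>x. f x - g x) x = average Q f x - average Q g x"
  unfolding average_def
  by (rule Bochner_Integration.integral_diff[OF average_integrable[OF f] average_integrable[OF g]])

text \<open>Up to a multiple of the identity both operators are convolutions with finite measures,
  so they commute by Fubini.\<close>

lemma jump_average:
  assumes N: "symmetric_measure N" and f [measurable]: "f \<in> borel_measurable borel" and B: "\<And>x. \<bar>f x\<bar> \<le> B"
  shows "jump N (average Q f) x = average Q (jump N f) x"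
proof -
  interpret N: symmetric_measure N by fact
  interpret P: pair_sigma_finite N Q ..
  interpret PF: finite_measure "N \<Otimes>\<^sub>M Q"
    by (rule finite_measure_pair_measure) unfold_locales
  have [measurable_cong]: "sets N = sets borel" by (rule N.sets_N)
  have i: "integrable (N \<Otimes>\<^sub>M Q) (\<lambda>(z, y). f (x + y + z))"
    by (rule PF.integrable_const_bound[of _ B]) (use B in auto)
  have "jump N (average Q f) x = (\<integral>z. \<integral>y. f (x + y + z) \<partial>Q \<partial>N) - measure N UNIV * average Q f x"
    unfolding N.jump_eq[OF average_measurable[OF f] average_bound[OF f B]]
    by (simp add: average_def add_ac)
  also have "(\<integral>z. \<integral>y. f (x + y + z) \<partial>Q \<partial>N) = (\<integral>y. \<integral>z. f (x + y + z) \<partial>N \<partial>Q)"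
    using P.Fubini_integral[OF i] by simp
  also have "\<dots> - measure N UNIV * average Q f x = average Q (jump N f) x"
  proof -
    have "integrable Q (\<lambda>y. \<integral>z. f (x + y + z) \<partial>N)" using P.integrable_snd[OF i] by simp
    from Bochner_Integration.integral_diff[OF this integrable_mult_right[OF average_integrable[OF f B], of "measure N UNIV" x]]
    show ?thesis by (simp add: average_def N.jump_eq[OF f B])
  qed
  finally show ?thesis .
qed

end

text \<open>The uniform distribution on [0, \<delta>]. Its translates have integrable densities and
  are thus admissible test functions for the weak-* initial condition.\<close>

definition box_kernel :: "real \<Rightarrow> real measure" where
  "box_kernel \<delta> = density lborel (\<lambda>y. ennreal (indicator {0..\<delta>} y / \<delta>))"

lemma sets_box [simp, measurable_cong]: "sets (box_kernel \<delta>) = sets borel" by (simp add: box_kernel_def)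

lemma averaging_measure_box:
  assumes "0 < \<delta>" shows "averaging_measure (box_kernel \<delta>)"
proof -
  have i: "integrable lborel (\<lambda>y. indicator {0..\<delta>} y / \<delta>)"
    using assms by (intro integrable_divide integrable_real_indicator) auto
  have sp: "space (box_kernel \<delta>) = UNIV" by (simp add: box_kernel_def)
  have "emeasure (box_kernel \<delta>) UNIV = (\<integral>\<^sup>+y. ennreal (indicator {0..\<delta>} y / \<delta>) \<partial>lborel)"
    by (simp add: box_kernel_def emeasure_density)
  also have "\<dots> = ennreal (LBINT y. indicator {0..\<delta>} y / \<delta>)"
    using assms by (intro nn_integral_eq_integral[OF i] AE_I2) simp
  also have "(LBINT y. indicator {0..\<delta>} y / \<delta>) = 1"
    using assms by simp
  finally have e: "emeasure (box_kernel \<delta>) UNIV = 1" by simp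
  show ?thesis
  proof (intro averaging_measure.intro finite_measureI averaging_measure_axioms.intro)
    show "emeasure (box_kernel \<delta>) (space (box_kernel \<delta>)) \<noteq> \<infinity>" unfolding sp e by simp
    show "measure (box_kernel \<delta>) UNIV = 1" unfolding measure_def e by simp
  qed simp
qed

lemma average_box:
  assumes [measurable]: "f \<in> borel_measurable borel" and "0 < \<delta>"
  shows "average (box_kernel \<delta>) f x = (LBINT y. f y * (indicator {x..x + \<delta>} y / \<delta>))"
proof -
  have "average (box_kernel \<delta>) f x = (LBINT y. indicator {0..\<delta>} y / \<delta> * f (x + y))"
    unfolding average_def box_kernel_def using assms(2) by (subst integral_density) auto
  also have "\<dots> = (LBINT y. f (x + y) * (indicator {x..x + \<delta>} (x + y) / \<delta>))"
    by (intro Bochner_Integration.integral_cong) (auto split: split_indicator)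
  also have "\<dots> = (LBINT y. f y * (indicator {x..x + \<delta>} y / \<delta>))"
    using lborel_integral_real_affine[of 1 "\<lambda>y. f y * (indicator {x..x + \<delta>} y / \<delta>)" x, symmetric] by simp
  finally show ?thesis .
qed

lemma average_box_close:
  assumes \<delta>: "0 < \<delta>" and D: "\<And>x. (f has_real_derivative f1 x) (at x)" "\<And>x. \<bar>f1 x\<bar> \<le> B" "\<And>x. \<bar>f x\<bar> \<le> B"
  shows "\<bar>average (box_kernel \<delta>) f x - f x\<bar> \<le> B * \<delta>"
proof -
  interpret averaging_measure "box_kernel \<delta>" by (rule averaging_measure_box[OF \<delta>])
  have [measurable]: "f \<in> borel_measurable borel" by (rule DERIV_borel_measurable[OF D(1)])
  have B0: "0 \<le> B" using D(2)[of 0] by linarith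
  have ai: "integrable (box_kernel \<delta>) (\<lambda>y. f (x + y))"
    by (rule average_integrable[OF DERIV_borel_measurable[OF D(1)] D(3)])
  note i = Bochner_Integration.integrable_diff[OF ai integrable_const[of "f x"]]
  have "average (box_kernel \<delta>) f x - f x = (\<integral>y. f (x + y) - f x \<partial>box_kernel \<delta>)"
    using Bochner_Integration.integral_diff[OF ai integrable_const[of "f x"]]
    by (simp add: average_def total_mass)
  moreover have "norm (\<integral>y. f (x + y) - f x \<partial>box_kernel \<delta>) \<le> (\<integral>y. norm (f (x + y) - f x) \<partial>box_kernel \<delta>)"
    by (rule integral_norm_bound)
  moreover have "(\<integral>y. norm (f (x + y) - f x) \<partial>box_kernel \<delta>) \<le> (\<integral>y. B * \<delta> \<partial>box_kernel \<delta>)"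
  proof (rule integral_mono_AE[OF integrable_norm[OF i] integrable_const])
    have "\<bar>f (x + y) - f x\<bar> \<le> B * \<delta>" if "y \<in> {0..\<delta>}" for y
    proof -
      have "\<bar>f (x + y) - f x\<bar> \<le> B * \<bar>x + y - x\<bar>"
        by (rule deriv_bound_lipschitz[of UNIV f f1]) (use D in auto)
      also have "\<dots> \<le> B * \<delta>" using that B0 by (intro mult_left_mono) auto
      finally show ?thesis .
    qed
    then have "y \<in> {0..\<delta>} \<longrightarrow> norm (f (x + y) - f x) \<le> B * \<delta>" for y by simp
    then show "AE y in box_kernel \<delta>. norm (f (x + y) - f x) \<le> B * \<delta>"
      unfolding box_kernel_def by (subst AE_density) (auto simp: indicator_def)
  qed
  moreover have "(\<integral>y. B * \<delta> \<partial>box_kernel \<delta>) = B * \<delta>" by (simp add: total_mass)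
  ultimately show ?thesis unfolding real_norm_def by linarith
qed

section \<open>Weighted estimates for the difference of two solutions\<close>

context
  fixes \<alpha> :: real
  assumes \<alpha>: "1 < \<alpha>" "\<alpha> < 2"
begin

lemma jump_diff:
  assumes N: "symmetric_measure N"
    and f: "f \<in> borel_measurable borel" "\<And>x. \<bar>f x\<bar> \<le> B"
    and g: "g \<in> borel_measurable borel" "\<And>x. \<bar>g x\<bar> \<le> B'"
  shows "jump N (\<lambda>x. f x - g x) x = jump N f x - jump N g x"
proof -
  interpret symmetric_measure N by fact
  have "(\<integral>z. f (x + z) - f x - (g (x + z) - g x) \<partial>N) = jump N f x - jump N g x"
    unfolding jump_def
    by (rule Bochner_Integration.integral_diff)
       (intro Bochner_Integration.integrable_diff integrable_const integrable_bounded_shift(1)[OF f]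
          integrable_bounded_shift(1)[OF g])+
  then show ?thesis by (simp add: jump_def algebra_simps)
qed

text \<open>The nonlinear terms stay in the form u u_x - v v_x because they will be read in two
  ways: as ((u + v)/2 w)_x at positive times, and as a source bounded by the gradient estimate near
  t = 0.\<close>

lemma flow_difference_residual:
  assumes u: "regular_flow \<alpha> I u K" and v: "regular_flow \<alpha> I v K'" and t: "t \<in> I"
    and \<epsilon>: "0 < \<epsilon>" "\<epsilon> \<le> 1"
  shows "\<bar>(dt u t x - dt v t x) - jump (levy \<alpha> \<epsilon>) (\<lambda>x. u t x - v t x) x
     + (u t x * dx u t x - v t x * dx v t x)\<bar> \<le> (K + K') * levy_error \<alpha> \<epsilon>"
proof -
  note Cu = flow_C2(1)[OF \<alpha> u t] and Cv = flow_C2(1)[OF \<alpha> v t]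
  have "jump (levy \<alpha> \<epsilon>) (\<lambda>x. u t x - v t x) x = jump (levy \<alpha> \<epsilon>) (u t) x - jump (levy \<alpha> \<epsilon>) (v t) x"
    by (rule jump_diff[OF symmetric_measure_levy[OF \<alpha> \<epsilon>] C2_bounded_measurable(1)[OF Cu] C2_boundedD(3)[OF Cu]
        C2_bounded_measurable(1)[OF Cv] C2_boundedD(3)[OF Cv]])
  moreover have "\<bar>frac_lap \<alpha> (u t) x + jump (levy \<alpha> \<epsilon>) (u t) x\<bar> \<le> K * levy_error \<alpha> \<epsilon>"
    by (rule levy_approx_jump[OF \<alpha> u \<epsilon> Cu])
  moreover have "\<bar>frac_lap \<alpha> (v t) x + jump (levy \<alpha> \<epsilon>) (v t) x\<bar> \<le> K' * levy_error \<alpha> \<epsilon>"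
    by (rule levy_approx_jump[OF \<alpha> v \<epsilon> Cv])
  ultimately show ?thesis
    using flow_equation[OF \<alpha> u t, of x] flow_equation[OF \<alpha> v t, of x] unfolding distrib_right by linarith
qed

text \<open>Only the sup bound M of the velocity (u + v)/2 enters the exponent, not the regularity
  constants of the interval from a/2 to T, so the growth factor stays bounded as a -> 0.\<close>

lemma interior_weighted_bound:
  assumes u: "is_solution \<alpha> u0 u" and v: "is_solution \<alpha> v0 v"
    and at: "0 < a" "a \<le> t" "t < T" and w: "levy_weight \<alpha> \<psi> \<psi>' k"
    and M: "\<And>t x. 0 < t \<Longrightarrow> t < T \<Longrightarrow> \<bar>u t x\<bar> \<le> M" "\<And>t x. 0 < t \<Longrightarrow> t < T \<Longrightarrow> \<bar>v t x\<bar> \<le> M"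
  shows "(LBINT x. \<bar>u t x - v t x\<bar> * \<psi> x)
     \<le> exp (k * (1 + M) * (t - a)) * (LBINT x. \<bar>u a x - v a x\<bar> * \<psi> x)"
proof -
  let ?I = "{a / 2<..<T}"
  have aT: "0 < a / 2" "a / 2 < T" using at by auto
  obtain K where fu: "regular_flow \<alpha> ?I u K" using is_solution_regular_flow[OF u aT] by blast
  obtain K' where fv: "regular_flow \<alpha> ?I v K'" using is_solution_regular_flow[OF v aT] by blast
  note Cu = flow_C2(1)[OF \<alpha> fu] and Cv = flow_C2(1)[OF \<alpha> fv]
  note C = C2_bounded_diff[OF Cu Cv]
  have "(LBINT x. \<bar>u t x - v t x\<bar> * \<psi> x)
     \<le> exp (k * (1 + M) * (t - a)) * ((LBINT x. \<bar>u a x - v a x\<bar> * \<psi> x) + (LBINT x. \<psi> x) * (0 - 0))"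
  proof (rule weighted_L1_bound_levy[OF \<alpha> w, where I="?I" and W="\<lambda>t x. u t x - v t x" and F="\<lambda>_. 0" and \<Phi>="\<lambda>_. 0"
        and Wt="\<lambda>t x. dt u t x - dt v t x" and Wx="\<lambda>t x. dx u t x - dx v t x"
        and K="K + K'" and K'="K + K'" and b="\<lambda>t x. (u t x + v t x) / 2" and bx="\<lambda>t x. (dx u t x + dx v t x) / 2"
        and Bx="K + K'"])
    fix \<tau> x assume \<tau>: "\<tau> \<in> ?I"
    note D = C2_boundedD[OF Cu[OF \<tau>]] C2_boundedD[OF Cv[OF \<tau>]]
    show "((\<lambda>r. u r x - v r x) has_real_derivative dt u \<tau> x - dt v \<tau> x) (at \<tau>)"
      by (intro DERIV_diff flow_time_deriv(1)[OF \<alpha> fu \<tau>] flow_time_deriv(1)[OF \<alpha> fv \<tau>])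
    show "((\<lambda>x. u \<tau> x - v \<tau> x) has_real_derivative dx u \<tau> x - dx v \<tau> x) (at x)"
      by (intro DERIV_diff D)
    show "isCont (\<lambda>x. dx u \<tau> x - dx v \<tau> x) x"
      by (intro continuous_intros DERIV_isCont[OF D(2)] DERIV_isCont[OF D(8)])
    show "\<bar>u \<tau> x - v \<tau> x\<bar> \<le> K + K'" "\<bar>dx u \<tau> x - dx v \<tau> x\<bar> \<le> K + K'"
      by (rule C2_boundedD[OF C[OF \<tau> \<tau>]])+
    show "\<bar>dt u \<tau> x - dt v \<tau> x\<bar> \<le> K + K'"
      using flow_time_deriv(5)[OF \<alpha> fu \<tau>, of x] flow_time_deriv(5)[OF \<alpha> fv \<tau>, of x] by linarith
    show "((\<lambda>x. (u \<tau> x + v \<tau> x) / 2) has_real_derivative (dx u \<tau> x + dx v \<tau> x) / 2) (at x)"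
      by (intro DERIV_cdivide DERIV_add D)
    show "isCont (\<lambda>x. (dx u \<tau> x + dx v \<tau> x) / 2) x"
      by (intro continuous_intros DERIV_isCont[OF D(2)] DERIV_isCont[OF D(8)]) auto
    show "\<bar>(u \<tau> x + v \<tau> x) / 2\<bar> \<le> M"
      using M(1)[of \<tau> x] M(2)[of \<tau> x] \<tau> aT by (simp add: abs_le_iff)
    show "\<bar>(dx u \<tau> x + dx v \<tau> x) / 2\<bar> \<le> K + K'"
      using D(4)[of x] D(10)[of x] by (simp add: abs_le_iff)
    show "((\<lambda>_. 0) has_real_derivative 0) (at \<tau>)" by simp
  next
    fix \<tau> assume \<tau>: "\<tau> \<in> ?I"
    show "(\<lambda>x. dt u \<tau> x - dt v \<tau> x) \<in> borel_measurable borel"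
      by (intro borel_measurable_diff DERIV_borel_measurable[OF flow_time_deriv(3)[OF \<alpha> fu \<tau>]]
          DERIV_borel_measurable[OF flow_time_deriv(3)[OF \<alpha> fv \<tau>]])
  next
    fix \<epsilon> \<tau> x :: real assume \<epsilon>: "0 < \<epsilon>" "\<epsilon> \<le> 1" and \<tau>: "\<tau> \<in> ?I"
    \<comment> \<open>The product of (u + v)/2 and u - v is (u^2 - v^2)/2, whose derivative is u u_x
      - v v_x.\<close>
    have "(dx u \<tau> x + dx v \<tau> x) / 2 * (u \<tau> x - v \<tau> x) + (u \<tau> x + v \<tau> x) / 2 * (dx u \<tau> x - dx v \<tau> x)
      = u \<tau> x * dx u \<tau> x - v \<tau> x * dx v \<tau> x" by (simp add: field_simps)
    then show "\<bar>(dt u \<tau> x - dt v \<tau> x) - jump (levy \<alpha> \<epsilon>) (\<lambda>x. u \<tau> x - v \<tau> x) x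
       + ((dx u \<tau> x + dx v \<tau> x) / 2 * (u \<tau> x - v \<tau> x) + (u \<tau> x + v \<tau> x) / 2 * (dx u \<tau> x - dx v \<tau> x))\<bar>
       \<le> 0 + (K + K') * levy_error \<alpha> \<epsilon>"
      using flow_difference_residual[OF fu fv \<tau> \<epsilon>, of x] by simp
  next
    show "a \<in> ?I" "t \<in> ?I" "a \<le> t" using at by simp_all
  qed simp_all
  then show ?thesis by simp
qed

text \<open>The velocity is set to zero and the whole nonlinearity becomes the source 2 M A
  \<tau>^(-p), whose primitive tends to 0 at the initial time because p < 1. The averaging acts on a
  linear equation with a source, so it only has to commute with the jump operator and to preserve
  sup bounds.\<close>

lemma averaged_weighted_bound:
  assumes u: "is_solution \<alpha> u0 u" and v: "is_solution \<alpha> v0 v"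
    and sa: "0 < s" "s \<le> a" "a < T" and w: "levy_weight \<alpha> \<psi> \<psi>' k"
    and M: "\<And>t x. 0 < t \<Longrightarrow> t < T \<Longrightarrow> \<bar>u t x\<bar> \<le> M" "\<And>t x. 0 < t \<Longrightarrow> t < T \<Longrightarrow> \<bar>v t x\<bar> \<le> M"
    and A: "\<And>t x. 0 < t \<Longrightarrow> t < T \<Longrightarrow> \<bar>dx u t x\<bar> \<le> A * t powr (- p)"
      "\<And>t x. 0 < t \<Longrightarrow> t < T \<Longrightarrow> \<bar>dx v t x\<bar> \<le> A * t powr (- p)"
    and p: "p < 1" and Q: "averaging_measure Q"
  shows "(LBINT x. \<bar>average Q (\<lambda>x. u a x - v a x) x\<bar> * \<psi> x)
     \<le> exp (k * (a - s)) * ((LBINT x. \<bar>average Q (\<lambda>x. u s x - v s x) x\<bar> * \<psi> x)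
       + (LBINT x. \<psi> x) * (2 * M * A * a powr (1 - p) / (1 - p) - 2 * M * A * s powr (1 - p) / (1 - p)))"
proof -
  interpret averaging_measure Q by fact
  let ?I = "{s / 2<..<T}"
  have sT: "0 < s / 2" "s / 2 < T" using sa by auto
  obtain K where fu: "regular_flow \<alpha> ?I u K" using is_solution_regular_flow[OF u sT] by blast
  obtain K' where fv: "regular_flow \<alpha> ?I v K'" using is_solution_regular_flow[OF v sT] by blast
  note Cu = flow_C2[OF \<alpha> fu] and Cv = flow_C2[OF \<alpha> fv]
  let ?W = "\<lambda>t x. u t x - v t x" and ?Wt = "\<lambda>t x. dt u t x - dt v t x" and ?Wx = "\<lambda>t x. dx u t x - dx v t x"
  note C = C2_bounded_diff[OF Cu(1) Cv(1)]
  have m2: "(\<lambda>x. dx (dx u) t x - dx (dx v) t x) \<in> borel_measurable borel" if "t \<in> ?I" for t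
    by (intro borel_measurable_diff C2_bounded_measurable(2)[OF Cu(2)[OF that]] C2_bounded_measurable(2)[OF Cv(2)[OF that]])
  note CA = average_C2_bounded[OF C m2]
  have Wm: "?W t \<in> borel_measurable borel" if "t \<in> ?I" for t by (rule C2_bounded_measurable(1)[OF C[OF that that]])
  have Wtm: "?Wt t \<in> borel_measurable borel" if "t \<in> ?I" for t
    by (intro borel_measurable_diff DERIV_borel_measurable[OF flow_time_deriv(3)[OF \<alpha> fu that]]
          DERIV_borel_measurable[OF flow_time_deriv(3)[OF \<alpha> fv that]])
  have Wb: "\<bar>?W t x\<bar> \<le> K + K'" if "t \<in> ?I" for t x by (rule C2_boundedD(3)[OF C[OF that that]])
  have Wtb: "\<bar>?Wt t x\<bar> \<le> K + K'" if "t \<in> ?I" for t x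
    using flow_time_deriv(5)[OF \<alpha> fu that, of x] flow_time_deriv(5)[OF \<alpha> fv that, of x] by linarith
  have "(LBINT x. \<bar>average Q (?W a) x\<bar> * \<psi> x)
     \<le> exp (k * (1 + 0) * (a - s)) * ((LBINT x. \<bar>average Q (?W s) x\<bar> * \<psi> x)
       + (LBINT x. \<psi> x) * (2 * M * A * a powr (1 - p) / (1 - p) - 2 * M * A * s powr (1 - p) / (1 - p)))"
  proof (rule weighted_L1_bound_levy[OF \<alpha> w, where I="?I" and W="\<lambda>t. average Q (?W t)"
        and F="\<lambda>t. 2 * M * A * t powr (- p)" and \<Phi>="\<lambda>t. 2 * M * A * t powr (1 - p) / (1 - p)"
        and Wt="\<lambda>t. average Q (?Wt t)" and Wx="\<lambda>t. average Q (?Wx t)"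
        and K="K + K'" and K'="K + K'" and b="\<lambda>_ _. 0" and bx="\<lambda>_ _. 0" and Bx=0])
    fix \<tau> x assume \<tau>: "\<tau> \<in> ?I"
    note D = C2_boundedD[OF CA[OF \<tau> \<tau> \<tau>]]
    show "((\<lambda>r. average Q (?W r) x) has_real_derivative average Q (?Wt \<tau>) x) (at \<tau>)"
    proof (rule average_time_deriv[of ?I])
      show "((\<lambda>r. u r x - v r x) has_real_derivative dt u s x - dt v s x) (at s)" if "s \<in> ?I" for s x
        by (intro DERIV_diff flow_time_deriv(1)[OF \<alpha> fu that] flow_time_deriv(1)[OF \<alpha> fv that])
    qed (use \<tau> Wm Wtm Wb Wtb in auto)
    show "(average Q (?W \<tau>) has_real_derivative average Q (?Wx \<tau>) x) (at x)"
      "isCont (average Q (?Wx \<tau>)) x" "\<bar>average Q (?W \<tau>) x\<bar> \<le> K + K'" "\<bar>average Q (?Wx \<tau>) x\<bar> \<le> K + K'"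
      by (rule D DERIV_isCont[OF D(2)])+
    show "\<bar>average Q (?Wt \<tau>) x\<bar> \<le> K + K'"
      by (rule average_bound[OF Wtm[OF \<tau>] Wtb[OF \<tau>]])
    have "((\<lambda>t. t powr (1 - p)) has_real_derivative (1 - p) * \<tau> powr (1 - p - 1)) (at \<tau>)"
      using \<tau> sT by (intro has_real_derivative_powr) auto
    from DERIV_cdivide[OF DERIV_cmult[OF this, of "2 * M * A"], of "1 - p"]
    show "((\<lambda>t. 2 * M * A * t powr (1 - p) / (1 - p)) has_real_derivative 2 * M * A * \<tau> powr (- p)) (at \<tau>)"
      using p by (simp add: mult.assoc)
  next
    fix \<tau> assume \<tau>: "\<tau> \<in> ?I"
    show "average Q (?Wt \<tau>) \<in> borel_measurable borel" by (rule average_measurable[OF Wtm[OF \<tau>]])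
  next
    fix \<epsilon> \<tau> x :: real assume \<epsilon>: "0 < \<epsilon>" "\<epsilon> \<le> 1" and \<tau>: "\<tau> \<in> ?I"
    interpret N: symmetric_measure "levy \<alpha> \<epsilon>" by (rule symmetric_measure_levy[OF \<alpha> \<epsilon>])
    let ?R = "\<lambda>x. ?Wt \<tau> x - jump (levy \<alpha> \<epsilon>) (?W \<tau>) x"
    have \<tau>T: "0 < \<tau>" "\<tau> < T" using \<tau> sT by auto
    have Rb: "\<bar>?R y\<bar> \<le> 2 * M * A * \<tau> powr (- p) + (K + K') * levy_error \<alpha> \<epsilon>" for y
    proof -
      have "\<bar>u \<tau> y * dx u \<tau> y\<bar> \<le> M * (A * \<tau> powr (- p))" "\<bar>v \<tau> y * dx v \<tau> y\<bar> \<le> M * (A * \<tau> powr (- p))"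
        unfolding abs_mult using order_trans[OF abs_ge_zero M(1)[OF \<tau>T]]
        by (intro mult_mono M A \<tau>T; simp)+
      moreover have "2 * M * A * \<tau> powr (- p) = M * (A * \<tau> powr (- p)) + M * (A * \<tau> powr (- p))" by simp
      ultimately show ?thesis using flow_difference_residual[OF fu fv \<tau> \<epsilon>, of y] by linarith
    qed
    have "average Q (?Wt \<tau>) x - jump (levy \<alpha> \<epsilon>) (average Q (?W \<tau>)) x = average Q ?R x"
      unfolding jump_average[OF N.symmetric_measure_axioms Wm[OF \<tau>] Wb[OF \<tau>]]
      by (rule average_diff[symmetric, OF Wtm[OF \<tau>] Wtb[OF \<tau>] N.jump_measurable[OF Wm[OF \<tau>]] N.abs_jump_le[OF Wm[OF \<tau>] Wb[OF \<tau>]]])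
    moreover have "\<bar>average Q ?R x\<bar> \<le> 2 * M * A * \<tau> powr (- p) + (K + K') * levy_error \<alpha> \<epsilon>"
      by (rule average_bound[OF _ Rb]) (intro borel_measurable_diff Wtm[OF \<tau>] N.jump_measurable[OF Wm[OF \<tau>]])
    ultimately show "\<bar>average Q (?Wt \<tau>) x - jump (levy \<alpha> \<epsilon>) (average Q (?W \<tau>)) x
       + (0 * average Q (?W \<tau>) x + 0 * average Q (?Wx \<tau>) x)\<bar>
       \<le> 2 * M * A * \<tau> powr (- p) + (K + K') * levy_error \<alpha> \<epsilon>" by simp
  next
    show "s \<in> ?I" "a \<in> ?I" "s \<le> a" using sa by simp_all
  qed simp_all
  then show ?thesis by simp
qed

end

section \<open>The contraction in the integral norm\<close>

lemma LIMSEQ_const_divide_add: "(\<lambda>n. c / (real n + b)) \<longlonglongrightarrow> (0 :: real)"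
proof -
  have "filterlim (\<lambda>n. b + real n) at_top sequentially"
    by (rule filterlim_tendsto_add_at_top[OF tendsto_const filterlim_real_sequentially])
  then have "filterlim (\<lambda>n. real n + b) at_infinity sequentially"
    by (simp add: add.commute filterlim_at_top_imp_at_infinity)
  then show ?thesis by (rule tendsto_divide_0[OF tendsto_const])
qed

text \<open>Tonelli and translation invariance of Lebesgue measure. The nonnegative integral spares
  a separate proof that the average is integrable.\<close>

lemma (in averaging_measure) average_L1_le:
  assumes f: "integrable lborel f" "\<And>x. \<bar>f x\<bar> \<le> B"
  shows "(\<integral>\<^sup>+x. ennreal \<bar>average Q f x\<bar> \<partial>lborel) \<le> ennreal (LBINT x. \<bar>f x\<bar>)"
proof -
  have m [measurable]: "f \<in> borel_measurable borel" using f(1) by auto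
  interpret P: pair_sigma_finite Q lborel ..
  have "(\<integral>\<^sup>+x. ennreal \<bar>average Q f x\<bar> \<partial>lborel) \<le> (\<integral>\<^sup>+x. \<integral>\<^sup>+y. ennreal \<bar>f (x + y)\<bar> \<partial>Q \<partial>lborel)"
    unfolding average_def
    using integral_norm_bound_ennreal[OF average_integrable[OF m f(2)]] by (intro nn_integral_mono) simp
  also have "\<dots> = (\<integral>\<^sup>+y. \<integral>\<^sup>+x. ennreal \<bar>f (x + y)\<bar> \<partial>lborel \<partial>Q)"
    by (rule P.Fubini') measurable
  also have "\<dots> = (\<integral>\<^sup>+y. \<integral>\<^sup>+x. ennreal \<bar>f x\<bar> \<partial>lborel \<partial>Q)"
  proof (rule nn_integral_cong)
    show "(\<integral>\<^sup>+x. ennreal \<bar>f (x + y)\<bar> \<partial>lborel) = (\<integral>\<^sup>+x. ennreal \<bar>f x\<bar> \<partial>lborel)" for y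
      using nn_integral_real_affine[of "\<lambda>x. ennreal \<bar>f x\<bar>" 1 y] by (simp add: add.commute)
  qed
  also have "\<dots> = (\<integral>\<^sup>+x. ennreal \<bar>f x\<bar> \<partial>lborel)"
  proof -
    have "emeasure Q UNIV = 1" using emeasure_eq_measure[of UNIV] total_mass by simp
    then show ?thesis by simp
  qed
  also have "\<dots> = ennreal (LBINT x. \<bar>f x\<bar>)"
    using f(1) by (intro nn_integral_eq_integral) auto
  finally show ?thesis .
qed

context
  fixes \<alpha> :: real
  assumes \<alpha>: "1 < \<alpha>" "\<alpha> < 2"
begin

lemma scaled_bump_tendsto_1: "(\<lambda>n. scaled_bump \<alpha> (real n + b) x) \<longlonglongrightarrow> 1"
proof -
  have "(\<lambda>n. x / (real n + b)) \<longlonglongrightarrow> 0" by (rule LIMSEQ_const_divide_add)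
  then have "(\<lambda>n. bump \<alpha> (x / (real n + b))) \<longlonglongrightarrow> bump \<alpha> 0"
    by (rule isCont_tendsto_compose[OF DERIV_isCont[OF bump_deriv[OF \<alpha>]]])
  then show ?thesis by (simp add: scaled_bump_def[OF \<alpha>] bump_def[OF \<alpha>])
qed

lemma solution_slice_measurable:
  assumes u: "is_solution \<alpha> u0 u" and t: "0 < t"
  shows "u t \<in> borel_measurable borel"
proof -
  have "0 < t / 2" "t / 2 < t + 1" using t by auto
  then obtain K where f: "regular_flow \<alpha> {t / 2<..<t + 1} u K" using is_solution_regular_flow[OF u] by blast
  show ?thesis using t by (intro C2_bounded_measurable(1)[OF flow_C2(1)[OF \<alpha> f]]) auto
qed

text \<open>The weak-* condition, tested with the normalised indicator of [x, x + \<delta>].\<close>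

lemma average_box_initial_limit:
  assumes u: "is_solution \<alpha> u0 u" and u0: "u0 \<in> borel_measurable borel" and \<delta>: "0 < \<delta>"
    and s: "\<And>n. 0 < s n" "s \<longlonglongrightarrow> 0"
  shows "(\<lambda>n. average (box_kernel \<delta>) (u (s n)) x) \<longlonglongrightarrow> average (box_kernel \<delta>) u0 x"
proof -
  let ?k = "\<lambda>y. indicator {x..x + \<delta>} y / \<delta> :: real"
  have "integrable lborel ?k" using \<delta> by (intro integrable_divide integrable_real_indicator) auto
  then have "((\<lambda>t. LBINT y. u t y * ?k y) \<longlongrightarrow> (LBINT y. u0 y * ?k y)) (at_right 0)"
    using u unfolding is_solution_def by blast
  moreover have "filterlim s (at_right 0) sequentially"
    using s by (intro tendsto_imp_filterlim_at_right) auto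
  ultimately have "(\<lambda>n. LBINT y. u (s n) y * ?k y) \<longlonglongrightarrow> (LBINT y. u0 y * ?k y)"
    by (rule filterlim_compose)
  then show ?thesis
    using average_box[OF solution_slice_measurable[OF u s(1)] \<delta>] average_box[OF u0 \<delta>] by simp
qed

text \<open>Two limits: s -> 0 for a fixed averaging length \<delta>, where the averages converge
  pointwise, and afterwards \<delta> -> 0 at the fixed time a, where the solutions are Lipschitz in
  x. The bound \<psi> \<le> 1 permits the comparison with the unweighted norm of the data.\<close>

lemma initial_weighted_bound:
  assumes u: "is_solution \<alpha> u0 u" and v: "is_solution \<alpha> v0 v"
    and u0: "u0 \<in> borel_measurable borel" "\<And>x. \<bar>u0 x\<bar> \<le> B0"
    and v0: "v0 \<in> borel_measurable borel" "\<And>x. \<bar>v0 x\<bar> \<le> B0"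
    and w0: "integrable lborel (\<lambda>x. u0 x - v0 x)"
    and aT: "0 < a" "a < T" and w: "levy_weight \<alpha> \<psi> \<psi>' k" and \<psi>1: "\<And>x. \<psi> x \<le> 1"
    and M: "\<And>t x. 0 < t \<Longrightarrow> t < T \<Longrightarrow> \<bar>u t x\<bar> \<le> M" "\<And>t x. 0 < t \<Longrightarrow> t < T \<Longrightarrow> \<bar>v t x\<bar> \<le> M"
    and A: "\<And>t x. 0 < t \<Longrightarrow> t < T \<Longrightarrow> \<bar>dx u t x\<bar> \<le> A * t powr (- p)"
      "\<And>t x. 0 < t \<Longrightarrow> t < T \<Longrightarrow> \<bar>dx v t x\<bar> \<le> A * t powr (- p)"
    and p: "p < 1"
  shows "(LBINT x. \<bar>u a x - v a x\<bar> * \<psi> x)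
     \<le> exp (k * a) * ((LBINT x. \<bar>u0 x - v0 x\<bar>)
       + (LBINT x. \<psi> x) * (2 * M * A * a powr (1 - p) / (1 - p)))"
proof -
  interpret weight \<psi> \<psi>' 2 k using w by (simp add: levy_weight_def)
  define P where "P = (LBINT x. \<psi> x)"
  define \<Phi> where "\<Phi> t = 2 * M * A * t powr (1 - p) / (1 - p)" for t
  define Y where "Y = (LBINT x. \<bar>u0 x - v0 x\<bar>)"
  have P0: "0 \<le> P" unfolding P_def using nonneg by (intro integral_nonneg_AE) auto
  have B0: "\<bar>u0 x - v0 x\<bar> \<le> 2 * B0" for x using u0(2)[of x] v0(2)[of x] by linarith
  have M2: "\<bar>u t x - v t x\<bar> \<le> 2 * M" if "0 < t" "t < T" for t x using M(1)[OF that, of x] M(2)[OF that, of x] by linarith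
  have um: "u t \<in> borel_measurable borel" "v t \<in> borel_measurable borel" if "0 < t" for t
    using solution_slice_measurable[OF u that] solution_slice_measurable[OF v that] by auto
  have wm: "(\<lambda>x. u t x - v t x) \<in> borel_measurable borel" if "0 < t" for t
    using um[OF that] by measurable
  define s where "s n = a / (real n + 2)" for n
  have s: "0 < s n" "s n \<le> a" for n
    using aT by (auto simp: s_def field_simps)
  have sT: "s n < T" for n using s(2)[of n] aT by linarith
  have s0: "s \<longlonglongrightarrow> 0" unfolding s_def by (rule LIMSEQ_const_divide_add)
  have avg: "(LBINT x. \<bar>average (box_kernel \<delta>) (\<lambda>x. u a x - v a x) x\<bar> * \<psi> x) \<le> exp (k * a) * (Y + P * \<Phi> a)"
    if \<delta>: "0 < \<delta>" for \<delta>
  proof -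
    interpret Q: averaging_measure "box_kernel \<delta>" by (rule averaging_measure_box[OF \<delta>])
    let ?avg = "average (box_kernel \<delta>)"
    let ?w0 = "\<lambda>x. u0 x - v0 x"
    have step: "(LBINT x. \<bar>?avg (\<lambda>x. u a x - v a x) x\<bar> * \<psi> x)
      \<le> exp (k * (a - s n)) * ((LBINT x. \<bar>?avg (\<lambda>x. u (s n) x - v (s n) x) x\<bar> * \<psi> x) + P * (\<Phi> a - \<Phi> (s n)))" for n
      unfolding P_def \<Phi>_def
      by (rule averaged_weighted_bound[OF \<alpha> u v s(1,2) aT(2) w M A p Q.averaging_measure_axioms])
    have w0m: "?w0 \<in> borel_measurable borel" using u0(1) v0(1) by measurable
    \<comment> \<open>The averages are merely bounded by 2 M; it is the integrable weight that
      supplies a majorant.\<close>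
    have lim: "(\<lambda>n. LBINT x. \<bar>?avg (\<lambda>x. u (s n) x - v (s n) x) x\<bar> * \<psi> x) \<longlonglongrightarrow> (LBINT x. \<bar>?avg ?w0 x\<bar> * \<psi> x)"
    proof (rule integral_dominated_convergence[where w="\<lambda>x. 2 * M * \<psi> x"])
      show "(\<lambda>x. \<bar>?avg ?w0 x\<bar> * \<psi> x) \<in> borel_measurable lborel"
        using Q.average_measurable[OF w0m] by measurable
      show "(\<lambda>x. \<bar>?avg (\<lambda>x. u (s n) x - v (s n) x) x\<bar> * \<psi> x) \<in> borel_measurable lborel" for n
        using Q.average_measurable[OF wm[OF s(1)[of n]]] by measurable
      show "integrable lborel (\<lambda>x. 2 * M * \<psi> x)" using integrable by simp
      show "AE x in lborel. norm (\<bar>?avg (\<lambda>x. u (s n) x - v (s n) x) x\<bar> * \<psi> x) \<le> 2 * M * \<psi> x" for n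
        using Q.average_bound[OF wm[OF s(1)[of n]] M2[OF s(1)[of n] sT[of n]]] nonneg
        by (intro AE_I2) (simp add: abs_mult mult_right_mono)
      show "AE x in lborel. (\<lambda>n. \<bar>?avg (\<lambda>x. u (s n) x - v (s n) x) x\<bar> * \<psi> x) \<longlonglongrightarrow> \<bar>?avg ?w0 x\<bar> * \<psi> x"
      proof (rule AE_I2)
        fix x
        have "(\<lambda>n. ?avg (u (s n)) x - ?avg (v (s n)) x) \<longlonglongrightarrow> ?avg u0 x - ?avg v0 x"
          by (intro tendsto_diff average_box_initial_limit[OF u u0(1) \<delta> s(1) s0] average_box_initial_limit[OF v v0(1) \<delta> s(1) s0])
        then have "(\<lambda>n. ?avg (\<lambda>x. u (s n) x - v (s n) x) x) \<longlonglongrightarrow> ?avg ?w0 x"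
          using Q.average_diff[OF um(1)[OF s(1)] M(1)[OF s(1) sT] um(2)[OF s(1)] M(2)[OF s(1) sT]] Q.average_diff[OF u0 v0]
          by simp
        then show "(\<lambda>n. \<bar>?avg (\<lambda>x. u (s n) x - v (s n) x) x\<bar> * \<psi> x) \<longlonglongrightarrow> \<bar>?avg ?w0 x\<bar> * \<psi> x"
          by (intro tendsto_intros)
      qed
    qed
    have \<Phi>0: "(\<lambda>n. \<Phi> (s n)) \<longlonglongrightarrow> 0"
    proof -
      have "(\<lambda>n. s n powr (1 - p)) \<longlonglongrightarrow> 0"
        using p by (intro tendsto_zero_powrI[OF s0] tendsto_const always_eventually allI less_imp_le s(1)) auto
      from tendsto_mult_left[OF this, of "2 * M * A / (1 - p)"] show ?thesis by (simp add: \<Phi>_def)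
    qed
    have "(\<lambda>n. exp (k * (a - s n)) * ((LBINT x. \<bar>?avg (\<lambda>x. u (s n) x - v (s n) x) x\<bar> * \<psi> x) + P * (\<Phi> a - \<Phi> (s n))))
       \<longlonglongrightarrow> exp (k * (a - 0)) * ((LBINT x. \<bar>?avg ?w0 x\<bar> * \<psi> x) + P * (\<Phi> a - 0))"
      by (intro tendsto_intros lim \<Phi>0 s0)
    then have c1: "(LBINT x. \<bar>?avg (\<lambda>x. u a x - v a x) x\<bar> * \<psi> x)
       \<le> exp (k * (a - 0)) * ((LBINT x. \<bar>?avg ?w0 x\<bar> * \<psi> x) + P * (\<Phi> a - 0))"
      using step by (intro LIMSEQ_le_const) auto
    have "(LBINT x. \<bar>?avg ?w0 x\<bar> * \<psi> x) \<le> Y"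
    proof -
      have i: "integrable lborel (\<lambda>x. \<bar>?avg ?w0 x\<bar> * \<psi> x)"
        using Q.average_measurable[OF w0m] Q.average_bound[OF w0m B0]
        by (intro integrable_bounded_mult_weight[of _ "2 * B0"]) auto
      have "ennreal (LBINT x. \<bar>?avg ?w0 x\<bar> * \<psi> x) = (\<integral>\<^sup>+x. ennreal (\<bar>?avg ?w0 x\<bar> * \<psi> x) \<partial>lborel)"
        using nonneg by (intro nn_integral_eq_integral[OF i, symmetric]) auto
      also have "\<dots> \<le> (\<integral>\<^sup>+x. ennreal \<bar>?avg ?w0 x\<bar> \<partial>lborel)"
        using \<psi>1 by (intro nn_integral_mono ennreal_leI) (simp add: mult_left_le)
      also have "\<dots> \<le> ennreal Y" unfolding Y_def by (rule Q.average_L1_le[OF w0 B0])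
      finally show ?thesis by (simp add: Y_def)
    qed
    then have "exp (k * a) * ((LBINT x. \<bar>?avg ?w0 x\<bar> * \<psi> x) + P * \<Phi> a) \<le> exp (k * a) * (Y + P * \<Phi> a)"
      by (intro mult_left_mono) auto
    with c1 show ?thesis unfolding diff_zero by (rule order_trans)
  qed
  have "(LBINT x. \<bar>u a x - v a x\<bar> * \<psi> x) \<le> exp (k * a) * (Y + P * \<Phi> a)"
  proof (rule field_le_epsilon)
    fix e :: real assume e: "0 < e"
    have "0 < a / 2" "a / 2 < T" using aT by auto
    obtain K where fu: "regular_flow \<alpha> {a / 2<..<T} u K" using is_solution_regular_flow[OF u \<open>0 < a / 2\<close> \<open>a / 2 < T\<close>] by blast
    obtain K' where fv: "regular_flow \<alpha> {a / 2<..<T} v K'" using is_solution_regular_flow[OF v \<open>0 < a / 2\<close> \<open>a / 2 < T\<close>] by blast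
    have aI: "a \<in> {a / 2<..<T}" using aT by auto
    note C = C2_bounded_diff[OF flow_C2(1)[OF \<alpha> fu aI] flow_C2(1)[OF \<alpha> fv aI]]
    \<comment> \<open>Chosen so that replacing w(a) by its average costs (K + K') \<delta> P \<le>
      e; the summand 1 excludes a zero denominator.\<close>
    define \<delta> where "\<delta> = e / ((K + K') * P + 1)"
    have KP: "0 \<le> (K + K') * P" using C2_boundedD(6)[OF C] P0 by simp
    have \<delta>: "0 < \<delta>" using e KP by (simp add: \<delta>_def)
    let ?a = "average (box_kernel \<delta>) (\<lambda>x. u a x - v a x)"
    interpret Q: averaging_measure "box_kernel \<delta>" by (rule averaging_measure_box[OF \<delta>])
    have i: "integrable lborel (\<lambda>x. \<bar>?a x\<bar> * \<psi> x)"
      using Q.average_measurable[OF wm[OF aT(1)]] Q.average_bound[OF wm[OF aT(1)] M2[OF aT]]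
      by (intro integrable_bounded_mult_weight[of _ "2 * M"]) auto
    have "(LBINT x. \<bar>u a x - v a x\<bar> * \<psi> x) \<le> (LBINT x. \<bar>?a x\<bar> * \<psi> x + (K + K') * \<delta> * \<psi> x)"
    proof (rule integral_mono)
      show "integrable lborel (\<lambda>x. \<bar>u a x - v a x\<bar> * \<psi> x)"
        using wm[OF aT(1)] M2[OF aT] by (intro integrable_bounded_mult_weight[of _ "2 * M"]) auto
      show "integrable lborel (\<lambda>x. \<bar>?a x\<bar> * \<psi> x + (K + K') * \<delta> * \<psi> x)"
        by (intro Bochner_Integration.integrable_add i integrable_mult_right integrable)
      fix x
      have "\<bar>?a x - (u a x - v a x)\<bar> \<le> (K + K') * \<delta>"
        by (rule average_box_close[OF \<delta> C2_boundedD(1)[OF C] C2_boundedD(4)[OF C] C2_boundedD(3)[OF C]])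
      then have "\<bar>u a x - v a x\<bar> \<le> \<bar>?a x\<bar> + (K + K') * \<delta>" by linarith
      from mult_right_mono[OF this nonneg[of x]]
      show "\<bar>u a x - v a x\<bar> * \<psi> x \<le> \<bar>?a x\<bar> * \<psi> x + (K + K') * \<delta> * \<psi> x" by (simp add: distrib_right)
    qed
    also have "\<dots> = (LBINT x. \<bar>?a x\<bar> * \<psi> x) + (K + K') * \<delta> * P"
      using Bochner_Integration.integral_add[OF i integrable_mult_right[OF integrable, of "(K + K') * \<delta>"]]
      by (simp add: P_def)
    also have "(K + K') * \<delta> * P \<le> e"
    proof -
      have "(K + K') * \<delta> * P = e * ((K + K') * P / ((K + K') * P + 1))" by (simp add: \<delta>_def)
      also have "\<dots> \<le> e * 1" using e KP by (intro mult_left_mono) auto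
      finally show ?thesis by simp
    qed
    finally show "(LBINT x. \<bar>u a x - v a x\<bar> * \<psi> x) \<le> exp (k * a) * (Y + P * \<Phi> a) + e"
      using avg[OF \<delta>] by linarith
  qed
  then show ?thesis by (simp add: Y_def P_def \<Phi>_def)
qed

text \<open>The mass P of the weight grows with R but multiplies a^(1-p), so a -> 0 with R fixed
  leaves only a factor exp(C t / R). This factor tends to 1 as R grows, and Fatou removes the
  weight. Bounding the nonnegative integral also yields that u(t) - v(t) is integrable.\<close>

lemma L1_contraction:
  assumes u: "is_solution \<alpha> u0 u" and v: "is_solution \<alpha> v0 v"
    and u0: "u0 \<in> borel_measurable borel" "\<And>x. \<bar>u0 x\<bar> \<le> B0"
    and v0: "v0 \<in> borel_measurable borel" "\<And>x. \<bar>v0 x\<bar> \<le> B0"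
    and w0: "integrable lborel (\<lambda>x. u0 x - v0 x)" and t: "0 < t"
  shows "(\<integral>\<^sup>+x. ennreal \<bar>u t x - v t x\<bar> \<partial>lborel) \<le> ennreal (LBINT x. \<bar>u0 x - v0 x\<bar>)"
proof -
  note [measurable] = solution_slice_measurable[OF u t] solution_slice_measurable[OF v t] scaled_bump_measurable[OF \<alpha>]
  define T where "T = t + 1"
  define p where "p = 1 / \<alpha>"
  have T: "0 < T" "t < T" using t by (auto simp: T_def)
  have p: "p < 1" using \<alpha> by (simp add: p_def)
  obtain Mu where Mu: "1 \<le> Mu" "\<And>t x. 0 < t \<Longrightarrow> t < T \<Longrightarrow> \<bar>u t x\<bar> \<le> Mu"
    using is_solution_bounded[OF u T(1)] by blast
  obtain Mv where Mv: "1 \<le> Mv" "\<And>t x. 0 < t \<Longrightarrow> t < T \<Longrightarrow> \<bar>v t x\<bar> \<le> Mv"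
    using is_solution_bounded[OF v T(1)] by blast
  obtain Au where Au: "0 \<le> Au" "\<And>t x. 0 < t \<Longrightarrow> t < T \<Longrightarrow> \<bar>dx u t x\<bar> \<le> Au * t powr (- p)"
    using gradient_bound[OF \<alpha> u T(1)] unfolding p_def by blast
  obtain Av where Av: "0 \<le> Av" "\<And>t x. 0 < t \<Longrightarrow> t < T \<Longrightarrow> \<bar>dx v t x\<bar> \<le> Av * t powr (- p)"
    using gradient_bound[OF \<alpha> v T(1)] unfolding p_def by blast
  define M where "M = max Mu Mv"
  define A where "A = max Au Av"
  have M: "\<bar>u t x\<bar> \<le> M" "\<bar>v t x\<bar> \<le> M" if "0 < t" "t < T" for t x
    using Mu(2)[OF that, of x] Mv(2)[OF that, of x] by (auto simp: M_def)
  have A: "\<bar>dx u t x\<bar> \<le> A * t powr (- p)" "\<bar>dx v t x\<bar> \<le> A * t powr (- p)" if "0 < t" "t < T" for t x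
    using Au(2)[OF that, of x] Av(2)[OF that, of x]
      mult_right_mono[of Au A "t powr (- p)"] mult_right_mono[of Av A "t powr (- p)"] by (auto simp: A_def)
  define Y where "Y = (LBINT x. \<bar>u0 x - v0 x\<bar>)"
  have weighted: "(LBINT x. \<bar>u t x - v t x\<bar> * scaled_bump \<alpha> R x) \<le> exp (weight_const \<alpha> / R * (1 + M) * t) * Y"
    if R: "1 \<le> R" for R
  proof -
    note w = scaled_bump_weight[OF \<alpha> R]
    define k where "k = weight_const \<alpha> / R"
    define P where "P = (LBINT x. scaled_bump \<alpha> R x)"
    have bound: "(LBINT x. \<bar>u t x - v t x\<bar> * scaled_bump \<alpha> R x)
      \<le> exp (k * (1 + M) * (t - a)) * (exp (k * a) * (Y + P * (2 * M * A * a powr (1 - p) / (1 - p))))"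
      if a: "0 < a" "a < t" for a
    proof -
      have "(LBINT x. \<bar>u t x - v t x\<bar> * scaled_bump \<alpha> R x)
        \<le> exp (k * (1 + M) * (t - a)) * (LBINT x. \<bar>u a x - v a x\<bar> * scaled_bump \<alpha> R x)"
        unfolding k_def by (rule interior_weighted_bound[OF \<alpha> u v a(1) _ T(2) w M]) (use a in auto)
      also have "\<dots> \<le> exp (k * (1 + M) * (t - a)) * (exp (k * a) * (Y + P * (2 * M * A * a powr (1 - p) / (1 - p))))"
        unfolding k_def Y_def P_def
        by (intro mult_left_mono initial_weighted_bound[OF u v u0 v0 w0 a(1) _ w scaled_bump_bounds(2)[OF \<alpha>] M A p])
           (use a T in auto)
      finally show ?thesis .
    qed
    have "((\<lambda>a::real. a powr (1 - p)) \<longlongrightarrow> 0) (at_right 0)"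
    proof (rule tendsto_zero_powrI)
      show "((\<lambda>x::real. x) \<longlongrightarrow> 0) (at_right 0)" by (rule tendsto_ident_at)
      show "\<forall>\<^sub>F x in at_right (0::real). 0 \<le> x" using eventually_at_right_less[of 0] by eventually_elim simp
    qed (use p in auto)
    then have "((\<lambda>a. exp (k * (1 + M) * (t - a)) * (exp (k * a) * (Y + P * (2 * M * A * a powr (1 - p) / (1 - p)))))
      \<longlongrightarrow> exp (k * (1 + M) * (t - 0)) * (exp (k * 0) * (Y + P * (2 * M * A * 0 / (1 - p))))) (at_right 0)"
      using p by (intro tendsto_intros) auto
    moreover have "\<forall>\<^sub>F a in at_right 0. a \<in> {0<..<t}" using t by (rule eventually_at_right_real)
    then have "\<forall>\<^sub>F a in at_right 0. (LBINT x. \<bar>u t x - v t x\<bar> * scaled_bump \<alpha> R x)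
      \<le> exp (k * (1 + M) * (t - a)) * (exp (k * a) * (Y + P * (2 * M * A * a powr (1 - p) / (1 - p))))"
      by eventually_elim (use bound in auto)
    ultimately have "(LBINT x. \<bar>u t x - v t x\<bar> * scaled_bump \<alpha> R x)
      \<le> exp (k * (1 + M) * (t - 0)) * (exp (k * 0) * (Y + P * (2 * M * A * 0 / (1 - p))))"
      by (intro tendsto_lowerbound) auto
    then show ?thesis by (simp add: k_def)
  qed
  have wm: "(\<lambda>x. u t x - v t x) \<in> borel_measurable borel"
    using solution_slice_measurable[OF u t] solution_slice_measurable[OF v t] by measurable
  have ex: "(\<integral>\<^sup>+x. ennreal (\<bar>u t x - v t x\<bar> * scaled_bump \<alpha> (real n + 1) x) \<partial>lborel)
     \<le> ennreal (exp (weight_const \<alpha> / (real n + 1) * (1 + M) * t) * Y)" for n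
  proof -
    have R: "1 \<le> real n + 1" by simp
    have "integrable lborel (\<lambda>x. \<bar>u t x - v t x\<bar> * scaled_bump \<alpha> (real n + 1) x)"
    proof (rule integrable_mult_bounded[OF scaled_bump_integrable[OF \<alpha> R]])
      show "\<bar>\<bar>u t x - v t x\<bar>\<bar> \<le> 2 * M" for x using M[OF t T(2), of x] by linarith
    qed (use wm in measurable)
    then have "(\<integral>\<^sup>+x. ennreal (\<bar>u t x - v t x\<bar> * scaled_bump \<alpha> (real n + 1) x) \<partial>lborel)
      = ennreal (LBINT x. \<bar>u t x - v t x\<bar> * scaled_bump \<alpha> (real n + 1) x)"
      using scaled_bump_bounds(1)[OF \<alpha>] by (intro nn_integral_eq_integral AE_I2 mult_nonneg_nonneg) (auto intro: less_imp_le)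
    then show ?thesis using weighted[OF R] by (simp add: ennreal_leI)
  qed
  have "(\<integral>\<^sup>+x. ennreal \<bar>u t x - v t x\<bar> \<partial>lborel)
     = (\<integral>\<^sup>+x. liminf (\<lambda>n. ennreal (\<bar>u t x - v t x\<bar> * scaled_bump \<alpha> (real n + 1) x)) \<partial>lborel)"
  proof (rule nn_integral_cong)
    fix x
    have "(\<lambda>n. ennreal (\<bar>u t x - v t x\<bar> * scaled_bump \<alpha> (real n + 1) x)) \<longlonglongrightarrow> ennreal (\<bar>u t x - v t x\<bar> * 1)"
      by (intro tendsto_ennrealI tendsto_mult_left scaled_bump_tendsto_1)
    then show "ennreal \<bar>u t x - v t x\<bar> = liminf (\<lambda>n. ennreal (\<bar>u t x - v t x\<bar> * scaled_bump \<alpha> (real n + 1) x))"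
      using lim_imp_Liminf[OF sequentially_bot] by fastforce
  qed
  also have "\<dots> \<le> liminf (\<lambda>n. \<integral>\<^sup>+x. ennreal (\<bar>u t x - v t x\<bar> * scaled_bump \<alpha> (real n + 1) x) \<partial>lborel)"
    by (intro nn_integral_liminf) measurable
  also have "\<dots> \<le> liminf (\<lambda>n. ennreal (exp (weight_const \<alpha> / (real n + 1) * (1 + M) * t) * Y))"
    using ex by (intro Liminf_mono always_eventually allI)
  also have "\<dots> = ennreal Y"
  proof -
    have "(\<lambda>n. weight_const \<alpha> / (real n + 1)) \<longlonglongrightarrow> 0"
      by (rule LIMSEQ_const_divide_add)
    then have "(\<lambda>n. ennreal (exp (weight_const \<alpha> / (real n + 1) * (1 + M) * t) * Y)) \<longlonglongrightarrow> ennreal (exp (0 * (1 + M) * t) * Y)"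
      by (intro tendsto_ennrealI tendsto_intros)
    then show ?thesis using lim_imp_Liminf[OF sequentially_bot] by fastforce
  qed
  finally show ?thesis by (simp add: Y_def)
qed

end

section \<open>Step function data and translations\<close>

lemma deriv_shift_arg:
  fixes f :: "real \<Rightarrow> real"
  shows "deriv (\<lambda>x. f (x + h)) x = deriv f (x + h)"
  unfolding deriv_def by (simp add: DERIV_shift)

lemma frac_lap_shift: "frac_lap \<alpha> (\<lambda>x. f (x + h)) x = frac_lap \<alpha> f (x + h)"
  unfolding frac_lap_def deriv_shift_arg by (simp add: add_ac)

lemma Cb_on_shift:
  assumes "Cb_on I u" shows "Cb_on I (\<lambda>t x. u t (x + h))"
proof -
  have "continuous_on (I \<times> UNIV) ((\<lambda>(t, x). u t x) \<circ> (\<lambda>p. (fst p, snd p + h)))"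
  proof (rule continuous_on_compose)
    show "continuous_on (I \<times> UNIV) (\<lambda>p. (fst p, snd p + h))" by (intro continuous_intros)
    show "continuous_on ((\<lambda>p. (fst p, snd p + h)) ` (I \<times> UNIV)) (\<lambda>(t, x). u t x)"
      using assms unfolding Cb_on_def by (auto elim!: continuous_on_subset)
  qed
  moreover have "(\<lambda>(t, x). u t (x + h)) ` (I \<times> UNIV) \<subseteq> (\<lambda>(t, x). u t x) ` (I \<times> UNIV)"
  proof clarify
    fix t x assume "t \<in> I"
    then show "u t (x + h) \<in> (\<lambda>(t, x). u t x) ` (I \<times> UNIV)" by (intro image_eqI[of _ _ "(t, x + h)"]) auto
  qed
  ultimately show ?thesis
    using assms unfolding Cb_on_def by (auto simp: o_def case_prod_beta elim: bounded_subset)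
qed

lemma Cb_inf_on_shift:
  assumes "Cb_inf_on I u" shows "Cb_inf_on I (\<lambda>t x. u t (x + h))"
proof -
  from assms obtain D where D: "(\<forall>t\<in>I. \<forall>x. D 0 0 t x = u t x)"
      "\<And>i j t x. t \<in> I \<Longrightarrow> ((\<lambda>s. D i j s x) has_real_derivative D (Suc i) j t x) (at t)"
      "\<And>i j t x. t \<in> I \<Longrightarrow> ((\<lambda>y. D i j t y) has_real_derivative D i (Suc j) t x) (at x)"
      "\<And>i j. Cb_on I (D i j)"
    unfolding Cb_inf_on_def by blast
  show ?thesis
    unfolding Cb_inf_on_def
  proof (rule exI[of _ "\<lambda>i j t x. D i j t (x + h)"], intro conjI allI ballI)
    fix i j t x assume t: "t \<in> I"
    show "((\<lambda>y. D i j t (y + h)) has_real_derivative D i (Suc j) t (x + h)) (at x)"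
      using D(3)[OF t, of i j "x + h"] by (simp add: DERIV_shift)
  qed (use D in \<open>auto intro: Cb_on_shift\<close>)
qed

lemma is_solution_shift:
  assumes "is_solution \<alpha> u0 u"
  shows "is_solution \<alpha> (\<lambda>x. u0 (x + h)) (\<lambda>t x. u t (x + h))"
  unfolding is_solution_def
proof (intro conjI allI impI ballI)
  fix T :: real assume T: "0 < T"
  show "Cb_on {0<..<T} (\<lambda>t x. u t (x + h))" using assms T unfolding is_solution_def by (blast intro: Cb_on_shift)
  show "Cb_inf_on {a<..<T} (\<lambda>t x. u t (x + h))" if "a \<in> {0<..<T}" for a
    using assms T that unfolding is_solution_def by (blast intro: Cb_inf_on_shift)
  show "deriv (\<lambda>s. u s (x + h)) t + frac_lap \<alpha> (\<lambda>x. u t (x + h)) x + u t (x + h) * deriv (\<lambda>x. u t (x + h)) x = 0"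
    if "t \<in> {0<..<T}" for t x
    unfolding frac_lap_shift deriv_shift_arg using assms T that unfolding is_solution_def by blast
next
  fix \<phi> :: "real \<Rightarrow> real" assume \<phi>: "integrable lborel \<phi>"
  \<comment> \<open>The translation is moved onto the test function, where the initial condition of
    u applies.\<close>
  have "integrable lborel (\<lambda>x. \<phi> (x - h))"
    using lborel_integrable_real_affine[OF \<phi>, of 1 "- h"] by (simp add: add.commute)
  then have "((\<lambda>t. LBINT x. u t x * \<phi> (x - h)) \<longlongrightarrow> (LBINT x. u0 x * \<phi> (x - h))) (at_right 0)"
    using assms unfolding is_solution_def by blast
  moreover have "(LBINT x. f x * \<phi> (x - h)) = (LBINT x. f (x + h) * \<phi> x)" for f :: "real \<Rightarrow> real"
    using lborel_integral_real_affine[of 1 "\<lambda>x. f x * \<phi> (x - h)" h] by (simp add: add.commute)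
  ultimately show "((\<lambda>t. LBINT x. u t (x + h) * \<phi> x) \<longlongrightarrow> (LBINT x. u0 (x + h) * \<phi> x)) (at_right 0)"
    by simp
qed

text \<open>Tonelli: a point y of the measure is counted in the increment from x to x + h exactly
  for x in [y - h, y), a set of length h.\<close>

lemma cdf_increment:
  assumes M: "finite_measure M" "sets M = sets borel" and h: "0 < h"
  shows "integrable lborel (\<lambda>x. measure M {..x + h} - measure M {..x::real})"
    and "(LBINT x. measure M {..x + h} - measure M {..x}) = h * measure M UNIV"
proof -
  interpret finite_measure M by fact
  interpret P: pair_sigma_finite M lborel ..
  note [measurable_cong] = M(2)
  have sp: "space M = UNIV" using sets_eq_imp_space_eq[OF M(2)] by simp
  have d: "measure M {..x + h} - measure M {..x} = measure M {x<..x + h}" for x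
  proof -
    have "{x<..x + h} = {..x + h} - {..x}" using h by auto
    then show ?thesis using finite_measure_Diff[of "{..x + h}" "{..x}"] h M(2) by simp
  qed
  have mono: "mono (\<lambda>x. measure M {..x})"
    using M(2) by (intro monoI finite_measure_mono) auto
  have [measurable]: "(\<lambda>x. measure M {..x}) \<in> borel_measurable borel" by (rule borel_measurable_mono[OF mono])
  have "(\<integral>\<^sup>+x. ennreal (measure M {..x + h} - measure M {..x}) \<partial>lborel)
     = (\<integral>\<^sup>+x. \<integral>\<^sup>+y. indicator {p. fst p < snd p \<and> snd p \<le> fst p + h} (x, y) \<partial>M \<partial>lborel)"
  proof (rule nn_integral_cong)
    fix x
    have "(\<integral>\<^sup>+y. indicator {p. fst p < snd p \<and> snd p \<le> fst p + h} (x, y) \<partial>M) = (\<integral>\<^sup>+y. indicator {x<..x + h} y \<partial>M)"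
      by (intro nn_integral_cong) (auto split: split_indicator)
    also have "\<dots> = emeasure M {x<..x + h}" using M(2) by simp
    finally show "ennreal (measure M {..x + h} - measure M {..x}) =
      (\<integral>\<^sup>+y. indicator {p. fst p < snd p \<and> snd p \<le> fst p + h} (x, y) \<partial>M)"
      unfolding d by (simp add: emeasure_eq_measure)
  qed
  also have "\<dots> = (\<integral>\<^sup>+y. \<integral>\<^sup>+x. indicator {p. fst p < snd p \<and> snd p \<le> fst p + h} (x, y) \<partial>lborel \<partial>M)"
    by (rule P.Fubini') measurable
  also have "\<dots> = (\<integral>\<^sup>+y. ennreal h \<partial>M)"
  proof (rule nn_integral_cong)
    fix y
    have "(\<integral>\<^sup>+x. indicator {p. fst p < snd p \<and> snd p \<le> fst p + h} (x, y) \<partial>lborel) = (\<integral>\<^sup>+x. indicator {y - h..<y} x \<partial>lborel)"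
      by (intro nn_integral_cong) (auto split: split_indicator)
    also have "\<dots> = ennreal h" using h by simp
    finally show "(\<integral>\<^sup>+x. indicator {p. fst p < snd p \<and> snd p \<le> fst p + h} (x, y) \<partial>lborel) = ennreal h" .
  qed
  also have "\<dots> = ennreal (h * measure M UNIV)"
    using h by (simp add: sp emeasure_eq_measure ennreal_mult)
  finally have nn: "(\<integral>\<^sup>+x. ennreal (measure M {..x + h} - measure M {..x}) \<partial>lborel) = ennreal (h * measure M UNIV)" .
  have pos: "0 \<le> measure M {..x + h} - measure M {..x}" for x unfolding d by simp
  show i: "integrable lborel (\<lambda>x. measure M {..x + h} - measure M {..x})"
  proof (rule integrableI_nonneg)
    show "(\<integral>\<^sup>+x. ennreal (measure M {..x + h} - measure M {..x}) \<partial>lborel) < \<infinity>" unfolding nn by simp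
  qed (use pos in auto)
  show "(LBINT x. measure M {..x + h} - measure M {..x}) = h * measure M UNIV"
    using nn_integral_eq_integral[OF i] pos h unfolding nn by (simp add: integral_nonneg_AE)
qed

text \<open>A linear modulus of continuity under translations in the integral norm is the form in
  which bounded variation will be used. V is the total mass of both measures, whose increments are
  nonnegative and are estimated separately.\<close>

lemma measure_datum_properties:
  assumes "measure_datum u0"
  obtains B V where "u0 \<in> borel_measurable borel" "\<And>x. \<bar>u0 x\<bar> \<le> B" "0 \<le> V"
    "\<And>h. 0 < h \<Longrightarrow> integrable lborel (\<lambda>x. u0 (x + h) - u0 x)"
    "\<And>h. 0 < h \<Longrightarrow> (LBINT x. \<bar>u0 (x + h) - u0 x\<bar>) \<le> V * h"
proof -
  from assms obtain c M1 M2 where M: "finite_measure M1" "finite_measure M2" "sets M1 = sets borel" "sets M2 = sets borel"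
    and u0: "u0 = (\<lambda>x. c + measure M1 {..x} - measure M2 {..x})"
    unfolding measure_datum_def by blast
  interpret A: finite_measure M1 by fact
  interpret B: finite_measure M2 by fact
  have sp: "space M1 = UNIV" "space M2 = UNIV" using sets_eq_imp_space_eq[OF M(3)] sets_eq_imp_space_eq[OF M(4)] by simp_all
  have "mono (\<lambda>x::real. measure M1 {..x})"
    by (rule monoI, rule A.finite_measure_mono) (simp_all add: M(3))
  note [measurable] = borel_measurable_mono[OF this]
  have "mono (\<lambda>x::real. measure M2 {..x})"
    by (rule monoI, rule B.finite_measure_mono) (simp_all add: M(4))
  note [measurable] = borel_measurable_mono[OF this]
  note i1 = cdf_increment[OF M(1,3)] and i2 = cdf_increment[OF M(2,4)]
  have eq: "u0 (x + h) - u0 x = (measure M1 {..x + h} - measure M1 {..x}) - (measure M2 {..x + h} - measure M2 {..x})" for x h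
    by (simp add: u0)
  show ?thesis
  proof (rule that[of "\<bar>c\<bar> + measure M1 UNIV + measure M2 UNIV" "measure M1 UNIV + measure M2 UNIV"])
    show "u0 \<in> borel_measurable borel" unfolding u0 by measurable
    show "\<bar>u0 x\<bar> \<le> \<bar>c\<bar> + measure M1 UNIV + measure M2 UNIV" for x
      using A.bounded_measure[of "{..x}"] B.bounded_measure[of "{..x}"] measure_nonneg[of M1 "{..x}"] measure_nonneg[of M2 "{..x}"]
      unfolding u0 sp by linarith
    fix h :: real assume h: "0 < h"
    show i: "integrable lborel (\<lambda>x. u0 (x + h) - u0 x)"
      unfolding eq by (rule Bochner_Integration.integrable_diff[OF i1(1)[OF h] i2(1)[OF h]])
    have "measure M1 {..x} \<le> measure M1 {..x + h}" for x
      by (rule A.finite_measure_mono) (use h M(3) in simp_all)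
    moreover have "measure M2 {..x} \<le> measure M2 {..x + h}" for x
      by (rule B.finite_measure_mono) (use h M(4) in simp_all)
    ultimately have pos: "0 \<le> measure M1 {..x + h} - measure M1 {..x}" "0 \<le> measure M2 {..x + h} - measure M2 {..x}" for x
      by simp_all
    have "(LBINT x. \<bar>u0 (x + h) - u0 x\<bar>)
      \<le> (LBINT x. (measure M1 {..x + h} - measure M1 {..x}) + (measure M2 {..x + h} - measure M2 {..x}))"
    proof (rule integral_mono[OF integrable_abs[OF i] Bochner_Integration.integrable_add[OF i1(1)[OF h] i2(1)[OF h]]])
      show "\<bar>u0 (x + h) - u0 x\<bar> \<le> (measure M1 {..x + h} - measure M1 {..x}) + (measure M2 {..x + h} - measure M2 {..x})" for x
        unfolding eq using pos[of x] by linarith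
    qed
    also have "\<dots> = (measure M1 UNIV + measure M2 UNIV) * h"
      unfolding Bochner_Integration.integral_add[OF i1(1)[OF h] i2(1)[OF h]] i1(2)[OF h] i2(2)[OF h]
      by (simp add: algebra_simps)
    finally show "(LBINT x. \<bar>u0 (x + h) - u0 x\<bar>) \<le> (measure M1 UNIV + measure M2 UNIV) * h" .
  qed simp
qed

context
  fixes \<alpha> :: real
  assumes \<alpha>: "1 < \<alpha>" "\<alpha> < 2"
begin

text \<open>The difference quotients of u(t) have integral norm at most V for every step h, and
  Fatou passes to the derivative; its integrability comes out at the same time.\<close>

lemma gradient_L1_bound:
  assumes u: "is_solution \<alpha> u0 u" and d: "measure_datum u0"
  obtains V where "0 \<le> V" "\<And>t. 0 < t \<Longrightarrow> integrable lborel (dx u t)"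
    "\<And>t. 0 < t \<Longrightarrow> (LBINT x. \<bar>dx u t x\<bar>) \<le> V"
proof -
  obtain B V where m: "u0 \<in> borel_measurable borel" and B: "\<And>x. \<bar>u0 x\<bar> \<le> B" and V: "0 \<le> V"
    and i: "\<And>h. 0 < h \<Longrightarrow> integrable lborel (\<lambda>x. u0 (x + h) - u0 x)"
    and le: "\<And>h. 0 < h \<Longrightarrow> (LBINT x. \<bar>u0 (x + h) - u0 x\<bar>) \<le> V * h"
    using measure_datum_properties[OF d] by blast
  have *: "integrable lborel (dx u t) \<and> (LBINT x. \<bar>dx u t x\<bar>) \<le> V" if t: "0 < t" for t
  proof -
    have "0 < t / 2" "t / 2 < t + 1" using t by auto
    then obtain K where f: "regular_flow \<alpha> {t / 2<..<t + 1} u K" using is_solution_regular_flow[OF u] by blast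
    have tI: "t \<in> {t / 2<..<t + 1}" using t by auto
    note C = flow_C2(1)[OF \<alpha> f tI]
    have [measurable]: "u t \<in> borel_measurable borel" "dx u t \<in> borel_measurable borel"
      by (rule C2_bounded_measurable[OF C])+
    define h where "h n = 1 / (real n + 1)" for n
    have h: "0 < h n" for n by (simp add: h_def)
    have h0: "h \<longlonglongrightarrow> 0" unfolding h_def by (rule LIMSEQ_const_divide_add)
    have inc: "(\<integral>\<^sup>+x. ennreal \<bar>(u t (x + h n) - u t x) / h n\<bar> \<partial>lborel) \<le> ennreal V" for n
    proof -
      have "(\<integral>\<^sup>+x. ennreal \<bar>u t (x + h n) - u t x\<bar> \<partial>lborel) \<le> ennreal (LBINT x. \<bar>u0 (x + h n) - u0 x\<bar>)"
      proof (rule L1_contraction[OF \<alpha> is_solution_shift[OF u] u _ _ m B i[OF h] t])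
        show "(\<lambda>x. u0 (x + h n)) \<in> borel_measurable borel" using m by measurable
        show "\<bar>u0 (x + h n)\<bar> \<le> B" for x by (rule B)
      qed
      also have "\<dots> \<le> ennreal (V * h n)" using le[OF h] by (rule ennreal_leI)
      finally have 1: "(\<integral>\<^sup>+x. ennreal \<bar>u t (x + h n) - u t x\<bar> \<partial>lborel) \<le> ennreal (V * h n)" .
      have "(\<integral>\<^sup>+x. ennreal \<bar>(u t (x + h n) - u t x) / h n\<bar> \<partial>lborel)
         = (\<integral>\<^sup>+x. ennreal (1 / h n) * ennreal \<bar>u t (x + h n) - u t x\<bar> \<partial>lborel)"
        using h[of n] by (intro nn_integral_cong) (simp add: abs_divide flip: ennreal_mult)
      also have "\<dots> = ennreal (1 / h n) * (\<integral>\<^sup>+x. ennreal \<bar>u t (x + h n) - u t x\<bar> \<partial>lborel)"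
        by (rule nn_integral_cmult) measurable
      also have "\<dots> \<le> ennreal (1 / h n) * ennreal (V * h n)" using 1 by (rule mult_left_mono) simp
      also have "\<dots> = ennreal V" using h[of n] V by (simp flip: ennreal_mult)
      finally show ?thesis .
    qed
    have "(\<integral>\<^sup>+x. ennreal \<bar>dx u t x\<bar> \<partial>lborel) = (\<integral>\<^sup>+x. liminf (\<lambda>n. ennreal \<bar>(u t (x + h n) - u t x) / h n\<bar>) \<partial>lborel)"
    proof (rule nn_integral_cong)
      fix x
      have "((\<lambda>k. (u t (x + k) - u t x) / k) \<longlongrightarrow> dx u t x) (at 0)"
        using C2_boundedD(1)[OF C, of x] by (simp add: DERIV_def)
      moreover have "filterlim h (at 0) sequentially"
        using h0 h by (intro filterlim_atI) (auto simp: less_imp_neq[symmetric])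
      ultimately have "(\<lambda>n. (u t (x + h n) - u t x) / h n) \<longlonglongrightarrow> dx u t x" by (rule filterlim_compose)
      then have "(\<lambda>n. ennreal \<bar>(u t (x + h n) - u t x) / h n\<bar>) \<longlonglongrightarrow> ennreal \<bar>dx u t x\<bar>"
        by (intro tendsto_ennrealI tendsto_rabs)
      then show "ennreal \<bar>dx u t x\<bar> = liminf (\<lambda>n. ennreal \<bar>(u t (x + h n) - u t x) / h n\<bar>)"
        using lim_imp_Liminf[OF sequentially_bot] by fastforce
    qed
    also have "\<dots> \<le> liminf (\<lambda>n. \<integral>\<^sup>+x. ennreal \<bar>(u t (x + h n) - u t x) / h n\<bar> \<partial>lborel)"
      by (intro nn_integral_liminf) measurable
    also have "\<dots> \<le> liminf (\<lambda>n. ennreal V)" using inc by (intro Liminf_mono always_eventually allI)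
    also have "\<dots> = ennreal V" by (simp add: Liminf_const)
    finally have nn: "(\<integral>\<^sup>+x. ennreal \<bar>dx u t x\<bar> \<partial>lborel) \<le> ennreal V" .
    have int: "integrable lborel (dx u t)"
      by (rule integrableI_bounded) (use nn in \<open>auto intro: le_less_trans\<close>)
    then have "ennreal (LBINT x. \<bar>dx u t x\<bar>) \<le> ennreal V"
      using nn nn_integral_eq_integral[OF integrable_abs[OF int]] by simp
    then show ?thesis using int V by simp
  qed
  then show ?thesis using that V by blast
qed

text \<open>The differentiated equation is a conservation law for u_x with velocity u and the same
  dissipation, so the weighted estimate applies without a source. The weight 1 + 1/R -
  \<open>scaled_bump\<close> is not integrable; it is reached from the integrable tail weights as S
  -> \<infinity>, with the majorant 2 |u_x|.\<close>

lemma gradient_tail_bound: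
  assumes u: "is_solution \<alpha> u0 u" and st: "0 < s" "s \<le> t" "t < T" and R: "1 \<le> R"
    and M: "\<And>t x. 0 < t \<Longrightarrow> t < T \<Longrightarrow> \<bar>u t x\<bar> \<le> M"
    and i: "\<And>t. 0 < t \<Longrightarrow> integrable lborel (dx u t)"
  shows "(LBINT x. \<bar>dx u t x\<bar> * (1 + 1 / R - scaled_bump \<alpha> R x))
    \<le> exp (3 * weight_const \<alpha> * (1 + M) * (t - s)) * (LBINT x. \<bar>dx u s x\<bar> * (1 + 1 / R - scaled_bump \<alpha> R x))"
proof -
  let ?I = "{s / 2<..<T}"
  have sT: "0 < s / 2" "s / 2 < T" using st by auto
  obtain K where f: "regular_flow \<alpha> ?I u K" using is_solution_regular_flow[OF u sT] by blast
  note C1 = flow_C2(1)[OF \<alpha> f] and C2 = flow_C2(2)[OF \<alpha> f]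
  define E where "E = exp (3 * weight_const \<alpha> * (1 + M) * (t - s))"
  have step: "(LBINT x. \<bar>dx u t x\<bar> * tail_weight \<alpha> R S x) \<le> E * (LBINT x. \<bar>dx u s x\<bar> * tail_weight \<alpha> R S x)"
    if S: "R \<le> S" for S
  proof -
    have "(LBINT x. \<bar>dx u t x\<bar> * tail_weight \<alpha> R S x)
      \<le> exp (3 * weight_const \<alpha> * (1 + M) * (t - s)) * ((LBINT x. \<bar>dx u s x\<bar> * tail_weight \<alpha> R S x)
        + (LBINT x. tail_weight \<alpha> R S x) * (0 - 0))"
    proof (rule weighted_L1_bound_levy[OF \<alpha> tail_weight[OF \<alpha> R S], where I="?I" and W="dx u" and F="\<lambda>_. 0" and \<Phi>="\<lambda>_. 0"
        and Wt="dt (dx u)" and Wx="dx (dx u)" and K=K and K'=K and b=u and bx="dx u" and Bx=K])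
      fix \<tau> x assume \<tau>: "\<tau> \<in> ?I"
      show "((\<lambda>r. dx u r x) has_real_derivative dt (dx u) \<tau> x) (at \<tau>)" by (rule flow_time_deriv(2)[OF \<alpha> f \<tau>])
      show "(dx u \<tau> has_real_derivative dx (dx u) \<tau> x) (at x)" by (rule C2_boundedD(1)[OF C2[OF \<tau>]])
      show "isCont (dx (dx u) \<tau>) x" by (rule DERIV_isCont[OF C2_boundedD(2)[OF C2[OF \<tau>]]])
      show "\<bar>dx u \<tau> x\<bar> \<le> K" by (rule C2_boundedD(3)[OF C2[OF \<tau>]])
      show "\<bar>dx u \<tau> x\<bar> \<le> K" by (rule C2_boundedD(3)[OF C2[OF \<tau>]])
      show "\<bar>dt (dx u) \<tau> x\<bar> \<le> K" by (rule flow_time_deriv(6)[OF \<alpha> f \<tau>])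
      show "\<bar>dx (dx u) \<tau> x\<bar> \<le> K" by (rule C2_boundedD(4)[OF C2[OF \<tau>]])
      show "(u \<tau> has_real_derivative dx u \<tau> x) (at x)" by (rule C2_boundedD(1)[OF C1[OF \<tau>]])
      show "isCont (dx u \<tau>) x" by (rule DERIV_isCont[OF C2_boundedD(1)[OF C2[OF \<tau>]]])
      show "\<bar>u \<tau> x\<bar> \<le> M" using M[of \<tau> x] \<tau> sT by simp
      show "((\<lambda>_. 0) has_real_derivative 0) (at \<tau>)" by simp
    next
      fix \<tau> assume \<tau>: "\<tau> \<in> ?I"
      show "dt (dx u) \<tau> \<in> borel_measurable borel"
        by (rule isCont_borel_measurable[OF flow_time_deriv(4)[OF \<alpha> f \<tau>]])
    next
      fix \<epsilon> \<tau> x :: real assume \<epsilon>: "0 < \<epsilon>" "\<epsilon> \<le> 1" and \<tau>: "\<tau> \<in> ?I"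
      show "\<bar>dt (dx u) \<tau> x - jump (levy \<alpha> \<epsilon>) (dx u \<tau>) x + (dx u \<tau> x * dx u \<tau> x + u \<tau> x * dx (dx u) \<tau> x)\<bar>
        \<le> 0 + K * levy_error \<alpha> \<epsilon>"
        using levy_approx_jump[OF \<alpha> f \<epsilon> C2[OF \<tau>], of x] flow_deriv_equation[OF \<alpha> f \<tau>, of x] by linarith
    next
      show "s \<in> ?I" "t \<in> ?I" "s \<le> t" using st by simp_all
    qed simp_all
    then show ?thesis by (simp add: E_def)
  qed
  have lim: "(\<lambda>n. LBINT x. \<bar>dx u r x\<bar> * tail_weight \<alpha> R (real n + R) x)
     \<longlonglongrightarrow> (LBINT x. \<bar>dx u r x\<bar> * (1 + 1 / R - scaled_bump \<alpha> R x))" if r: "0 < r" for r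
  proof (rule integral_dominated_convergence[where w="\<lambda>x. 2 * \<bar>dx u r x\<bar>"])
    have [measurable]: "dx u r \<in> borel_measurable borel" "scaled_bump \<alpha> S \<in> borel_measurable borel"
      "tail_weight \<alpha> R (real n + R) \<in> borel_measurable borel" for n S
      using i[OF r] scaled_bump_measurable[OF \<alpha>]
      by (auto simp: tail_weight_def[OF \<alpha>, abs_def])
    show "(\<lambda>x. \<bar>dx u r x\<bar> * (1 + 1 / R - scaled_bump \<alpha> R x)) \<in> borel_measurable lborel" by measurable
    show "(\<lambda>x. \<bar>dx u r x\<bar> * tail_weight \<alpha> R (real n + R) x) \<in> borel_measurable lborel" for n by measurable
    show "integrable lborel (\<lambda>x. 2 * \<bar>dx u r x\<bar>)" using i[OF r] by simp
    show "AE x in lborel. norm (\<bar>dx u r x\<bar> * tail_weight \<alpha> R (real n + R) x) \<le> 2 * \<bar>dx u r x\<bar>" for n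
    proof (rule AE_I2)
      fix x
      interpret weight "tail_weight \<alpha> R (real n + R)" "tail_weight' \<alpha> R (real n + R)" 2 "3 * weight_const \<alpha>"
        using tail_weight[OF \<alpha> R, of "real n + R"] by (simp add: levy_weight_def)
      show "norm (\<bar>dx u r x\<bar> * tail_weight \<alpha> R (real n + R) x) \<le> 2 * \<bar>dx u r x\<bar>"
        using nonneg[of x] mult_left_mono[OF bounded[of x], of "\<bar>dx u r x\<bar>"] by (simp add: abs_mult)
    qed
    show "AE x in lborel. (\<lambda>n. \<bar>dx u r x\<bar> * tail_weight \<alpha> R (real n + R) x)
      \<longlonglongrightarrow> \<bar>dx u r x\<bar> * (1 + 1 / R - scaled_bump \<alpha> R x)"
    proof (rule AE_I2)
      fix x
      have "(\<lambda>n. tail_weight \<alpha> R (real n + R) x) \<longlonglongrightarrow> (1 + 1 / R) * 1 - scaled_bump \<alpha> R x"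
        unfolding tail_weight_def[OF \<alpha>] by (intro tendsto_intros scaled_bump_tendsto_1[OF \<alpha>])
      then show "(\<lambda>n. \<bar>dx u r x\<bar> * tail_weight \<alpha> R (real n + R) x) \<longlonglongrightarrow> \<bar>dx u r x\<bar> * (1 + 1 / R - scaled_bump \<alpha> R x)"
        by (intro tendsto_mult_left) simp
    qed
  qed
  have "0 < t" using st by simp
  have "(LBINT x. \<bar>dx u t x\<bar> * (1 + 1 / R - scaled_bump \<alpha> R x))
    \<le> E * (LBINT x. \<bar>dx u s x\<bar> * (1 + 1 / R - scaled_bump \<alpha> R x))"
    by (rule LIMSEQ_le[OF lim[OF \<open>0 < t\<close>] tendsto_mult_left[OF lim[OF st(1)], of E]]) (use step in auto)
  then show ?thesis by (simp add: E_def)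
qed

end

section \<open>Continuity in time of the gradient\<close>

context
  fixes \<alpha> :: real
  assumes \<alpha>: "1 < \<alpha>" "\<alpha> < 2"
begin

text \<open>Tightness and local uniform continuity. The tails at all times near t0 are controlled by
  the tail at the single earlier time s = t0 / 2, which is small for large R since u_x(s) is
  integrable; inside, \<open>dx u\<close> is Lipschitz in time with a constant independent of
  x.\<close>

lemma gradient_L1_continuous:
  assumes u: "is_solution \<alpha> u0 u" and d: "measure_datum u0" and t0: "0 < t0" and e: "0 < e"
  obtains \<delta> where "0 < \<delta>" "\<And>t. \<bar>t - t0\<bar> < \<delta> \<Longrightarrow> (LBINT x. \<bar>dx u t x - dx u t0 x\<bar>) < e"
proof -
  obtain V where i: "\<And>t. 0 < t \<Longrightarrow> integrable lborel (dx u t)"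
    using gradient_L1_bound[OF \<alpha> u d] by blast
  define s where "s = t0 / 2"
  define T where "T = t0 + 1"
  have sT: "0 < s" "s < t0" "t0 < T" "0 < s / 2" "s / 2 < T" "0 < T" using t0 by (auto simp: s_def T_def)
  obtain M where M: "1 \<le> M" "\<And>t x. 0 < t \<Longrightarrow> t < T \<Longrightarrow> \<bar>u t x\<bar> \<le> M"
    using is_solution_bounded[OF u sT(6)] by blast
  let ?I = "{s / 2<..<T}"
  obtain K where f: "regular_flow \<alpha> ?I u K" using is_solution_regular_flow[OF u sT(4,5)] by blast
  note C = flow_C2(1)[OF \<alpha> f]
  define tail where "tail R r = (LBINT x. \<bar>dx u r x\<bar> * (1 + 1 / R - scaled_bump \<alpha> R x))" for R r
  \<comment> \<open>A common bound for the growth factors from time s to any later time below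
    T.\<close>
  define E where "E = exp (3 * weight_const \<alpha> * (1 + M) * T)"
  have w0: "0 \<le> 1 + 1 / R - scaled_bump \<alpha> R x" "1 + 1 / R - scaled_bump \<alpha> R x \<le> 2" if "1 \<le> R" for R x
  proof -
    have "1 / R \<le> 1" "0 \<le> 1 / R" using that by auto
    then show "0 \<le> 1 + 1 / R - scaled_bump \<alpha> R x" "1 + 1 / R - scaled_bump \<alpha> R x \<le> 2"
      using scaled_bump_bounds[OF \<alpha>, of R x] by linarith+
  qed
  have it: "integrable lborel (\<lambda>x. \<bar>dx u r x\<bar> * (1 + 1 / R - scaled_bump \<alpha> R x))" if "1 \<le> R" "0 < r" for R r
  proof -
    have [measurable]: "scaled_bump \<alpha> R \<in> borel_measurable borel" by (rule scaled_bump_measurable[OF \<alpha>])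
    have "integrable lborel (\<lambda>x. (1 + 1 / R - scaled_bump \<alpha> R x) * \<bar>dx u r x\<bar>)"
    proof (rule integrable_mult_bounded[OF integrable_abs[OF i[OF that(2)]]])
      show "(\<lambda>x. 1 + 1 / R - scaled_bump \<alpha> R x) \<in> borel_measurable borel" by measurable
      show "\<bar>1 + 1 / R - scaled_bump \<alpha> R x\<bar> \<le> 2" for x
        using w0[OF that(1), of x] by (simp only: abs_of_nonneg)
    qed
    then show ?thesis by (simp add: mult.commute)
  qed
  have tail_le: "tail R r \<le> E * tail R s" if R: "1 \<le> R" and r: "s \<le> r" "r < T" for R r
  proof -
    have "tail R r \<le> exp (3 * weight_const \<alpha> * (1 + M) * (r - s)) * tail R s"
      unfolding tail_def by (rule gradient_tail_bound[OF \<alpha> u sT(1) r R M(2) i])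
    also have "\<dots> \<le> E * tail R s"
    proof (rule mult_right_mono)
      show "exp (3 * weight_const \<alpha> * (1 + M) * (r - s)) \<le> E"
        unfolding E_def using weight_const_ge_1[OF \<alpha>] M(1) r sT
        by (simp add: mult_left_mono)
      show "0 \<le> tail R s" unfolding tail_def using w0[OF R] by (intro integral_nonneg_AE) auto
    qed
    finally show ?thesis .
  qed
  have "(\<lambda>n. tail (real n + 1) s) \<longlonglongrightarrow> (\<integral>x. 0 \<partial>(lborel :: real measure))"
    unfolding tail_def
  proof (rule integral_dominated_convergence[where w="\<lambda>x. 2 * \<bar>dx u s x\<bar>"])
    show "(\<lambda>x. \<bar>dx u s x\<bar> * (1 + 1 / (real n + 1) - scaled_bump \<alpha> (real n + 1) x)) \<in> borel_measurable lborel" for n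
      using it[of "real n + 1" s] sT(1) by (intro borel_measurable_integrable) auto
    show "integrable lborel (\<lambda>x. 2 * \<bar>dx u s x\<bar>)" using i[OF sT(1)] by simp
    show "AE x in lborel. norm (\<bar>dx u s x\<bar> * (1 + 1 / (real n + 1) - scaled_bump \<alpha> (real n + 1) x)) \<le> 2 * \<bar>dx u s x\<bar>" for n
    proof (rule AE_I2)
      fix x
      have "\<bar>dx u s x\<bar> * (1 + 1 / (real n + 1) - scaled_bump \<alpha> (real n + 1) x) \<le> \<bar>dx u s x\<bar> * 2"
        by (intro mult_left_mono w0) auto
      moreover have "0 \<le> \<bar>dx u s x\<bar> * (1 + 1 / (real n + 1) - scaled_bump \<alpha> (real n + 1) x)"
        by (intro mult_nonneg_nonneg w0) auto
      ultimately show "norm (\<bar>dx u s x\<bar> * (1 + 1 / (real n + 1) - scaled_bump \<alpha> (real n + 1) x)) \<le> 2 * \<bar>dx u s x\<bar>"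
        unfolding real_norm_def by linarith
    qed
    show "AE x in lborel. (\<lambda>n. \<bar>dx u s x\<bar> * (1 + 1 / (real n + 1) - scaled_bump \<alpha> (real n + 1) x)) \<longlonglongrightarrow> 0"
    proof (rule AE_I2)
      fix x
      have "(\<lambda>n. \<bar>dx u s x\<bar> * (1 + 1 / (real n + 1) - scaled_bump \<alpha> (real n + 1) x)) \<longlonglongrightarrow> \<bar>dx u s x\<bar> * (1 + 0 - 1)"
        by (intro tendsto_intros scaled_bump_tendsto_1[OF \<alpha>] LIMSEQ_const_divide_add)
      then show "(\<lambda>n. \<bar>dx u s x\<bar> * (1 + 1 / (real n + 1) - scaled_bump \<alpha> (real n + 1) x)) \<longlonglongrightarrow> 0" by simp
    qed
  qed simp
  from tendsto_mult_left[OF this, of E] have "(\<lambda>n. E * tail (real n + 1) s) \<longlonglongrightarrow> 0" by simp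
  then have "\<forall>\<^sub>F n in sequentially. E * tail (real n + 1) s < e / 4" using e by (intro order_tendstoD(2)) auto
  then obtain n where n: "E * tail (real n + 1) s < e / 4" by (auto simp: eventually_sequentially)
  define R where "R = real n + 1"
  have R: "1 \<le> R" by (simp add: R_def)
  define P where "P = (LBINT x. scaled_bump \<alpha> R x)"
  have P0: "0 \<le> P" unfolding P_def using scaled_bump_bounds(1)[OF \<alpha>] by (intro integral_nonneg_AE AE_I2) (auto intro: less_imp_le)
  have K0: "0 \<le> K" using C2_boundedD(6)[OF C[of t0]] sT by auto
  \<comment> \<open>The entries t0 / 2 and 1 keep t between s and T; the last one makes the inner
    part at most e / 4, while each of the two tails takes less than e / 4.\<close>
  define \<delta> where "\<delta> = min (min (t0 / 2) 1) (e / (4 * (K * P + 1)))"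
  have KP: "0 \<le> K * P" using K0 P0 by simp
  have "0 < \<delta>" using t0 e KP by (simp add: \<delta>_def add_nonneg_pos)
  moreover have "(LBINT x. \<bar>dx u t x - dx u t0 x\<bar>) < e" if t: "\<bar>t - t0\<bar> < \<delta>" for t
  proof -
    have "\<bar>t - t0\<bar> < t0 / 2" "\<bar>t - t0\<bar> < 1" using t by (simp_all add: \<delta>_def)
    then have tb: "s \<le> t" "t < T" "0 < t" unfolding s_def T_def by linarith+
    have tI: "t \<in> ?I" "t0 \<in> ?I" using tb sT by auto
    have lip: "\<bar>dx u t x - dx u t0 x\<bar> \<le> K * \<bar>t - t0\<bar>" for x
      by (rule deriv_bound_lipschitz[of ?I "\<lambda>s. dx u s x" "\<lambda>s. dt (dx u) s x"])
         (use tI flow_time_deriv(2,6)[OF \<alpha> f] in auto)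
    let ?w = "\<lambda>x. 1 + 1 / R - scaled_bump \<alpha> R x"
    have ib: "integrable lborel (\<lambda>x. K * \<bar>t - t0\<bar> * scaled_bump \<alpha> R x)"
      using scaled_bump_integrable[OF \<alpha> R] by simp
    note i1 = it[OF R tb(3)] and i2 = it[OF R t0]
    have "(LBINT x. \<bar>dx u t x - dx u t0 x\<bar>)
      \<le> (LBINT x. K * \<bar>t - t0\<bar> * scaled_bump \<alpha> R x + (\<bar>dx u t x\<bar> * ?w x + \<bar>dx u t0 x\<bar> * ?w x))"
    proof (rule integral_mono)
      show "integrable lborel (\<lambda>x. \<bar>dx u t x - dx u t0 x\<bar>)"
        by (intro integrable_abs Bochner_Integration.integrable_diff i tb t0)
      show "integrable lborel (\<lambda>x. K * \<bar>t - t0\<bar> * scaled_bump \<alpha> R x + (\<bar>dx u t x\<bar> * ?w x + \<bar>dx u t0 x\<bar> * ?w x))"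
        by (intro Bochner_Integration.integrable_add ib i1 i2)
      fix x
      let ?b = "scaled_bump \<alpha> R x"
      have b: "0 \<le> ?b" "?b \<le> 1" using scaled_bump_bounds[OF \<alpha>, of R x] by auto
      \<comment> \<open>A partition of unity: the bump carries the Lipschitz bound, and its
        complement is dominated by the tail weight.\<close>
      have "\<bar>dx u t x - dx u t0 x\<bar> = \<bar>dx u t x - dx u t0 x\<bar> * ?b + \<bar>dx u t x - dx u t0 x\<bar> * (1 - ?b)"
        by (simp add: algebra_simps)
      also have "\<dots> \<le> K * \<bar>t - t0\<bar> * ?b + (\<bar>dx u t x\<bar> + \<bar>dx u t0 x\<bar>) * ?w x"
        using b lip[of x] R by (intro add_mono mult_mono) auto
      finally show "\<bar>dx u t x - dx u t0 x\<bar> \<le> K * \<bar>t - t0\<bar> * ?b + (\<bar>dx u t x\<bar> * ?w x + \<bar>dx u t0 x\<bar> * ?w x)"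
        by (simp only: distrib_right)
    qed
    also have "\<dots> = K * \<bar>t - t0\<bar> * P + (tail R t + tail R t0)"
      unfolding Bochner_Integration.integral_add[OF ib Bochner_Integration.integrable_add[OF i1 i2]]
        Bochner_Integration.integral_add[OF i1 i2] tail_def P_def by simp
    also have "\<dots> < e"
    proof -
      have "tail R t + tail R t0 < e / 2"
        using tail_le[OF R tb(1,2)] tail_le[OF R _ sT(3)] sT n by (simp add: R_def)
      moreover have "K * \<bar>t - t0\<bar> * P \<le> e / 4"
      proof -
        have "K * \<bar>t - t0\<bar> * P = (K * P) * \<bar>t - t0\<bar>" by simp
        also have "\<dots> \<le> (K * P) * (e / (4 * (K * P + 1)))"
          using t KP by (intro mult_left_mono) (auto simp: \<delta>_def)
        also have "\<dots> = (e / 4) * (K * P / (K * P + 1))" by simp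
        also have "\<dots> \<le> (e / 4) * 1" using e KP by (intro mult_left_mono) auto
        finally show ?thesis by simp
      qed
      ultimately show ?thesis using e by linarith
    qed
    finally show ?thesis .
  qed
  ultimately show ?thesis using that by blast
qed

section \<open>Interpolation between the integral norm and the sup norm\<close>

lemma powr_le_mult_powr:
  assumes "\<bar>x\<bar> \<le> L" "0 < L" "1 \<le> p"
  shows "\<bar>x\<bar> powr p \<le> L powr (p - 1) * \<bar>x :: real\<bar>"
proof (cases "x = 0")
  case False
  have "\<bar>x\<bar> powr p = \<bar>x\<bar> powr (p - 1) * \<bar>x\<bar>" using False by (simp add: powr_diff)
  also have "\<dots> \<le> L powr (p - 1) * \<bar>x\<bar>" using assms by (intro mult_right_mono powr_mono2) auto
  finally show ?thesis .
qed simp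

lemma gradient_Lp_cont:
  assumes u: "is_solution \<alpha> u0 u" and d: "measure_datum u0" and T: "0 < T" and p: "1 \<le> p"
  shows "Lp_cont p {0<..T} (dx u)"
proof -
  obtain V where i: "\<And>t. 0 < t \<Longrightarrow> integrable lborel (dx u t)"
    using gradient_L1_bound[OF \<alpha> u d] by blast
  \<comment> \<open>The interval reaches beyond T, so that t0 = T is an interior point, and starts
    at t0 / 2, since K may degenerate towards time 0.\<close>
  have loc: "\<exists>K>0. \<forall>t\<in>{t0 / 2<..<T + 1}. \<forall>x. \<bar>dx u t x\<bar> \<le> K" if t0: "0 < t0" "t0 \<le> T" for t0
  proof -
    have "0 < t0 / 2" "t0 / 2 < T + 1" using t0 by auto
    then obtain K where f: "regular_flow \<alpha> {t0 / 2<..<T + 1} u K" using is_solution_regular_flow[OF u] by blast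
    then have "\<forall>t\<in>{t0 / 2<..<T + 1}. \<forall>x. \<bar>dx u t x\<bar> \<le> max 1 K"
      using C2_boundedD(4)[OF flow_C2(1)[OF \<alpha> f]] by (auto simp: le_max_iff_disj)
    then show ?thesis by (intro exI[of _ "max 1 K"]) auto
  qed
  have pint: "integrable lborel (\<lambda>x. \<bar>g x\<bar> powr p)" "(LBINT x. \<bar>g x\<bar> powr p) \<le> L powr (p - 1) * (LBINT x. \<bar>g x\<bar>)"
    if g: "integrable lborel g" and L: "0 < L" "\<And>x. \<bar>g x\<bar> \<le> L" for g :: "real \<Rightarrow> real" and L
  proof -
    have [measurable]: "g \<in> borel_measurable borel" using g by auto
    have i2: "integrable lborel (\<lambda>x. L powr (p - 1) * \<bar>g x\<bar>)" using g by simp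
    have le: "\<bar>g x\<bar> powr p \<le> L powr (p - 1) * \<bar>g x\<bar>" for x by (rule powr_le_mult_powr[OF L(2,1) p])
    show i1: "integrable lborel (\<lambda>x. \<bar>g x\<bar> powr p)"
      by (rule Bochner_Integration.integrable_bound[OF i2]) (use le in \<open>auto simp: abs_mult\<close>)
    show "(LBINT x. \<bar>g x\<bar> powr p) \<le> L powr (p - 1) * (LBINT x. \<bar>g x\<bar>)"
      using integral_mono[OF i1 i2 le] by simp
  qed
  show ?thesis
    unfolding Lp_cont_def
  proof (intro conjI ballI)
    fix t assume t: "t \<in> {0<..T}"
    then have t': "0 < t" "t \<le> T" by auto
    show "dx u t \<in> borel_measurable lborel" using i[OF t'(1)] by auto
    obtain K where K: "0 < K" "\<forall>s\<in>{t / 2<..<T + 1}. \<forall>x. \<bar>dx u s x\<bar> \<le> K" using loc[OF t'] by blast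
    show "integrable lborel (\<lambda>x. \<bar>dx u t x\<bar> powr p)" by (rule pint(1)[OF i[OF t'(1)] K(1)]) (use K(2) t' in auto)
  next
    fix t0 assume "t0 \<in> {0<..T}"
    then have t0: "0 < t0" "t0 \<le> T" by auto
    obtain K where K: "0 < K" "\<forall>s\<in>{t0 / 2<..<T + 1}. \<forall>x. \<bar>dx u s x\<bar> \<le> K" using loc[OF t0] by blast
    let ?N = "\<lambda>t. \<integral>x. \<bar>dx u t x - dx u t0 x\<bar> \<partial>lborel"
    have N0: "0 \<le> ?N t" for t by (intro integral_nonneg_AE) auto
    have lim: "(?N \<longlongrightarrow> 0) (at t0 within {0<..T})"
    proof (rule tendstoI)
      fix e :: real assume "0 < e"
      then obtain \<delta> where \<delta>: "0 < \<delta>" "\<And>t. \<bar>t - t0\<bar> < \<delta> \<Longrightarrow> ?N t < e"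
        using gradient_L1_continuous[OF u d t0(1)] by blast
      then show "\<forall>\<^sub>F t in at t0 within {0<..T}. dist (?N t) 0 < e"
        unfolding eventually_at using N0 by (intro exI[of _ \<delta>]) (auto simp: dist_real_def)
    qed
    have "((\<lambda>t. LBINT x. \<bar>dx u t x - dx u t0 x\<bar> powr p) \<longlongrightarrow> 0) (at t0 within {0<..T})"
    proof (rule tendsto_sandwich[OF _ _ tendsto_const])
      show "\<forall>\<^sub>F t in at t0 within {0<..T}. 0 \<le> (LBINT x. \<bar>dx u t x - dx u t0 x\<bar> powr p)"
        by (intro always_eventually allI integral_nonneg_AE) auto
      show "((\<lambda>t. (2 * K) powr (p - 1) * ?N t) \<longlongrightarrow> 0) (at t0 within {0<..T})"
        using tendsto_mult_left[OF lim, of "(2 * K) powr (p - 1)"] by simp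
      show "\<forall>\<^sub>F t in at t0 within {0<..T}. (LBINT x. \<bar>dx u t x - dx u t0 x\<bar> powr p) \<le> (2 * K) powr (p - 1) * ?N t"
        unfolding eventually_at
      proof (intro exI[of _ "t0 / 2"] conjI ballI impI)
        fix t assume "t \<in> {0<..T}" "t \<noteq> t0 \<and> dist t t0 < t0 / 2"
        then have t: "t \<in> {t0 / 2<..<T + 1}" "0 < t" by (auto simp: dist_real_def abs_if split: if_splits)
        have t0I: "t0 \<in> {t0 / 2<..<T + 1}" using t0 by auto
        show "(LBINT x. \<bar>dx u t x - dx u t0 x\<bar> powr p) \<le> (2 * K) powr (p - 1) * ?N t"
        proof (rule pint(2))
          show "integrable lborel (\<lambda>x. dx u t x - dx u t0 x)"
            by (intro Bochner_Integration.integrable_diff i t(2) t0(1))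
          show "\<bar>dx u t x - dx u t0 x\<bar> \<le> 2 * K" for x
            using K(2)[rule_format, OF t(1), of x] K(2)[rule_format, OF t0I, of x] by linarith
        qed (use K in simp)
      qed (use t0 in simp)
    qed
    then show "((\<lambda>t. (LBINT x. \<bar>dx u t x - dx u t0 x\<bar> powr p) powr (1 / p)) \<longlongrightarrow> 0) (at t0 within {0<..T})"
    proof (rule tendsto_zero_powrI)
      show "\<forall>\<^sub>F t in at t0 within {0<..T}. 0 \<le> (LBINT x. \<bar>dx u t x - dx u t0 x\<bar> powr p)"
        by (intro always_eventually allI integral_nonneg_AE) auto
      show "0 < 1 / p" using p by simp
    qed (rule tendsto_const)
  qed
qed

text \<open>The mixed derivative \<open>dt (dx u)\<close> is bounded near t0, so \<open>dx u\<close>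
  is Lipschitz in time uniformly in x.\<close>

lemma gradient_Linf_cont:
  assumes u: "is_solution \<alpha> u0 u" and T: "0 < T"
  shows "Linf_cont {0<..T} (dx u)"
proof -
  have loc: "\<exists>K>0. (\<forall>t\<in>{t0 / 2<..<T + 1}. dx u t \<in> borel_measurable borel \<and>
     (\<forall>x. \<bar>dx u t x\<bar> \<le> K \<and> \<bar>dx u t x - dx u t0 x\<bar> \<le> K * \<bar>t - t0\<bar>))" if t0: "0 < t0" "t0 \<le> T" for t0
  proof -
    have a: "0 < t0 / 2" "t0 / 2 < T + 1" using t0 by auto
    then obtain K where f: "regular_flow \<alpha> {t0 / 2<..<T + 1} u K" using is_solution_regular_flow[OF u] by blast
    note C = flow_C2(1)[OF \<alpha> f]
    have t0I: "t0 \<in> {t0 / 2<..<T + 1}" using t0 by auto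
    have lip: "\<bar>dx u t x - dx u t0 x\<bar> \<le> K * \<bar>t - t0\<bar>" if "t \<in> {t0 / 2<..<T + 1}" for t x
      by (rule deriv_bound_lipschitz[of "{t0 / 2<..<T + 1}" "\<lambda>s. dx u s x" "\<lambda>s. dt (dx u) s x"])
         (use that t0I flow_time_deriv(2,6)[OF \<alpha> f] in auto)
    have K0: "0 \<le> K" using C2_boundedD(6)[OF C[OF t0I]] .
    have "\<bar>dx u t x\<bar> \<le> K + 1 \<and> \<bar>dx u t x - dx u t0 x\<bar> \<le> (K + 1) * \<bar>t - t0\<bar>" if "t \<in> {t0 / 2<..<T + 1}" for t x
      using C2_boundedD(4)[OF C[OF that], of x] lip[OF that, of x] by (simp add: distrib_right)
    then show ?thesis using K0 C2_bounded_measurable(2)[OF C] by (intro exI[of _ "K + 1"]) auto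
  qed
  show ?thesis
    unfolding Linf_cont_def
  proof (intro conjI ballI allI impI)
    fix t assume "t \<in> {0<..T}"
    then have t: "0 < t" "t \<le> T" by auto
    then have tI: "t \<in> {t / 2<..<T + 1}" by auto
    obtain K where K: "0 < K" "dx u t \<in> borel_measurable borel" "\<forall>x. \<bar>dx u t x\<bar> \<le> K" using loc[OF t] tI by blast
    show "dx u t \<in> borel_measurable lborel" using K(2) by simp
    show "\<exists>C. AE x in lborel. \<bar>dx u t x\<bar> \<le> C" using K(3) by (intro exI[of _ K]) auto
  next
    fix t0 e :: real assume "t0 \<in> {0<..T}" and e: "0 < e"
    then have t0: "0 < t0" "t0 \<le> T" by auto
    obtain K where K: "0 < K" "\<forall>t\<in>{t0 / 2<..<T + 1}. \<forall>x. \<bar>dx u t x - dx u t0 x\<bar> \<le> K * \<bar>t - t0\<bar>"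
      using loc[OF t0] by blast
    show "\<exists>\<delta>>0. \<forall>t\<in>{0<..T}. \<bar>t - t0\<bar> < \<delta> \<longrightarrow> (AE x in lborel. \<bar>dx u t x - dx u t0 x\<bar> \<le> e)"
    proof (intro exI[of _ "min (t0 / 2) (e / K)"] conjI ballI impI)
      show "0 < min (t0 / 2) (e / K)" using t0 e K(1) by simp
      fix t assume t: "t \<in> {0<..T}" "\<bar>t - t0\<bar> < min (t0 / 2) (e / K)"
      then have tI: "t \<in> {t0 / 2<..<T + 1}" by (auto simp: abs_if split: if_splits)
      have "K * \<bar>t - t0\<bar> \<le> e" using t(2) K(1) by (simp add: field_simps)
      then have "\<bar>dx u t x - dx u t0 x\<bar> \<le> e" for x using K(2) tI by (meson order_trans)
      then show "AE x in lborel. \<bar>dx u t x - dx u t0 x\<bar> \<le> e" by simp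
    qed
  qed
qed

end

theorem theorem2p2:
  fixes \<alpha> :: real
  assumes "1 < \<alpha>" and "\<alpha> < 2"
  shows "(\<forall>u0 u. measure_datum u0 \<and> is_solution \<alpha> u0 u \<longrightarrow>
            (\<forall>T>0. (\<forall>p::real. 1 \<le> p \<longrightarrow> Lp_cont p {0<..T} (\<lambda>t x. deriv (u t) x)) \<and>
                    Linf_cont {0<..T} (\<lambda>t x. deriv (u t) x))) \<and>
         (\<forall>u0 v0 u v. measure_datum u0 \<and> measure_datum v0 \<and>
            is_solution \<alpha> u0 u \<and> is_solution \<alpha> v0 v \<and>
            (\<forall>t>0. AE x in lborel. deriv (v t) x \<ge> 0) \<and>
            integrable lborel (\<lambda>x. u0 x - v0 x) \<longrightarrow>
            (\<forall>t>0. (\<integral>\<^sup>+ x. ennreal \<bar>u t x - v t x\<bar> \<partial>lborel)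
                     \<le> (\<integral>\<^sup>+ x. ennreal \<bar>u0 x - v0 x\<bar> \<partial>lborel)))"
proof (intro conjI allI impI)
  fix u0 u and T :: real
  assume a: "measure_datum u0 \<and> is_solution \<alpha> u0 u" and T: "0 < T"
  have dx: "(\<lambda>t x. deriv (u t) x) = dx u" by (simp add: dx_def fun_eq_iff)
  show "Lp_cont p {0<..T} (\<lambda>t x. deriv (u t) x)" if "1 \<le> p" for p
    unfolding dx using gradient_Lp_cont[OF assms] a T that by blast
  show "Linf_cont {0<..T} (\<lambda>t x. deriv (u t) x)"
    unfolding dx using gradient_Linf_cont[OF assms] a T by blast
next
  fix u0 v0 :: "real \<Rightarrow> real" and u v and t :: real
  assume a: "measure_datum u0 \<and> measure_datum v0 \<and> is_solution \<alpha> u0 u \<and> is_solution \<alpha> v0 v \<and>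
    (\<forall>t>0. AE x in lborel. deriv (v t) x \<ge> 0) \<and> integrable lborel (\<lambda>x. u0 x - v0 x)" and t: "0 < t"
  then have i: "integrable lborel (\<lambda>x. u0 x - v0 x)" by blast
  obtain B where u0: "u0 \<in> borel_measurable borel" "\<And>x. \<bar>u0 x\<bar> \<le> B" using measure_datum_properties a by metis
  obtain B' where v0: "v0 \<in> borel_measurable borel" "\<And>x. \<bar>v0 x\<bar> \<le> B'" using measure_datum_properties a by metis
  have "(\<integral>\<^sup>+ x. ennreal \<bar>u t x - v t x\<bar> \<partial>lborel) \<le> ennreal (\<integral>x. \<bar>u0 x - v0 x\<bar> \<partial>lborel)"
  proof (rule L1_contraction[OF assms])
    show "\<bar>u0 x\<bar> \<le> max B B'" "\<bar>v0 x\<bar> \<le> max B B'" for x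
      using u0(2)[of x] v0(2)[of x] by auto
  qed (use a t u0(1) v0(1) in auto)
  \<comment> \<open>Integrability of the difference of the data makes the two integrals agree;
    without it the Bochner integral would take its default value 0.\<close>
  also have "\<dots> = (\<integral>\<^sup>+ x. ennreal \<bar>u0 x - v0 x\<bar> \<partial>lborel)"
    using i by (intro nn_integral_eq_integral[symmetric]) auto
  finally show "(\<integral>\<^sup>+ x. ennreal \<bar>u t x - v t x\<bar> \<partial>lborel) \<le> (\<integral>\<^sup>+ x. ennreal \<bar>u0 x - v0 x\<bar> \<partial>lborel)" .
qed

end
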